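(* Let $g>0$ and $0<B_L<B_R$, and put $r=B_L/B_R\in(0,1)$. Consider the Riemann problem for the one-dimensional variable-width Shallow water Equations at a width jump, $$\frac{\partial (B\mathbf u)}{\partial t}+\frac{\partial (B\,\mathbf f(\mathbf u))}{\partial x}+\mathbf h(\mathbf u)\frac{\partial B}{\partial x}=0,\qquad \mathbf u(x,0)=\begin{cases}\mathbf u_L,&x<0\\ \mathbf u_R,&x>0\end{cases},\qquad B(x)=\begin{cases}B_L,&x<0\\ B_R,&x>0\end{cases},$$ where $\mathbf u=(h,hu)^T$, $\mathbf f(\mathbf u)=(hu,\ \tfrac12 gh^2+hu^2)^T$, $\mathbf h(\mathbf u)=(0,-\tfrac12 gh^2)^T$, with initial states $\mathbf u_L=(h_L,h_Lu_L)^T$, $\mathbf u_R=(h_R,h_Ru_R)^T$, $h_L,h_R>0$, and let $F_R=u_R/\sqrt{gh_R}$. Solutions, and their number, are understood in the sense defined in the context (intersections of the L-M curve of $\mathbf u_L$ with the branches of the R-M locus of $\mathbf u_R$, or formation of a dry bed). Then: 1. For all $\mathbf u_L,\mathbf u_R$ a solution of the Riemann problem exists. 2. If $F_R>-K_{sp}(r)$, then for every $\mathbf u_L$ the solution is unique. 3. If $F_R\le -K_{sp}(r)$, the solution may be unique or triple depending on $\mathbf u_L$: for every $\mathbf u_L$ the number of solutions, counted with multiplicity over the branches of the R-M locus, is either one or three, and both cases occur for suitable $\mathbf u_L$.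
   Context: **States.** States are identified with points $(h,u)$, $h\ge 0$, of the $(h,u)$ plane. For $h>0$ the Froude number is $F=u/\sqrt{gh}$; a state is subcritical, critical, supercritical if $|F|<1$, $|F|=1$, $|F|>1$. Write $F_L=u_L/\sqrt{gh_L}$. **Elementary curves.** For a reference state $\mathbf a=(h_a,u_a)$: - $R_1(\mathbf a)$: $u=u_a+2\sqrt{gh_a}-2\sqrt{gh}$, $0\le h\le h_a$. - $S_1(\mathbf a)$: $u=u_a-(h-h_a)\sqrt{\tfrac g2(1/h+1/h_a)}$, $h\ge h_a$. - $R_2^B(\mathbf a)$: $u=u_a-2\sqrt{gh_a}+2\sqrt{gh}$, $0\le h\le h_a$. - $S_2^B(\mathbf a)$: $u=u_a+(h-h_a)\sqrt{\tfrac g2(1/h+1/h_a)}$, $h\ge h_a$. - $T_1=R_1\cup S_1$, $T_2^B=R_2^B\cup S_2^B$. - $CD(\mathbf a)$: $u=h_au_a/h$ (constant unit-width discharge). **Froude limits.** $K_{sb}(r)\in(0,1)$ and $K_{sp}(r)\in(1,\infty)$ are the two positive roots $K$ of $1+\tfrac12K^2=\tfrac32 (K/r)^{2/3}$. They are the Froude numbers in the section of width $B_R$ for which the flow with the same discharge and specific energy is critical in the section of width $B_L$. Moreover $K_{jump}(r)=\sqrt8\,K_{sb}(r)\bigl(-1+\sqrt{1+8K_{sb}(r)^2}\bigr)^{-3/2}$, which is larger than $K_{sp}(r)$. **Conjugate states.** - Hydraulic jump: for a supercritical state $\mathbf a$ (trivially extended to critical ones, for which $\mathbf a^\#=\mathbf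 a$), $\mathbf a^\#$ is the subcritical state with $h_a^\#=\tfrac12h_a(\sqrt{1+8F_a^2}-1)$ and $h_a^\#u_a^\#=h_au_a$. - Smooth transition: for a state $\mathbf a$ on one side of the width jump (width $B_L$ on the left, $B_R$ on the right), $\mathbf a^0$ is the state on the other side with the same discharge $Q=Bhu$ and the same specific energy $h+u^2/(2g)$ and in the same flow regime (both subcritical, or both supercritical, limiting critical cases included). States at rest satisfy $\mathbf a^0=\mathbf a$. For right states $\mathbf a^0$ exists only if $|F_a|\le K_{sb}(r)$ or $|F_a|\ge K_{sp}(r)$, and it is critical in the equality cases. A critical left state has two such right conjugates: a subcritical one with $|F|=K_{sb}(r)$ and a supercritical one with $|F|=K_{sp}(r)$. - Combined superscripts are read from left to right: $\mathbf a^{0\#}=(\mathbf a^0)^\#$, $\mathbf a^{\#0}=(\mathbf a^\#)^0$. **L-M curve of $\mathbf u_L$** (flow depths increase along the listed pieces; it is the graph of a function $u=f_{LM}(h)$ on $[0,+\infty)$, and its dry state is $\mathbf I=(0,u_I)$ with $u_I=f_{LM}(0)$). When $F_L\ge-2$, $\mathbf K_L$ denotes the state of $T_1(\mathbf u_L)$ with $u=0$. - $F_L<-2$ (type $I_L$): the curve $T_1(\mathbf u_L)$. - $-2\le F_L\le1$ (type $II_L$): let $\boldsymbol\gamma$ be the intersection of $R_1(\mathbf u_L)$ with $u=\sqrt{gh}$, and let $\boldsymbol\gamma_{sp}$, $\boldsymbol\gamma_{sb}$ be its supercritical and subcritical right conjugates by smooth transition. The curve is the union of: $R_1(\boldsymbol\gamma_{sp})$;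 $S_1(\boldsymbol\gamma_{sp})$ between $\boldsymbol\gamma_{sp}$ and $\boldsymbol\gamma_{sp}^\#$; $CD(\boldsymbol\gamma_{sp})$ between $\boldsymbol\gamma_{sp}^\#$ and $\boldsymbol\gamma_{sb}$; the locus of the subcritical right conjugates $\mathbf a^0$ of the states $\mathbf a\in T_1(\mathbf u_L)$ between $\boldsymbol\gamma$ and $\mathbf K_L$; the part of $T_1(\mathbf u_L)$ with $u<0$. (For $F_L=-2$ all pieces but the last degenerate to $(0,0)$.) - $F_L>1$ (type $III_L$): the union of: $R_1(\mathbf u_L^0)$; $S_1(\mathbf u_L^0)$ between $\mathbf u_L^0$ and $\mathbf u_L^{0\#}$; $CD(\mathbf u_L^0)$ between $\mathbf u_L^{0\#}$ and $\mathbf u_L^{\#0}$; the locus of the subcritical right conjugates $\mathbf a^0$ of the states $\mathbf a\in S_1(\mathbf u_L)$ between $\mathbf u_L^\#$ and $\mathbf K_L$; the part of $T_1(\mathbf u_L)$ with $u<0$. **R-M locus of $\mathbf u_R$.** When $F_R\le2$, $\mathbf K_R$ denotes the state of $T_2^B(\mathbf u_R)$ with $u=0$. Every branch below is the graph of a function of $h$ on an interval. - $F_R>2$ (type $I_R$): a single branch, $T_2^B(\mathbf u_R)$. - For $-K_{jump}(r)<F_R\le2$, let $\boldsymbol\alpha_{sb}$ be the intersection of $T_2^B(\mathbf u_R)$ with $u=-K_{sb}(r)\sqrt{gh}$, $\boldsymbol\alpha=\boldsymbol\alpha_{sb}^0$ its critical left conjugate, and $RS$ the locus of the subcritical (critical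 at $\boldsymbol\alpha$) left conjugates $\mathbf a^0$ of the states $\mathbf a\in T_2^B(\mathbf u_R)$ between $\boldsymbol\alpha_{sb}$ and $\mathbf K_R$. - $-K_{sp}(r)<F_R\le2$ (type $II_R$): a single branch, the union of $R_2^B(\boldsymbol\alpha)$, $RS$, and the part of $T_2^B(\mathbf u_R)$ with $u>0$. (For $F_R=2$ the first two pieces degenerate to $(0,0)$.) - $-K_{jump}(r)<F_R\le-K_{sp}(r)$ (type $III_R$): let $\boldsymbol\beta$ be the intersection of $CD(\mathbf u_R^0)$ with $u=-\sqrt{gh}$. Three branches: (1) the union of $R_2^B(\boldsymbol\alpha)$, $RS$, and the part of $T_2^B(\mathbf u_R)$ with $u>0$; (2) the union of $R_2^B(\boldsymbol\beta)$ and $CD(\mathbf u_R^0)$ between $\boldsymbol\beta$ and $\mathbf u_R^{0\#}$; (3) the union of $R_2^B(\mathbf u_R^0)$ and $S_2^B(\mathbf u_R^0)$ between $\mathbf u_R^0$ and $\mathbf u_R^{0\#}$. - $F_R\le-K_{jump}(r)$ (type $IV_R$): three branches: (1) the union of the locus of the subcritical left conjugates $\mathbf a^0$ of the states $\mathbf a\in S_2^B(\mathbf u_R)$ between $\mathbf u_R^\#$ and $\mathbf K_R$ (its endpoints being $\mathbf u_R^{\#0}$ and $\mathbf K_R$), and the part of $T_2^B(\mathbf u_R)$ with $u>0$; (2) $CD(\mathbf u_R^0)$ between $\mathbf u_R^{\#0}$ and $\mathbf u_R^{0\#}$; (3) the union of $R_2^B(\mathbf u_R^0)$ and $S_2^B(\mathbf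 u_R^0)$ between $\mathbf u_R^0$ and $\mathbf u_R^{0\#}$. Here $\mathbf u_L$, $\mathbf u_L^\#$ are regarded as left states and $\mathbf u_R$, $\mathbf u_R^\#$ as right states when the superscript $0$ is applied. Each branch includes its endpoints with finite depth. A branch whose depths reach $h=0$ has a dry state $\mathbf J=(0,u_J)$, its value at $h=0$. **Solutions and their number.** A solution is a self-similar wave configuration made of shocks and rarefactions of the classic Shallow water Equations in $x<0$ and $x>0$ and a standing wave at $x=0$ (a stationary weak solution through a smooth monotone width variation: discharge is invariant, and specific energy is invariant except for a possible hydraulic jump inside the transition). Such configurations are encoded as follows. For each branch of the R-M locus: - each intersection point $\mathbf u_M$ of the L-M curve with that branch gives one solution; - if the branch has a dry state $\mathbf J$ and $u_I<u_J$, the branch gives one solution with formation of a dry bed (the dry state $\mathbf I$ is connected to the left part of the configuration and $\mathbf J$ to the right part). There are no other solutions. Solutions are counted branch by branch, so that a point common to two branches counts once for each of them (two of three solutions may thus coincide). "Unique" means that the total count is one, "triple" that it is three. *)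

theory Defs
  imports "HOL-Analysis.Analysis"
begin

text \<open>
  A state is a pair \<open>(h, u)\<close> of flow depth and velocity; \<open>g\<close> is the gravitational acceleration and
  \<open>B\<^sub>L\<close>, \<open>B\<^sub>R\<close> are the widths to the left and to the right of the width jump.
\<close>

type_synonym state = "real \<times> real"

definition froude :: "real \<Rightarrow> state \<Rightarrow> real" where
  "froude g a = snd a / sqrt (g * fst a)"


section \<open>Elementary curves\<close>

definition R1 :: "real \<Rightarrow> state \<Rightarrow> state set" where
  "R1 g a = {(h, u). 0 \<le> h \<and> h \<le> fst a \<and>
     u = snd a + 2 * sqrt (g * fst a) - 2 * sqrt (g * h)}"

definition S1 :: "real \<Rightarrow> state \<Rightarrow> state set" where
  "S1 g a = {(h, u). h \<ge> fst a \<and>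
     u = snd a - (h - fst a) * sqrt (g / 2 * (1 / h + 1 / fst a))}"

definition R2B :: "real \<Rightarrow> state \<Rightarrow> state set" where
  "R2B g a = {(h, u). 0 \<le> h \<and> h \<le> fst a \<and>
     u = snd a - 2 * sqrt (g * fst a) + 2 * sqrt (g * h)}"

definition S2B :: "real \<Rightarrow> state \<Rightarrow> state set" where
  "S2B g a = {(h, u). h \<ge> fst a \<and>
     u = snd a + (h - fst a) * sqrt (g / 2 * (1 / h + 1 / fst a))}"

definition T1 :: "real \<Rightarrow> state \<Rightarrow> state set" where
  "T1 g a = R1 g a \<union> S1 g a"

definition T2B :: "real \<Rightarrow> state \<Rightarrow> state set" where
  "T2B g a = R2B g a \<union> S2B g a"

text \<open>
  The restriction \<open>h > 0\<close> matters: division by zero would otherwise put the dry state \<open>(0, 0)\<close> on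
  every such curve.
\<close>

definition CD :: "state \<Rightarrow> state set" where
  "CD a = {(h, u). h > 0 \<and> u = fst a * snd a / h}"

definition between :: "state set \<Rightarrow> state \<Rightarrow> state \<Rightarrow> state set" where
  "between C a b = {s \<in> C. fst s \<in> closed_segment (fst a) (fst b)}"


section \<open>Froude limits\<close>

definition K_sb :: "real \<Rightarrow> real" where
  "K_sb r = (THE K. 0 < K \<and> K < 1 \<and> 1 + K\<^sup>2 / 2 = 3 / 2 * (K / r) powr (2 / 3))"

definition K_sp :: "real \<Rightarrow> real" where
  "K_sp r = (THE K. 1 < K \<and> 1 + K\<^sup>2 / 2 = 3 / 2 * (K / r) powr (2 / 3))"

definition K_jump :: "real \<Rightarrow> real" where
  "K_jump r = sqrt 8 * K_sb r * (- 1 + sqrt (1 + 8 * (K_sb r)\<^sup>2)) powr (- 3 / 2)"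


section \<open>Conjugate states\<close>

definition jump_conj :: "real \<Rightarrow> state \<Rightarrow> state" where
  "jump_conj g a =
     (let h = 1 / 2 * fst a * (sqrt (1 + 8 * (froude g a)\<^sup>2) - 1) in (h, fst a * snd a / h))"

definition discharge :: "real \<Rightarrow> state \<Rightarrow> real" where
  "discharge B a = B * fst a * snd a"

definition specific_energy :: "real \<Rightarrow> state \<Rightarrow> real" where
  "specific_energy g a = fst a + (snd a)\<^sup>2 / (2 * g)"

text \<open>
  The two flow regimes, each including the critical states. For positive depth they say
  \<open>\<bar>F\<bar> \<le> 1\<close> and \<open>\<bar>F\<bar> \<ge> 1\<close>; without the division, the state \<open>(0, 0)\<close> belongs to both of them, so that it
  is its own conjugate in either regime, as the degenerate cases \<open>F\<^sub>L = - 2\<close> and \<open>F\<^sub>R = 2\<close> require.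
\<close>

definition subcritical_le :: "real \<Rightarrow> state \<Rightarrow> bool" where
  "subcritical_le g a \<longleftrightarrow> \<bar>snd a\<bar> \<le> sqrt (g * fst a)"

definition supercritical_le :: "real \<Rightarrow> state \<Rightarrow> bool" where
  "supercritical_le g a \<longleftrightarrow> sqrt (g * fst a) \<le> \<bar>snd a\<bar>"

text \<open>
  Smooth transition from a state \<open>a\<close> in the section of width \<open>B\<close> to a state \<open>b\<close> in the section of
  width \<open>B'\<close>. A critical left state has a conjugate in either regime, so the regime is part of the
  notion: \<open>conj_sb\<close> and \<open>conj_sp\<close> are the conjugate states in the subcritical and the supercritical
  regime.
\<close>

definition smooth_transition :: "real \<Rightarrow> real \<Rightarrow> real \<Rightarrow> state \<Rightarrow> state \<Rightarrow> bool" where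
  "smooth_transition g B B' a b \<longleftrightarrow>
     0 \<le> fst b \<and> discharge B a = discharge B' b \<and> specific_energy g a = specific_energy g b"

definition is_conj_sb :: "real \<Rightarrow> real \<Rightarrow> real \<Rightarrow> state \<Rightarrow> state \<Rightarrow> bool" where
  "is_conj_sb g B B' a b \<longleftrightarrow>
     smooth_transition g B B' a b \<and> subcritical_le g a \<and> subcritical_le g b"

definition is_conj_sp :: "real \<Rightarrow> real \<Rightarrow> real \<Rightarrow> state \<Rightarrow> state \<Rightarrow> bool" where
  "is_conj_sp g B B' a b \<longleftrightarrow>
     smooth_transition g B B' a b \<and> supercritical_le g a \<and> supercritical_le g b"

definition conj_sb :: "real \<Rightarrow> real \<Rightarrow> real \<Rightarrow> state \<Rightarrow> state" where
  "conj_sb g B B' a = (THE b. is_conj_sb g B B' a b)"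

definition conj_sp :: "real \<Rightarrow> real \<Rightarrow> real \<Rightarrow> state \<Rightarrow> state" where
  "conj_sp g B B' a = (THE b. is_conj_sp g B B' a b)"

definition conj_sb_locus :: "real \<Rightarrow> real \<Rightarrow> real \<Rightarrow> state set \<Rightarrow> state set" where
  "conj_sb_locus g B B' C = {b. \<exists>a\<in>C. is_conj_sb g B B' a b}"


section \<open>The L-M curve\<close>

definition K_L :: "real \<Rightarrow> state \<Rightarrow> state" where
  "K_L g uL = (THE s. s \<in> T1 g uL \<and> snd s = 0)"

definition LM_I :: "real \<Rightarrow> state \<Rightarrow> state set" where
  "LM_I g uL = T1 g uL"

definition gamma_L :: "real \<Rightarrow> state \<Rightarrow> state" where
  "gamma_L g uL = (THE s. s \<in> R1 g uL \<and> snd s = sqrt (g * fst s))"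

definition LM_II :: "real \<Rightarrow> real \<Rightarrow> real \<Rightarrow> state \<Rightarrow> state set" where
  "LM_II g BL BR uL =
     (let \<gamma> = gamma_L g uL;
          \<gamma>sp = conj_sp g BL BR \<gamma>;
          \<gamma>sb = conj_sb g BL BR \<gamma>
      in R1 g \<gamma>sp
       \<union> between (S1 g \<gamma>sp) \<gamma>sp (jump_conj g \<gamma>sp)
       \<union> between (CD \<gamma>sp) (jump_conj g \<gamma>sp) \<gamma>sb
       \<union> conj_sb_locus g BL BR (between (T1 g uL) \<gamma> (K_L g uL))
       \<union> {s \<in> T1 g uL. snd s < 0})"

definition LM_III :: "real \<Rightarrow> real \<Rightarrow> real \<Rightarrow> state \<Rightarrow> state set" where
  "LM_III g BL BR uL =
     (let uL0 = conj_sp g BL BR uL;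
          uL0J = jump_conj g uL0;
          uLJ = jump_conj g uL;
          uLJ0 = conj_sb g BL BR uLJ
      in R1 g uL0
       \<union> between (S1 g uL0) uL0 uL0J
       \<union> between (CD uL0) uL0J uLJ0
       \<union> conj_sb_locus g BL BR (between (S1 g uL) uLJ (K_L g uL))
       \<union> {s \<in> T1 g uL. snd s < 0})"

definition LM_curve :: "real \<Rightarrow> real \<Rightarrow> real \<Rightarrow> state \<Rightarrow> state set" where
  "LM_curve g BL BR uL =
     (if froude g uL < - 2 then LM_I g uL
      else if froude g uL \<le> 1 then LM_II g BL BR uL
      else LM_III g BL BR uL)"


section \<open>The R-M locus, as the list of its branches\<close>

definition K_R :: "real \<Rightarrow> state \<Rightarrow> state" where
  "K_R g uR = (THE s. s \<in> T2B g uR \<and> snd s = 0)"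

definition alpha_sb :: "real \<Rightarrow> real \<Rightarrow> real \<Rightarrow> state \<Rightarrow> state" where
  "alpha_sb g BL BR uR =
     (THE s. s \<in> T2B g uR \<and> snd s = - K_sb (BL / BR) * sqrt (g * fst s))"

definition alpha_R :: "real \<Rightarrow> real \<Rightarrow> real \<Rightarrow> state \<Rightarrow> state" where
  "alpha_R g BL BR uR = conj_sb g BR BL (alpha_sb g BL BR uR)"

definition RS :: "real \<Rightarrow> real \<Rightarrow> real \<Rightarrow> state \<Rightarrow> state set" where
  "RS g BL BR uR =
     conj_sb_locus g BR BL (between (T2B g uR) (alpha_sb g BL BR uR) (K_R g uR))"

definition beta_R :: "real \<Rightarrow> real \<Rightarrow> real \<Rightarrow> state \<Rightarrow> state" where
  "beta_R g BL BR uR =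
     (THE s. s \<in> CD (conj_sp g BR BL uR) \<and> snd s = - sqrt (g * fst s))"

definition RM_I :: "real \<Rightarrow> state \<Rightarrow> state set list" where
  "RM_I g uR = [T2B g uR]"

definition RM_II :: "real \<Rightarrow> real \<Rightarrow> real \<Rightarrow> state \<Rightarrow> state set list" where
  "RM_II g BL BR uR =
     [R2B g (alpha_R g BL BR uR) \<union> RS g BL BR uR \<union> {s \<in> T2B g uR. snd s > 0}]"

definition RM_III :: "real \<Rightarrow> real \<Rightarrow> real \<Rightarrow> state \<Rightarrow> state set list" where
  "RM_III g BL BR uR =
     (let uR0 = conj_sp g BR BL uR;
          uR0J = jump_conj g uR0;
          \<beta> = beta_R g BL BR uR
      in [R2B g (alpha_R g BL BR uR) \<union> RS g BL BR uR \<union> {s \<in> T2B g uR. snd s > 0},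
          R2B g \<beta> \<union> between (CD uR0) \<beta> uR0J,
          R2B g uR0 \<union> between (S2B g uR0) uR0 uR0J])"

definition RM_IV :: "real \<Rightarrow> real \<Rightarrow> real \<Rightarrow> state \<Rightarrow> state set list" where
  "RM_IV g BL BR uR =
     (let uR0 = conj_sp g BR BL uR;
          uR0J = jump_conj g uR0;
          uRJ = jump_conj g uR;
          uRJ0 = conj_sb g BR BL uRJ
      in [conj_sb_locus g BR BL (between (S2B g uR) uRJ (K_R g uR)) \<union> {s \<in> T2B g uR. snd s > 0},
          between (CD uR0) uRJ0 uR0J,
          R2B g uR0 \<union> between (S2B g uR0) uR0 uR0J])"

definition RM_branches :: "real \<Rightarrow> real \<Rightarrow> real \<Rightarrow> state \<Rightarrow> state set list" where
  "RM_branches g BL BR uR =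
     (if froude g uR > 2 then RM_I g uR
      else if froude g uR > - K_sp (BL / BR) then RM_II g BL BR uR
      else if froude g uR > - K_jump (BL / BR) then RM_III g BL BR uR
      else RM_IV g BL BR uR)"


section \<open>Solutions of the Riemann problem\<close>

text \<open>
  A solution records the index of the branch of the R-M locus it comes from, so that a state common
  to two branches yields two solutions. A solution without dry bed is given by its middle state
  \<open>u\<^sub>M\<close>, a solution with dry bed by the dry states \<open>I\<close> (left) and \<open>J\<close> (right).
\<close>

datatype riemann_solution = Wet nat state | Dry_Bed nat state state

definition solutions :: "real \<Rightarrow> real \<Rightarrow> real \<Rightarrow> state \<Rightarrow> state \<Rightarrow> riemann_solution set" where
  "solutions g BL BR uL uR =
     (let LM = LM_curve g BL BR uL; RM = RM_branches g BL BR uR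
      in {Wet i M | i M. i < length RM \<and> M \<in> LM \<and> M \<in> RM ! i}
       \<union> {Dry_Bed i (0, uI) (0, uJ) | i uI uJ.
            i < length RM \<and> (0, uI) \<in> LM \<and> (0, uJ) \<in> RM ! i \<and> uI < uJ})"

end

theory Submission
  imports Defs
begin

text \<open>
  Along \<open>T\<^sub>1\<close> the quantity \<open>u + 2 \<surd>(g h)\<close> does not increase, so the discharge falls on the subcritical
  part, while the specific energy grows there; hence the subcritical conjugate states become deeper and
  slower, and the L-M curve descends strictly from its dry state to \<open>u = -\<infinity>\<close>. Its pieces are in the
  right order because a hydraulic jump dissipates more energy in the wide section than in the narrow
  one. By reflection, the branches of the R-M locus ascend strictly, so each of them carries at most one
  solution.

  A branch from depth zero to infinity always carries exactly one. If \<open>F\<^sub>R \<le> - K\<^sub>s\<^sub>p\<close>, the second and the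
  third branch end in the same state \<open>E = u\<^sub>R\<^sup>0\<^sup>#\<close>, and in type IV the first and the second one start in
  the same state \<open>D = u\<^sub>R\<^sup>#\<^sup>0\<close>, where \<open>D\<close> is not deeper than \<open>E\<close>. The first branch is hit iff the L-M curve
  passes above \<open>D\<close> (always in type III), the third iff it passes below \<open>E\<close>, the second iff both hold;
  at least one of the two does. Both hold if \<open>u\<^sub>L = E\<close>, only the first if \<open>u\<^sub>L\<close> has the depth of \<open>E\<close> and
  half its velocity.
\<close>

section \<open>Descending curves\<close>

text \<open>Why a jump costs more in the wide section: widening lowers the unit-width discharge at
  constant energy, and of two supercritical flows with equal energy the one with less discharge has
  the larger jump ratio and so loses the larger share of its energy. With equal discharge after the
  transition, less energy means less subcritical depth; this orders the ends of every
  \<open>CD\<close> piece. The obstacle is that energy is not monotone along all of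
  \<open>T1\<close>. On a rarefaction it grows only where \<open>u\<close> is at most
  \<open>sqrt (g * h)\<close>, and on the shock curve of a supercritical state it may fall at first.
  Each locus of conjugate states must therefore be shown to start late enough. For a supercritical
  reflected right state this is where the type limits enter: below \<open>K_jump\<close> the
  post-jump Froude number exceeds \<open>K_sb\<close>, so the reflected \<open>alpha_sb\<close> lies
  beyond the post-jump state; below \<open>K_sp\<close> this follows already from the energy loss in
  the jump. A branch starting at depth zero above the L-M curve misses it altogether; its dry-bed
  solution replaces the missing intersection, so such a start imposes no condition.\<close>

lemma continuous_on_strict_antimono_surj:
  fixes f :: "real \<Rightarrow> real"
  assumes "a \<le> b"
    and anti: "\<And>x y. x \<in> {a..b} \<Longrightarrow> y \<in> {a..b} \<Longrightarrow> x < y \<Longrightarrow> f y < f x"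
    and surj: "{f b..f a} \<subseteq> f ` {a..b}"
  shows "continuous_on {a..b} f"
proof -
  \<comment> \<open>Lines of slope -1 outside \<open>{a..b}\<close> make the range all of the reals:
    the library criterion for monotone functions asks for an open range. It is applied to
    \<open>- F\<close>, which increases.\<close>
  define F where "F x = (if x < a then a - x + f a else if b < x then b - x + f b else f x)" for x
  have le: "f v \<le> f u" if "u \<in> {a..b}" "v \<in> {a..b}" "u \<le> v" for u v
    using anti[of u v] that by (cases "u = v") auto
  have mono: "F y \<le> F x" if "x \<le> y" for x y
    using that le[of a y] le[of x b] le[of a b] le[of x y] \<open>a \<le> b\<close>
    by (auto simp: F_def)
  have "y \<in> range F" for y
  proof -
    consider "y > f a" | "y < f b" | "y \<in> {f b..f a}" by force
    then show ?thesis
    proof cases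
      case 1
      then have "F (a - (y - f a)) = y" by (auto simp: F_def)
      then show ?thesis by (metis rangeI)
    next
      case 2
      then have "F (b + (f b - y)) = y" using \<open>a \<le> b\<close> by (auto simp: F_def)
      then show ?thesis by (metis rangeI)
    next
      case 3
      then obtain x where "x \<in> {a..b}" "f x = y" using surj by auto
      then have "F x = y" by (auto simp: F_def)
      then show ?thesis by (metis rangeI)
    qed
  qed
  then have "range F = UNIV" by blast
  then have "range (\<lambda>x. - F x) = UNIV"
    by (metis (no_types, lifting) UNIV_eq_I add.inverse_inverse rangeE rangeI)
  then have "continuous_on UNIV (\<lambda>x. - F x)"
    by (intro continuous_onI_mono) (auto simp: mono)
  then have "continuous_on UNIV (\<lambda>x. - (- F x))"
    by (rule continuous_on_minus)
  then have "continuous_on {a..b} F"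
    by (auto intro: continuous_on_subset)
  then show ?thesis
    by (rule continuous_on_eq) (auto simp: F_def)
qed

text \<open>The equivalence, unlike an implication, also makes equal depths and equal velocities
  imply each other, so the set is a graph over either coordinate.\<close>

definition strictly_descending :: "state set \<Rightarrow> bool" where
  "strictly_descending C \<longleftrightarrow> (\<forall>s\<in>C. \<forall>t\<in>C. fst s < fst t \<longleftrightarrow> snd t < snd s)"

text \<open>
  Prescribing both projections makes such a set the graph of a continuous function: a strictly monotone
  function whose range has no gaps has no jumps. In contrast to graphs, these sets can be glued by
  forming unions, and the loci of conjugate states can be handled without parametrizing them.
\<close>

definition darc :: "state set \<Rightarrow> state \<Rightarrow> state \<Rightarrow> bool" where
  "darc C P Q \<longleftrightarrow> P \<in> C \<and> Q \<in> C \<and> strictly_descending C \<and>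
     fst ` C = {fst P..fst Q} \<and> snd ` C = {snd Q..snd P}"

definition dray :: "state set \<Rightarrow> state \<Rightarrow> bool" where
  "dray C P \<longleftrightarrow> P \<in> C \<and> strictly_descending C \<and> fst ` C = {fst P..} \<and> snd ` C = {..snd P}"

lemma strictly_descendingD:
  "strictly_descending C \<Longrightarrow> s \<in> C \<Longrightarrow> t \<in> C \<Longrightarrow> fst s < fst t \<longleftrightarrow> snd t < snd s"
  by (auto simp: strictly_descending_def)

text \<open>A state of \<open>C\<close> and a state of \<open>D\<close> are compared through the
  common state \<open>Q\<close>, which is extreme in both sets.\<close>

lemma strictly_descending_Un:
  assumes C: "strictly_descending C" "Q \<in> C" "\<And>s. s \<in> C \<Longrightarrow> fst s \<le> fst Q \<and> snd Q \<le> snd s"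
    and D: "strictly_descending D" "Q \<in> D" "\<And>t. t \<in> D \<Longrightarrow> fst Q \<le> fst t \<and> snd t \<le> snd Q"
  shows "strictly_descending (C \<union> D)"
proof -
  have *: "(fst s < fst t \<longleftrightarrow> snd t < snd s) \<and> (fst t < fst s \<longleftrightarrow> snd s < snd t)"
    if "s \<in> C" "t \<in> D" for s t
    using C(3)[OF that(1)] D(3)[OF that(2)] strictly_descendingD[OF C(1) that(1) C(2)]
      strictly_descendingD[OF D(1) D(2) that(2)]
    by linarith
  show ?thesis
    using * strictly_descendingD[OF C(1)] strictly_descendingD[OF D(1)]
    unfolding strictly_descending_def by blast
qed

lemma darc_bounds:
  assumes "darc C P Q" "s \<in> C"
  shows "fst P \<le> fst s" "fst s \<le> fst Q" "snd Q \<le> snd s" "snd s \<le> snd P"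
proof -
  have "fst s \<in> fst ` C" "snd s \<in> snd ` C" using assms by auto
  then show "fst P \<le> fst s" "fst s \<le> fst Q" "snd Q \<le> snd s" "snd s \<le> snd P"
    using assms by (auto simp: darc_def)
qed

lemma dray_bounds:
  assumes "dray C P" "s \<in> C"
  shows "fst P \<le> fst s" "snd s \<le> snd P"
proof -
  have "fst s \<in> fst ` C" "snd s \<in> snd ` C" using assms by auto
  then show "fst P \<le> fst s" "snd s \<le> snd P"
    using assms by (auto simp: dray_def)
qed

lemma darc_Un:
  assumes "darc C P Q" "darc D Q R"
  shows "darc (C \<union> D) P R"
proof -
  have "fst P \<le> fst Q" "fst Q \<le> fst R" "snd R \<le> snd Q" "snd Q \<le> snd P"
    using darc_bounds[OF assms(1), of Q] darc_bounds[OF assms(2), of Q] assms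
    by (auto simp: darc_def)
  then have "{fst P..fst Q} \<union> {fst Q..fst R} = {fst P..fst R}"
      "{snd Q..snd P} \<union> {snd R..snd Q} = {snd R..snd P}" by auto
  moreover have "strictly_descending (C \<union> D)"
    using assms darc_bounds[OF assms(1)] darc_bounds[OF assms(2)]
    by (intro strictly_descending_Un[where Q = Q]) (auto simp: darc_def)
  ultimately show ?thesis using assms by (auto simp: darc_def image_Un)
qed

lemma darc_dray_Un:
  assumes "darc C P Q" "dray D Q"
  shows "dray (C \<union> D) P"
proof -
  have "fst P \<le> fst Q" "snd Q \<le> snd P"
    using darc_bounds[OF assms(1), of Q] assms by (auto simp: darc_def)
  then have "{fst P..fst Q} \<union> {fst Q..} = {fst P..}" "{snd Q..snd P} \<union> {..snd Q} = {..snd P}"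
    by auto
  moreover have "strictly_descending (C \<union> D)"
    using assms darc_bounds[OF assms(1)] dray_bounds[OF assms(2)]
    by (intro strictly_descending_Un[where Q = Q]) (auto simp: darc_def dray_def)
  ultimately show ?thesis using assms by (auto simp: darc_def dray_def image_Un)
qed

lemma strictly_descending_graph:
  assumes "\<And>x y. x \<in> A \<Longrightarrow> y \<in> A \<Longrightarrow> x < y \<Longrightarrow> f y < (f x :: real)"
  shows "strictly_descending ((\<lambda>h. (h, f h)) ` A)"
  using assms unfolding strictly_descending_def by (fastforce simp: not_less_iff_gr_or_eq)

lemma darc_graph:
  assumes "a \<le> b" "continuous_on {a..b} f"
    and anti: "\<And>x y. x \<in> {a..b} \<Longrightarrow> y \<in> {a..b} \<Longrightarrow> x < y \<Longrightarrow> f y < f x"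
  shows "darc ((\<lambda>h. (h, f h)) ` {a..b}) (a, f a) (b, f b)"
proof -
  have le: "f v \<le> f u" if "u \<in> {a..b}" "v \<in> {a..b}" "u \<le> v" for u v
    using anti[of u v] that by (cases "u = v") auto
  have "f ` {a..b} = {f b..f a}"
  proof
    show "f ` {a..b} \<subseteq> {f b..f a}" using le assms(1) by auto
    show "{f b..f a} \<subseteq> f ` {a..b}"
      using IVT2'[of f b _ a] assms by fastforce
  qed
  then show ?thesis
    using assms strictly_descending_graph[of "{a..b}" f] by (auto simp: darc_def image_image)
qed

lemma dray_graph:
  assumes "continuous_on {a..} f"
    and anti: "\<And>x y. a \<le> x \<Longrightarrow> x < y \<Longrightarrow> f y < f x"
    and unbounded: "\<And>c. \<exists>x\<ge>a. f x \<le> c"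
  shows "dray ((\<lambda>h. (h, f h)) ` {a..}) (a, f a)"
proof -
  have le: "f v \<le> f u" if "a \<le> u" "u \<le> v" for u v
    using anti[of u v] that by (cases "u = v") auto
  have "f ` {a..} = {..f a}"
  proof
    show "f ` {a..} \<subseteq> {..f a}" using le by auto
    show "{..f a} \<subseteq> f ` {a..}"
    proof
      fix c assume "c \<in> {..f a}"
      moreover obtain b where "b \<ge> a" "f b \<le> c" using unbounded by blast
      moreover have "continuous_on {a..b} f" using assms(1) by (rule continuous_on_subset) auto
      ultimately obtain x where "x \<ge> a" "f x = c" using IVT2'[of f b c a] by auto
      then show "c \<in> f ` {a..}" by auto
    qed
  qed
  then show ?thesis
    using anti strictly_descending_graph[of "{a..}" f] by (auto simp: dray_def image_image)
qed

lemma darc_imp_graph: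
  assumes "darc C P Q"
  obtains f where "continuous_on {fst P..fst Q} f" "C = (\<lambda>h. (h, f h)) ` {fst P..fst Q}"
    "\<And>x y. x \<in> {fst P..fst Q} \<Longrightarrow> y \<in> {fst P..fst Q} \<Longrightarrow> x < y \<Longrightarrow> f y < f x"
    "fst P \<le> fst Q" "f (fst P) = snd P" "f (fst Q) = snd Q"
proof -
  have desc: "strictly_descending C" and PQ: "P \<in> C" "Q \<in> C"
    and im: "fst ` C = {fst P..fst Q}" "snd ` C = {snd Q..snd P}" using assms by (auto simp: darc_def)
  have uniq: "u = v" if "(h, u) \<in> C" "(h, v) \<in> C" for h u v
    using strictly_descendingD[OF desc that] strictly_descendingD[OF desc that(2) that(1)] by auto
  define f where "f h = (THE u. (h, u) \<in> C)" for h
  have f: "f h = u" if "(h, u) \<in> C" for h u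
    unfolding f_def using that uniq by (intro the_equality) auto
  have mem: "(h, f h) \<in> C" if "h \<in> {fst P..fst Q}" for h
  proof -
    have "h \<in> fst ` C" using that im by auto
    then obtain u where "(h, u) \<in> C" by auto
    with f show ?thesis by simp
  qed
  have C: "C = (\<lambda>h. (h, f h)) ` {fst P..fst Q}"
  proof (intro set_eqI iffI)
    fix s assume "s \<in> C"
    then have "s = (fst s, f (fst s))" using f[of "fst s" "snd s"] by simp
    moreover have "fst s \<in> {fst P..fst Q}" using darc_bounds[OF assms \<open>s \<in> C\<close>] by simp
    ultimately show "s \<in> (\<lambda>h. (h, f h)) ` {fst P..fst Q}" by blast
  qed (use mem in auto)
  have anti: "f y < f x" if "x \<in> {fst P..fst Q}" "y \<in> {fst P..fst Q}" "x < y" for x y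
    using strictly_descendingD[OF desc mem[OF that(1)] mem[OF that(2)]] that(3) by simp
  have PQ': "fst P \<le> fst Q" using darc_bounds[OF assms PQ(1)] by simp
  have fPQ: "f (fst P) = snd P" "f (fst Q) = snd Q" using f PQ by (metis prod.collapse)+
  have "f ` {fst P..fst Q} = snd ` C" by (subst C) (simp add: image_image)
  then have "continuous_on {fst P..fst Q} f"
    using im fPQ by (intro continuous_on_strict_antimono_surj PQ' anti) auto
  then show thesis using that C anti PQ' fPQ by blast
qed

text \<open>In a descending set, cutting at the depth of \<open>Q\<close> is the same as cutting at
  its velocity, so both projections remain intervals. Continuity of rays is thereby reduced to that
  of arcs.\<close>

lemma dray_restrict:
  assumes "dray C P" "Q \<in> C"
  shows "darc {s \<in> C. fst s \<le> fst Q} P Q"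
proof -
  have desc: "strictly_descending C" and P: "P \<in> C"
    and im: "fst ` C = {fst P..}" "snd ` C = {..snd P}" using assms by (auto simp: dray_def)
  note b = dray_bounds[OF assms(1)]
  have iff: "fst s \<le> fst Q \<longleftrightarrow> snd Q \<le> snd s" if "s \<in> C" for s
    using strictly_descendingD[OF desc assms(2) that] by linarith
  have "fst ` {s \<in> C. fst s \<le> fst Q} = {h \<in> fst ` C. h \<le> fst Q}" by auto
  moreover have "snd ` {s \<in> C. fst s \<le> fst Q} = {h \<in> snd ` C. snd Q \<le> h}" using iff by auto
  moreover have "strictly_descending {s \<in> C. fst s \<le> fst Q}"
    using desc by (auto simp: strictly_descending_def)
  ultimately show ?thesis
    using P assms(2) b[OF assms(2)] im unfolding darc_def by auto
qed

lemma dray_imp_graph: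
  assumes "dray C P"
  obtains f where "continuous_on {fst P..} f" "C = (\<lambda>h. (h, f h)) ` {fst P..}"
    "\<And>x y. fst P \<le> x \<Longrightarrow> x < y \<Longrightarrow> f y < f x"
    "f (fst P) = snd P" "\<And>c. \<exists>x\<ge>fst P. f x \<le> c"
proof -
  have desc: "strictly_descending C" and P: "P \<in> C"
    and im: "fst ` C = {fst P..}" "snd ` C = {..snd P}" using assms by (auto simp: dray_def)
  have uniq: "u = v" if "(h, u) \<in> C" "(h, v) \<in> C" for h u v
    using strictly_descendingD[OF desc that] strictly_descendingD[OF desc that(2) that(1)] by auto
  define f where "f h = (THE u. (h, u) \<in> C)" for h
  have f: "f h = u" if "(h, u) \<in> C" for h u
    unfolding f_def using that uniq by (intro the_equality) auto
  have mem: "(h, f h) \<in> C" if "h \<ge> fst P" for h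
  proof -
    have "h \<in> fst ` C" using that im by auto
    then obtain u where "(h, u) \<in> C" by auto
    with f show ?thesis by simp
  qed
  have C: "C = (\<lambda>h. (h, f h)) ` {fst P..}"
  proof (intro set_eqI iffI)
    fix s assume "s \<in> C"
    then have "s = (fst s, f (fst s))" using f[of "fst s" "snd s"] by simp
    moreover have "fst s \<in> {fst P..}" using dray_bounds[OF assms \<open>s \<in> C\<close>] by simp
    ultimately show "s \<in> (\<lambda>h. (h, f h)) ` {fst P..}" by blast
  qed (use mem in auto)
  have anti: "f y < f x" if "fst P \<le> x" "x < y" for x y
    using strictly_descendingD[OF desc mem[of x] mem[of y]] that by simp
  have fP: "f (fst P) = snd P" using f P by (metis prod.collapse)
  have cont: "continuous_on {fst P..b} f" if "b \<ge> fst P" for b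
  proof -
    have "darc {s \<in> C. fst s \<le> b} P (b, f b)" using dray_restrict[OF assms mem[OF that]] by simp
    then obtain f' where f': "continuous_on {fst P..b} f'"
        "{s \<in> C. fst s \<le> b} = (\<lambda>h. (h, f' h)) ` {fst P..b}"
      by (rule darc_imp_graph) auto
    have "f' h = f h" if "h \<in> {fst P..b}" for h
    proof -
      have "(h, f' h) \<in> {s \<in> C. fst s \<le> b}" unfolding f'(2) using that by blast
      then show ?thesis using f[of h "f' h"] by simp
    qed
    then show ?thesis using continuous_on_eq[OF f'(1), of f] by simp
  qed
  have "continuous_on {fst P..} f"
    unfolding continuous_on_eq_continuous_within
  proof
    fix x assume x: "x \<in> {fst P..}"
    have "continuous (at x within {fst P..x+1}) f"
      using cont[of "x+1"] x by (auto simp: continuous_on_eq_continuous_within)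
    moreover have "at x within {fst P..x+1} = at x within {fst P..}"
      \<comment> \<open>Continuity at \<open>x\<close> depends only on depths below
        \<open>x + 1\<close>, where the result for arcs applies.\<close>
      by (rule at_within_nhd[where S = "{..<x+1}"]) auto
    ultimately show "continuous (at x within {fst P..}) f" by (simp add: continuous_within)
  qed
  moreover have "\<exists>x\<ge>fst P. f x \<le> c" for c
  proof -
    \<comment> \<open>\<open>c\<close> may exceed the top velocity \<open>snd P\<close>; the minimum
      is always attained.\<close>
    have "min c (snd P) \<in> snd ` C" using im by auto
    then obtain s where s: "s \<in> C" "snd s = min c (snd P)" by auto
    then have "f (fst s) \<le> c" using f[of "fst s" "snd s"] by (metis min.cobounded1 prod.collapse)
    then show ?thesis using dray_bounds[OF assms s(1)] by auto
  qed
  ultimately show thesis using that[of f] C anti fP by blast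
qed

section \<open>Counting the solutions on a branch\<close>

definition branch_solutions :: "state set \<Rightarrow> nat \<Rightarrow> state set \<Rightarrow> riemann_solution set" where
  "branch_solutions LM i D =
     {Wet i M | M. M \<in> LM \<and> M \<in> D} \<union>
     {Dry_Bed i (0, uI) (0, uJ) | uI uJ. (0, uI) \<in> LM \<and> (0, uJ) \<in> D \<and> uI < uJ}"

lemma solutions_eq:
  "solutions g BL BR uL uR =
     (\<Union>i<length (RM_branches g BL BR uR).
        branch_solutions (LM_curve g BL BR uL) i (RM_branches g BL BR uR ! i))"
  unfolding solutions_def branch_solutions_def Let_def by blast

lemma branch_solutions_disjoint:
  "i \<noteq> j \<Longrightarrow> branch_solutions LM i D \<inter> branch_solutions LM j D' = {}"
  by (auto simp: branch_solutions_def)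

text \<open>\<open>f - \<phi>\<close> decreases strictly, so it vanishes at most once, namely if it
  is nonnegative at the start \<open>a\<close> and nonpositive somewhere. If \<open>a = 0\<close>
  and \<open>f 0 < \<phi> 0\<close>, there is no crossing but exactly one dry-bed solution, so
  \<open>a = 0\<close> alone settles the condition at the start. The hypotheses on \<open>I\<close>
  cover both arcs and rays.\<close>

lemma branch_solutions_graph:
  fixes f \<phi> :: "real \<Rightarrow> real"
  assumes f: "continuous_on {0..} f" "\<And>x y. 0 \<le> x \<Longrightarrow> x < y \<Longrightarrow> f y < f x"
    and I: "0 \<le> a" "a \<in> I" "I \<subseteq> {a..}" "\<And>x. x \<in> I \<Longrightarrow> {a..x} \<subseteq> I"
    and \<phi>: "continuous_on I \<phi>" "\<And>x y. x \<in> I \<Longrightarrow> y \<in> I \<Longrightarrow> x < y \<Longrightarrow> \<phi> x < \<phi> y"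
    and LM: "LM = (\<lambda>h. (h, f h)) ` {0..}" and D: "D = (\<lambda>h. (h, \<phi> h)) ` I"
  shows "if (a = 0 \<or> \<phi> a \<le> f a) \<and> (\<exists>b\<in>I. f b \<le> \<phi> b)
         then is_singleton (branch_solutions LM i D) else branch_solutions LM i D = {}"
proof -
  have f_le: "f y \<le> f x" if "0 \<le> x" "x \<le> y" for x y
    using f(2)[of x y] that by (cases "x = y") auto
  have \<phi>_le: "\<phi> x \<le> \<phi> y" if "x \<in> I" "y \<in> I" "x \<le> y" for x y
    using \<phi>(2)[of x y] that by (cases "x = y") auto
  have I0: "x \<ge> a" "x \<ge> 0" if "x \<in> I" for x using that I by auto
  have inLM: "(h, u) \<in> LM \<longleftrightarrow> h \<ge> 0 \<and> u = f h" for h u by (auto simp: LM)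
  have inD: "(h, u) \<in> D \<longleftrightarrow> h \<in> I \<and> u = \<phi> h" for h u by (auto simp: D)
  define W where "W = {h\<in>I. f h = \<phi> h}"
  have W_le: "x = y" if "x \<in> W" "y \<in> W" for x y
  proof (rule ccontr)
    assume "x \<noteq> y"
    then consider "x < y" | "y < x" by linarith
    then show False
    proof cases
      case 1 then show False using f(2)[of x y] \<phi>(2)[of x y] that I0 by (auto simp: W_def)
    next
      case 2 then show False using f(2)[of y x] \<phi>(2)[of y x] that I0 by (auto simp: W_def)
    qed
  qed
  have sol: "branch_solutions LM i D = (\<lambda>h. Wet i (h, f h)) ` W \<union>
     (if 0 \<in> I \<and> f 0 < \<phi> 0 then {Dry_Bed i (0, f 0) (0, \<phi> 0)} else {})"
    using I0(2) by (auto simp: branch_solutions_def W_def inLM inD image_iff)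
  show ?thesis
  proof (cases "\<exists>b\<in>I. f b \<le> \<phi> b")
    case False
    then have "W = {}" "\<not> (0 \<in> I \<and> f 0 < \<phi> 0)" by (auto simp: W_def)
    then show ?thesis unfolding sol using False by (auto split: if_splits)
  next
    case True
    then obtain b where b: "b \<in> I" "f b \<le> \<phi> b" by blast
    show ?thesis
    proof (cases "\<phi> a \<le> f a")
      case True
      have sub: "{a..b} \<subseteq> I" using I(4) b by blast
      have "continuous_on {a..b} (\<lambda>h. f h - \<phi> h)"
        using sub \<phi>(1) f(1) I(1) by (intro continuous_intros) (auto intro: continuous_on_subset)
      then obtain x where x: "a \<le> x" "x \<le> b" "f x - \<phi> x = 0"
        using IVT2'[of "\<lambda>h. f h - \<phi> h" b 0 a] b True I0[OF b(1)] by auto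
      then have "x \<in> W" using sub by (auto simp: W_def)
      then have "W = {x}" using W_le by auto
      moreover have "\<not> (0 \<in> I \<and> f 0 < \<phi> 0)" using I0[of 0] True I(1) by auto
      ultimately show ?thesis using b True by (auto simp: sol)
    next
      case False
      have "W = {}"
      proof -
        have "f x < \<phi> x" if "x \<in> I" for x
          using False f_le[of a x] \<phi>_le[of a x] that I I0[OF that] by auto
        then show ?thesis by (force simp: W_def)
      qed
      moreover have "0 \<in> I \<and> f 0 < \<phi> 0 \<longleftrightarrow> a = 0"
        using I0[of 0] I False by auto
      ultimately show ?thesis using b False by (auto simp: sol is_singleton_def)
    qed
  qed
qed

section \<open>Reflection of velocities, and the position of branch endpoints relative to the L-M
  curve\<close>

definition mirror :: "state \<Rightarrow> state" where
  "mirror s = (fst s, - snd s)"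

lemma mirror_simps [simp]:
  "fst (mirror s) = fst s" "snd (mirror s) = - snd s" "mirror (mirror s) = s" "mirror (h, u) = (h, - u)"
  by (auto simp: mirror_def)

lemma mem_mirror_image_iff: "s \<in> mirror ` C \<longleftrightarrow> mirror s \<in> C"
  by (metis image_iff mirror_simps(3))

lemma mirror_image_mirror_image [simp]: "mirror ` mirror ` C = C"
  by (simp add: image_image)

text \<open>The inequality is weak, as in \<open>lies_below\<close>: a curve through an endpoint
  shared by two branches has to count for both of them.\<close>

definition lies_above :: "state set \<Rightarrow> state \<Rightarrow> bool" where
  "lies_above C P \<longleftrightarrow> (\<exists>u. (fst P, u) \<in> C \<and> snd P \<le> u)"

definition lies_below :: "state set \<Rightarrow> state \<Rightarrow> bool" where
  "lies_below C P \<longleftrightarrow> (\<exists>u. (fst P, u) \<in> C \<and> u \<le> snd P)"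

text \<open>Since the L-M curve descends and the branch ascends, lying below the branch somewhere
  amounts to lying below its deepest state \<open>Q\<close>.\<close>

lemma branch_solutions_arc:
  assumes LM: "dray LM (0, uI)" and D: "darc (mirror ` D) (mirror P) (mirror Q)" and "0 \<le> fst P"
  shows "if (fst P = 0 \<or> lies_above LM P) \<and> lies_below LM Q
         then is_singleton (branch_solutions LM i D) else branch_solutions LM i D = {}"
proof -
  obtain f where f: "continuous_on {0..} f" "LM = (\<lambda>h. (h, f h)) ` {0..}"
      "\<And>x y. 0 \<le> x \<Longrightarrow> x < y \<Longrightarrow> f y < f x"
    using dray_imp_graph[OF LM] by (metis fst_conv)
  obtain \<psi> where \<psi>: "continuous_on {fst P..fst Q} \<psi>" "mirror ` D = (\<lambda>h. (h, \<psi> h)) ` {fst P..fst Q}"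
      "\<And>x y. x \<in> {fst P..fst Q} \<Longrightarrow> y \<in> {fst P..fst Q} \<Longrightarrow> x < y \<Longrightarrow> \<psi> y < \<psi> x"
      "fst P \<le> fst Q" "\<psi> (fst P) = - snd P" "\<psi> (fst Q) = - snd Q"
    by (rule darc_imp_graph[OF D]) auto
  have "D = mirror ` mirror ` D" by simp
  also have "\<dots> = (\<lambda>h. (h, - \<psi> h)) ` {fst P..fst Q}" unfolding \<psi>(2) by (simp add: image_image)
  finally have Deq: "D = (\<lambda>h. (h, - \<psi> h)) ` {fst P..fst Q}" .
  have \<psi>_le: "- \<psi> b \<le> - \<psi> (fst Q)" if "b \<in> {fst P..fst Q}" for b
    using \<psi>(3)[of b "fst Q"] that \<psi>(4) by (cases "b = fst Q") auto
  have f_le: "f (fst Q) \<le> f b" if "b \<in> {fst P..fst Q}" for b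
    using f(3)[of b "fst Q"] that \<open>0 \<le> fst P\<close> by (cases "b = fst Q") auto
  have above: "lies_above LM P \<longleftrightarrow> - \<psi> (fst P) \<le> f (fst P)"
    using \<open>0 \<le> fst P\<close> \<psi>(4,5) by (auto simp: lies_above_def f(2))
  have below: "lies_below LM Q \<longleftrightarrow> (\<exists>b\<in>{fst P..fst Q}. f b \<le> - \<psi> b)"
  proof
    assume "lies_below LM Q"
    then show "\<exists>b\<in>{fst P..fst Q}. f b \<le> - \<psi> b"
      using \<psi>(4,6) by (intro bexI[of _ "fst Q"]) (auto simp: lies_below_def f(2))
  next
    assume "\<exists>b\<in>{fst P..fst Q}. f b \<le> - \<psi> b"
    then have "f (fst Q) \<le> snd Q" using \<psi>_le f_le \<psi>(6) by (metis minus_minus order_trans)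
    then show "lies_below LM Q"
      using \<open>0 \<le> fst P\<close> \<psi>(4) unfolding lies_below_def f(2)
      by (intro exI[of _ "f (fst Q)"]) auto
  qed
  note PQ = \<psi>(4)
  show ?thesis
    unfolding above below
    by (rule branch_solutions_graph[OF f(1) f(3) assms(3) _ _ _ _ _ f(2) Deq])
      (use \<psi>(1) \<psi>(3) PQ in \<open>auto intro: continuous_on_minus\<close>)
qed

text \<open>There is no condition at the deep end: velocities on the L-M curve are unbounded below,
  while on the branch they never drop under \<open>snd P\<close>.\<close>

lemma branch_solutions_ray:
  assumes LM: "dray LM (0, uI)" and D: "dray (mirror ` D) (mirror P)" and "0 \<le> fst P"
  shows "if fst P = 0 \<or> lies_above LM P
         then is_singleton (branch_solutions LM i D) else branch_solutions LM i D = {}"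
proof -
  obtain f where f: "continuous_on {0..} f" "LM = (\<lambda>h. (h, f h)) ` {0..}"
      "\<And>x y. 0 \<le> x \<Longrightarrow> x < y \<Longrightarrow> f y < f x" "\<And>c. \<exists>x\<ge>0. f x \<le> c"
    using dray_imp_graph[OF LM] by (metis fst_conv)
  obtain \<psi> where \<psi>: "continuous_on {fst P..} \<psi>" "mirror ` D = (\<lambda>h. (h, \<psi> h)) ` {fst P..}"
      "\<And>x y. fst P \<le> x \<Longrightarrow> x < y \<Longrightarrow> \<psi> y < \<psi> x" "\<psi> (fst P) = - snd P"
    by (rule dray_imp_graph[OF D]) auto
  have "D = mirror ` mirror ` D" by simp
  also have "\<dots> = (\<lambda>h. (h, - \<psi> h)) ` {fst P..}" unfolding \<psi>(2) by (simp add: image_image)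
  finally have Deq: "D = (\<lambda>h. (h, - \<psi> h)) ` {fst P..}" .
  have above: "lies_above LM P \<longleftrightarrow> - \<psi> (fst P) \<le> f (fst P)"
    using \<open>0 \<le> fst P\<close> \<psi>(4) by (auto simp: lies_above_def f(2))
  have below: "\<exists>b\<in>{fst P..}. f b \<le> - \<psi> b"
  proof -
    obtain x where x: "x \<ge> 0" "f x \<le> snd P" using f(4) by blast
    obtain b where b: "x \<le> b" "fst P \<le> b" by (meson max.cobounded1 max.cobounded2)
    have "f b \<le> f x" using f(3)[of x b] x b by (cases "x = b") auto
    moreover have "snd P \<le> - \<psi> b"
      using \<psi>(3)[of "fst P" b] \<psi>(4) b by (cases "fst P = b") auto
    ultimately show ?thesis using x b by (intro bexI[of _ b]) auto
  qed
  have "if (fst P = 0 \<or> - \<psi> (fst P) \<le> f (fst P)) \<and> (\<exists>b\<in>{fst P..}. f b \<le> - \<psi> b)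
         then is_singleton (branch_solutions LM i D) else branch_solutions LM i D = {}"
    by (rule branch_solutions_graph[OF f(1) f(3) assms(3) _ _ _ _ _ f(2) Deq])
      (use \<psi>(1) \<psi>(3) in \<open>auto intro: continuous_on_minus\<close>)
  then show ?thesis using below above by simp
qed

section \<open>Smooth transitions\<close>

context
  fixes g :: real
  assumes g_pos: "0 < g"
begin

lemma specific_energy_le_iff:
  "specific_energy g a \<le> specific_energy g b \<longleftrightarrow>
     2 * g * fst a + (snd a)\<^sup>2 \<le> 2 * g * fst b + (snd b)\<^sup>2"
proof -
  have "specific_energy g c = (2 * g * fst c + (snd c)\<^sup>2) / (2 * g)" for c
    using g_pos by (simp add: specific_energy_def field_simps)
  then show ?thesis using g_pos by (simp add: divide_le_cancel)
qed

lemma specific_energy_eq_iff: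
  "specific_energy g a = specific_energy g b \<longleftrightarrow>
     2 * g * fst a + (snd a)\<^sup>2 = 2 * g * fst b + (snd b)\<^sup>2"
  using specific_energy_le_iff[of a b] specific_energy_le_iff[of b a] by argo

lemma subcritical_le_iff: "0 \<le> fst a \<Longrightarrow> subcritical_le g a \<longleftrightarrow> (snd a)\<^sup>2 \<le> g * fst a"
  using g_pos unfolding subcritical_le_def
  by (metis abs_le_square_iff abs_of_nonneg mult_nonneg_nonneg order.strict_implies_order
      real_sqrt_ge_zero real_sqrt_pow2)

lemma supercritical_le_iff: "0 \<le> fst a \<Longrightarrow> supercritical_le g a \<longleftrightarrow> g * fst a \<le> (snd a)\<^sup>2"
  using g_pos unfolding supercritical_le_def
  by (metis abs_le_square_iff abs_of_nonneg mult_nonneg_nonneg order.strict_implies_order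
      real_sqrt_ge_zero real_sqrt_pow2)

text \<open>At fixed discharge \<open>q\<close> the energy \<open>h + q^2 / (2 g h^2)\<close>
  increases with \<open>h\<close> beyond a subcritical state, and more discharge only adds energy;
  so a deeper first state would have too much of it. This comparison gives uniqueness of conjugates,
  strict descent of the loci and the order of the pieces.\<close>

lemma subcritical_depth_le:
  assumes "0 < h1" "0 \<le> h2" and q: "(h2 * u2)\<^sup>2 \<le> (h1 * u1)\<^sup>2"
    and E: "specific_energy g (h1, u1) \<le> specific_energy g (h2, u2)"
    and sub: "u2\<^sup>2 \<le> g * h2"
  shows "h1 \<le> h2"
proof (rule ccontr)
  assume "\<not> h1 \<le> h2"
  then have lt: "h2 < h1" by simp
  have E': "2 * g * h1 + u1\<^sup>2 \<le> 2 * g * h2 + u2\<^sup>2" using E by (simp add: specific_energy_le_iff)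
  \<comment> \<open>The factor \<open>h1^2\<close> turns the velocity terms into squared discharges,
    to which \<open>q\<close> applies; afterwards \<open>g * (h1 - h2)\<close> cancels.\<close>
  have "2 * g * (h1 - h2) * h1\<^sup>2 \<le> (u2\<^sup>2 - u1\<^sup>2) * h1\<^sup>2"
    using E' by (intro mult_right_mono) (auto simp: algebra_simps)
  also have "\<dots> \<le> u2\<^sup>2 * h1\<^sup>2 - u2\<^sup>2 * h2\<^sup>2" using q by (simp add: algebra_simps power_mult_distrib)
  also have "\<dots> = u2\<^sup>2 * ((h1 - h2) * (h1 + h2))" by (simp add: algebra_simps power2_eq_square)
  also have "\<dots> \<le> (g * h2) * ((h1 - h2) * (h1 + h2))"
    using sub lt assms by (intro mult_right_mono) auto
  finally have "(g * (h1 - h2)) * (2 * h1\<^sup>2) \<le> (g * (h1 - h2)) * (h2 * (h1 + h2))"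
    by (simp add: algebra_simps)
  then have "2 * h1\<^sup>2 \<le> h2 * (h1 + h2)" using g_pos lt by simp
  moreover have "h2 * (h1 + h2) \<le> h1 * (h1 + h2)" using lt assms by (intro mult_right_mono) auto
  moreover have "h1 * (h1 + h2) < 2 * h1\<^sup>2" using lt assms by (simp add: power2_eq_square algebra_simps)
  ultimately show False by simp
qed

lemma subcritical_depth_less:
  assumes "0 < h1" "0 \<le> h2" and q: "(h2 * u2)\<^sup>2 < (h1 * u1)\<^sup>2"
    and E: "specific_energy g (h1, u1) \<le> specific_energy g (h2, u2)"
    and sub: "u2\<^sup>2 \<le> g * h2"
  shows "h1 < h2"
proof -
  have "h1 \<le> h2" using subcritical_depth_le[OF assms(1,2) _ E sub] q by simp
  moreover have "h1 \<noteq> h2"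
  proof
    assume "h1 = h2"
    then have "u2\<^sup>2 < u1\<^sup>2" "u1\<^sup>2 \<le> u2\<^sup>2"
      using q E assms(1) by (auto simp: specific_energy_le_iff power_mult_distrib)
    then show False by simp
  qed
  ultimately show ?thesis by simp
qed

text \<open>On the supercritical side energy falls as depth grows, which reverses the
  comparison.\<close>

lemma supercritical_depth_le:
  assumes "0 < h1" "0 < h2" and q: "(h2 * u2)\<^sup>2 \<le> (h1 * u1)\<^sup>2"
    and E: "specific_energy g (h1, u1) \<le> specific_energy g (h2, u2)"
    and sup: "g * h2 \<le> u2\<^sup>2"
  shows "h2 \<le> h1"
proof (rule ccontr)
  assume "\<not> h2 \<le> h1"
  then have lt: "h1 < h2" by simp
  have E': "2 * g * h1 + u1\<^sup>2 \<le> 2 * g * h2 + u2\<^sup>2" using E by (simp add: specific_energy_le_iff)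
  have "(g * h2) * ((h2 - h1) * (h2 + h1)) \<le> u2\<^sup>2 * ((h2 - h1) * (h2 + h1))"
    using sup lt assms by (intro mult_right_mono) auto
  also have "\<dots> = u2\<^sup>2 * h2\<^sup>2 - u2\<^sup>2 * h1\<^sup>2" by (simp add: algebra_simps power2_eq_square)
  also have "\<dots> \<le> (u1\<^sup>2 - u2\<^sup>2) * h1\<^sup>2" using q by (simp add: algebra_simps power_mult_distrib)
  also have "\<dots> \<le> (2 * g * (h2 - h1)) * h1\<^sup>2"
    using E' by (intro mult_right_mono) (auto simp: algebra_simps)
  finally have "(g * (h2 - h1)) * (h2 * (h2 + h1)) \<le> (g * (h2 - h1)) * (2 * h1\<^sup>2)"
    by (simp add: algebra_simps)
  then have "h2 * (h2 + h1) \<le> 2 * h1\<^sup>2" using g_pos lt by simp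
  moreover have "h1 * (h2 + h1) < h2 * (h2 + h1)" using lt assms by (intro mult_strict_right_mono) auto
  moreover have "2 * h1\<^sup>2 < h1 * (h2 + h1)" using lt assms by (simp add: power2_eq_square algebra_simps)
  ultimately show False by simp
qed

lemma is_conj_sb_unique:
  assumes "is_conj_sb g B B' a b" "is_conj_sb g B B' a b'" "0 < B'"
  shows "b = b'"
proof -
  obtain h u h' u' where b: "b = (h, u)" "b' = (h', u')" by (metis prod.exhaust)
  have h: "0 \<le> h" "0 \<le> h'" and q: "h * u = h' * u'"
    and E: "specific_energy g (h, u) = specific_energy g (h', u')"
    using assms by (auto simp: is_conj_sb_def smooth_transition_def discharge_def b mult.assoc)
  have sub: "u\<^sup>2 \<le> g * h" "u'\<^sup>2 \<le> g * h'"
    using assms h subcritical_le_iff[of b] subcritical_le_iff[of b'] by (auto simp: is_conj_sb_def b)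
  \<comment> \<open>A dry subcritical state is at rest and has zero energy, which forces the other
    state to be dry as well.\<close>
  have "h = 0 \<longleftrightarrow> h' = 0"
    using E sub g_pos h unfolding specific_energy_eq_iff
    by (smt (verit) fst_conv mult_nonneg_nonneg mult_eq_0_iff snd_conv zero_le_power2)
  moreover have "h = h'" if "0 < h" "0 < h'"
    using subcritical_depth_le[of h h' u' u] subcritical_depth_le[of h' h u u'] that q E sub h by simp
  ultimately have "h = h'" using h by force
  moreover from this have "u = u'" using q sub by (cases "h = 0") auto
  ultimately show ?thesis using b by simp
qed

text \<open>The discharge must not vanish: otherwise dry states \<open>(0, v)\<close> and
  \<open>(0, - v)\<close> with the same energy could both qualify.\<close>

lemma is_conj_sp_unique:
  assumes "is_conj_sp g B B' a b" "is_conj_sp g B B' a b'" "0 < B'" "0 < B" "fst a * snd a \<noteq> 0"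
  shows "b = b'"
proof -
  obtain h u h' u' where b: "b = (h, u)" "b' = (h', u')" by (metis prod.exhaust)
  have h: "0 \<le> h" "0 \<le> h'" and q: "h * u = h' * u'" "h * u \<noteq> 0"
    and E: "specific_energy g (h, u) = specific_energy g (h', u')"
    using assms by (auto simp: is_conj_sp_def smooth_transition_def discharge_def b mult.assoc)
  have sup: "g * h \<le> u\<^sup>2" "g * h' \<le> u'\<^sup>2"
    using assms h supercritical_le_iff[of b] supercritical_le_iff[of b'] by (auto simp: is_conj_sp_def b)
  have "0 < h" "0 < h'" using q h by (auto simp: less_le)
  then have "h = h'"
    using supercritical_depth_le[of h h' u' u] supercritical_depth_le[of h' h u u'] q E sup by simp
  moreover from this have "u = u'" using q by auto
  ultimately show ?thesis using b by simp
qed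

lemma conj_sb_eqI: "is_conj_sb g B B' a b \<Longrightarrow> 0 < B' \<Longrightarrow> conj_sb g B B' a = b"
  unfolding conj_sb_def by (rule the_equality) (auto intro: is_conj_sb_unique)

lemma conj_sp_eqI:
  "is_conj_sp g B B' a b \<Longrightarrow> 0 < B' \<Longrightarrow> 0 < B \<Longrightarrow> fst a * snd a \<noteq> 0 \<Longrightarrow> conj_sp g B B' a = b"
  unfolding conj_sp_def by (rule the_equality) (auto intro: is_conj_sp_unique)

text \<open>Zero energy and nonnegative depth leave only the state \<open>(0, 0)\<close>. This
  serves the degenerate cases \<open>F_L = -2\<close> and \<open>F_R = 2\<close>.\<close>

lemma conj_dry:
  assumes "0 < B" "0 < B'"
  shows "is_conj_sb g B B' (0, 0) b \<longleftrightarrow> b = (0, 0)" "is_conj_sp g B B' (0, 0) b \<longleftrightarrow> b = (0, 0)"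
proof -
  have "smooth_transition g B B' (0, 0) b \<longleftrightarrow> b = (0, 0)"
  proof
    assume "smooth_transition g B B' (0, 0) b"
    then have "0 \<le> fst b" "0 = 2 * g * fst b + (snd b)\<^sup>2"
      unfolding smooth_transition_def specific_energy_eq_iff by auto
    moreover from this have "0 \<le> 2 * g * fst b" using g_pos by auto
    ultimately have "2 * g * fst b = 0" "(snd b)\<^sup>2 = 0"
      by (smt (verit) zero_le_power2)+
    then show "b = (0, 0)" using g_pos by (auto simp: prod_eq_iff)
  qed (simp add: smooth_transition_def discharge_def)
  then show "is_conj_sb g B B' (0, 0) b \<longleftrightarrow> b = (0, 0)" "is_conj_sp g B B' (0, 0) b \<longleftrightarrow> b = (0, 0)"
    by (auto simp: is_conj_sb_def is_conj_sp_def subcritical_le_def supercritical_le_def)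
qed

lemma is_conj_mirror:
  "is_conj_sb g B B' (mirror a) (mirror b) \<longleftrightarrow> is_conj_sb g B B' a b"
  "is_conj_sp g B B' (mirror a) (mirror b) \<longleftrightarrow> is_conj_sp g B B' a b"
  by (auto simp: is_conj_sb_def is_conj_sp_def smooth_transition_def discharge_def
      specific_energy_def subcritical_le_def supercritical_le_def)

lemma smooth_transitionI:
  assumes "B * (h * u) = B' * q" "0 < h'" "h' + q\<^sup>2 / (2 * g * h'\<^sup>2) = specific_energy g (h, u)"
  shows "smooth_transition g B B' (h, u) (h', q / h')"
  using assms g_pos
  by (auto simp: smooth_transition_def discharge_def specific_energy_def power_divide field_simps)

text \<open>The intermediate value theorem on depths from \<open>h0\<close> to \<open>E\<close>: at
  depth \<open>E\<close> the potential part alone already reaches the energy \<open>E\<close>. The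
  bound on \<open>q^2\<close> says that \<open>h0\<close> is at least the critical depth, which
  makes the solution subcritical.\<close>

lemma is_conj_sb_exI:
  assumes sub: "subcritical_le g (h, u)" and q: "B * (h * u) = B' * q"
    and h0: "0 < h0" "q\<^sup>2 \<le> g * h0 ^ 3" "h0 + q\<^sup>2 / (2 * g * h0\<^sup>2) \<le> specific_energy g (h, u)"
  obtains h' where "h0 \<le> h'" "is_conj_sb g B B' (h, u) (h', q / h')"
proof -
  define E where "E = specific_energy g (h, u)"
  have q0: "0 \<le> q\<^sup>2 / (2 * g * x\<^sup>2)" for x using g_pos by simp
  have "h0 \<le> E" using h0(3) q0[of h0] unfolding E_def by linarith
  moreover have "continuous_on {h0..E} (\<lambda>x. x + q\<^sup>2 / (2 * g * x\<^sup>2))"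
    using h0(1) g_pos by (intro continuous_intros) auto
  ultimately obtain h' where h': "h0 \<le> h'" "h' + q\<^sup>2 / (2 * g * h'\<^sup>2) = E"
    using IVT'[of "\<lambda>x. x + q\<^sup>2 / (2 * g * x\<^sup>2)" h0 E E] h0(3) q0[of E] by (auto simp: E_def)
  have "q\<^sup>2 \<le> g * h' ^ 3"
    using h0 h' g_pos power_mono[of h0 h' 3] by (smt (verit) mult_left_mono)
  then have "(q / h')\<^sup>2 \<le> g * h'"
    using h0(1) h'(1) by (auto simp: power_divide field_simps power2_eq_square power3_eq_cube)
  then have "is_conj_sb g B B' (h, u) (h', q / h')"
    using smooth_transitionI[OF q, of h'] h' h0(1) sub subcritical_le_iff[of "(h', q / h')"]
    by (auto simp: is_conj_sb_def E_def)
  with h'(1) show thesis using that by blast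
qed

lemma is_conj_sp_exI:
  assumes sup: "supercritical_le g (h, u)" and q: "B * (h * u) = B' * q" "q \<noteq> 0"
    and h0: "0 < h0" "g * h0 ^ 3 \<le> q\<^sup>2" "h0 + q\<^sup>2 / (2 * g * h0\<^sup>2) \<le> specific_energy g (h, u)"
  obtains h' where "0 < h'" "h' \<le> h0" "is_conj_sp g B B' (h, u) (h', q / h')"
proof -
  define E where "E = specific_energy g (h, u)"
  have q0: "0 \<le> q\<^sup>2 / (2 * g * x\<^sup>2)" for x using g_pos by simp
  have "0 < E" using h0 q0[of h0] unfolding E_def by linarith
  \<comment> \<open>At depth \<open>\<bar>q\<bar> / sqrt (2 * g * E)\<close> the kinetic part alone
    equals \<open>E\<close>, so this is a starting point for the intermediate value theorem below
    \<open>h0\<close>.\<close>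
  define h1 where "h1 = min h0 (\<bar>q\<bar> / sqrt (2 * g * E))"
  have h1: "0 < h1" "h1 \<le> h0" using h0 q \<open>0 < E\<close> g_pos by (auto simp: h1_def)
  have "h1\<^sup>2 \<le> (\<bar>q\<bar> / sqrt (2 * g * E))\<^sup>2" using h1(1) by (intro power_mono) (auto simp: h1_def)
  also have "\<dots> = q\<^sup>2 / (2 * g * E)" using \<open>0 < E\<close> g_pos by (simp add: power_divide)
  finally have "E \<le> q\<^sup>2 / (2 * g * h1\<^sup>2)" using \<open>0 < E\<close> g_pos h1 by (simp add: field_simps)
  then have "E \<le> h1 + q\<^sup>2 / (2 * g * h1\<^sup>2)" using h1 by simp
  moreover have "continuous_on {h1..h0} (\<lambda>x. x + q\<^sup>2 / (2 * g * x\<^sup>2))"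
    using h1(1) g_pos by (intro continuous_intros) auto
  ultimately obtain h' where h': "h1 \<le> h'" "h' \<le> h0" "h' + q\<^sup>2 / (2 * g * h'\<^sup>2) = E"
    using IVT2'[of "\<lambda>x. x + q\<^sup>2 / (2 * g * x\<^sup>2)" h0 E h1] h0(3) h1 by (auto simp: E_def)
  have "g * h' ^ 3 \<le> q\<^sup>2"
    using h0 h' h1 g_pos power_mono[of h' h0 3] by (smt (verit) mult_left_mono)
  then have "g * h' \<le> (q / h')\<^sup>2"
    using h1(1) h'(1) by (auto simp: power_divide field_simps power2_eq_square power3_eq_cube)
  then have "is_conj_sp g B B' (h, u) (h', q / h')"
    using smooth_transitionI[OF q(1), of h'] h' h1(1) sup supercritical_le_iff[of "(h', q / h')"]
    by (auto simp: is_conj_sp_def E_def)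
  moreover have "0 < h'" using h' h1 by simp
  ultimately show thesis using that h' by blast
qed

end

section \<open>Wave curves\<close>

definition shock_velocity :: "real \<Rightarrow> state \<Rightarrow> real \<Rightarrow> real" where
  "shock_velocity g a h = snd a - (h - fst a) * sqrt (g / 2 * (1 / h + 1 / fst a))"

text \<open>Minus the derivative of \<open>shock_velocity\<close> in the depth. Written in the ratio
  \<open>h0 / h\<close>, its bounds become polynomial inequalities.\<close>

definition shock_slope :: "real \<Rightarrow> real \<Rightarrow> real \<Rightarrow> real" where
  "shock_slope g h0 h = sqrt (g / (2 * h0)) * ((1 + h0 / h / 2 + (h0 / h)\<^sup>2 / 2) / sqrt (1 + h0 / h))"

definition wave_velocity :: "real \<Rightarrow> state \<Rightarrow> real \<Rightarrow> real" where
  "wave_velocity g a h =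
     (if h \<le> fst a then snd a + 2 * sqrt (g * fst a) - 2 * sqrt (g * h) else shock_velocity g a h)"

context
  fixes g :: real
  assumes g_pos: "0 < g"
begin

lemma shock_velocity_alt:
  assumes "0 < fst a" "0 < h"
  shows "shock_velocity g a h = snd a - sqrt (g / (2 * fst a)) * ((h - fst a) * sqrt (1 + fst a / h))"
proof -
  have "g / 2 * (1 / h + 1 / fst a) = g / (2 * fst a) * (1 + fst a / h)"
    using assms by (simp add: field_simps)
  then show ?thesis unfolding shock_velocity_def by (simp only: real_sqrt_mult) simp
qed

lemma shock_velocity_has_derivative:
  assumes "0 < fst a" "0 < h"
  shows "(shock_velocity g a has_real_derivative - shock_slope g (fst a) h) (at h)"
proof -
  define k where "k = fst a"
  have k: "0 < k" using assms by (simp add: k_def)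
  have pos: "0 < 1 + k / h" using assms k by (simp add: add_pos_pos)
  have sq: "sqrt (1 + k / h) * sqrt (1 + k / h) = 1 + k / h" using pos by simp
  have "((\<lambda>h. 1 + k / h) has_real_derivative - (k / h\<^sup>2)) (at h)"
    using assms by (auto intro!: derivative_eq_intros simp: power2_eq_square)
  note d_sqrt = DERIV_chain2[OF DERIV_real_sqrt[OF pos] this]
  have d_lin: "((\<lambda>h. h - k) has_real_derivative 1) (at h)"
    by (auto intro!: derivative_eq_intros)
  have "((\<lambda>h. (h - k) * sqrt (1 + k / h)) has_real_derivative
      sqrt (1 + k / h) + (h - k) * (- (k / h\<^sup>2)) * (inverse (sqrt (1 + k / h)) / 2)) (at h)"
    using DERIV_mult[OF d_lin d_sqrt] by (rule DERIV_cong) (simp add: mult_ac)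
  moreover have "sqrt (1 + k / h) + (h - k) * (- (k / h\<^sup>2)) * (inverse (sqrt (1 + k / h)) / 2) =
      (1 + k / h / 2 + (k / h)\<^sup>2 / 2) / sqrt (1 + k / h)"
  proof -
    have gen: "S + A * (inverse S / 2) = (S * S + A / 2) / S" if "S \<noteq> 0" for S A :: real
      using that by (simp add: field_simps)
    have "sqrt (1 + k / h) + (h - k) * (- (k / h\<^sup>2)) * (inverse (sqrt (1 + k / h)) / 2) =
      (sqrt (1 + k / h) * sqrt (1 + k / h) + (h - k) * (- (k / h\<^sup>2)) / 2) / sqrt (1 + k / h)"
      using pos by (intro gen) simp
    also have "sqrt (1 + k / h) * sqrt (1 + k / h) + (h - k) * (- (k / h\<^sup>2)) / 2 =
        1 + k / h / 2 + (k / h)\<^sup>2 / 2"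
      unfolding sq using assms by (simp add: field_simps power2_eq_square)
    finally show ?thesis .
  qed
  ultimately have "((\<lambda>h. (h - k) * sqrt (1 + k / h)) has_real_derivative
      (1 + k / h / 2 + (k / h)\<^sup>2 / 2) / sqrt (1 + k / h)) (at h)" by simp
  from DERIV_diff[OF DERIV_const[of "snd a"] DERIV_cmult[OF this, of "sqrt (g / (2 * k))"]]
  have "((\<lambda>h. snd a - sqrt (g / (2 * k)) * ((h - k) * sqrt (1 + k / h))) has_real_derivative
      - shock_slope g k h) (at h)"
    by (simp add: shock_slope_def)
  moreover have "\<forall>\<^sub>F x in nhds h. shock_velocity g a x =
      snd a - sqrt (g / (2 * k)) * ((x - k) * sqrt (1 + k / x))"
    using eventually_nhds_in_open[of "{0<..}" h] assms
    by (auto elim!: eventually_mono simp: shock_velocity_alt k_def)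
  ultimately show ?thesis
    unfolding k_def by (subst DERIV_cong_ev[OF refl _ refl]) auto
qed

lemma shock_slope_pos: "0 < h0 \<Longrightarrow> 0 < h \<Longrightarrow> 0 < shock_slope g h0 h"
  using g_pos by (auto simp: shock_slope_def intro!: mult_pos_pos divide_pos_pos add_pos_nonneg)

text \<open>\<open>sqrt (g / h)\<close> is the corresponding slope of a rarefaction. After squaring,
  the claim for \<open>s = h0 / h\<close> is the square \<open>(s^2 + s - 2)^2\<close>, which
  vanishes at the reference depth, where the curves touch.\<close>

lemma shock_slope_ge:
  assumes "0 < h0" "0 < h"
  shows "sqrt (g / h) \<le> shock_slope g h0 h"
proof -
  define s where "s = h0 / h"
  have s: "0 < s" using assms by (simp add: s_def)
  have "0 \<le> (s\<^sup>2 + s - 2)\<^sup>2" by simp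
  then have le: "8 * s * (1 + s) \<le> (2 + s + s\<^sup>2)\<^sup>2"
    by (simp add: power2_eq_square algebra_simps)
  have "g / h = g / (2 * h0) * (8 * s * (1 + s) / (4 * (1 + s)))"
  proof -
    have "8 * s * (1 + s) / (4 * (1 + s)) = 2 * s"
      using s by (subst nonzero_divide_eq_eq) (auto simp: algebra_simps)
    then show ?thesis using assms by (simp add: s_def)
  qed
  also have "\<dots> \<le> g / (2 * h0) * ((2 + s + s\<^sup>2)\<^sup>2 / (4 * (1 + s)))"
    using le assms s g_pos by (intro mult_left_mono divide_right_mono) auto
  also have "(2 + s + s\<^sup>2)\<^sup>2 / (4 * (1 + s)) = ((1 + s / 2 + s\<^sup>2 / 2) / sqrt (1 + s))\<^sup>2"
  proof -
    have "(2 + s + s\<^sup>2)\<^sup>2 = 4 * (1 + s / 2 + s\<^sup>2 / 2)\<^sup>2"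
      by (simp add: power2_eq_square algebra_simps)
    moreover have "4 * (1 + s / 2 + s\<^sup>2 / 2)\<^sup>2 / (4 * (1 + s)) = (1 + s / 2 + s\<^sup>2 / 2)\<^sup>2 / (1 + s)"
      by (rule mult_divide_mult_cancel_left) simp
    ultimately show ?thesis using s by (simp only: power_divide) simp
  qed
  finally have "sqrt (g / h) \<le> sqrt (g / (2 * h0) * ((1 + s / 2 + s\<^sup>2 / 2) / sqrt (1 + s))\<^sup>2)"
    by simp
  also have "\<dots> = shock_slope g h0 h"
  proof -
    have "0 \<le> (1 + s / 2 + s\<^sup>2 / 2) / sqrt (1 + s)" using s by simp
    then show ?thesis by (simp only: real_sqrt_mult real_sqrt_abs abs_of_nonneg shock_slope_def s_def)
  qed
  finally show ?thesis .
qed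

lemma shock_slope_antimono:
  assumes "0 < h0" "0 < h" "h \<le> h'"
  shows "shock_slope g h0 h' \<le> shock_slope g h0 h"
proof -
  have mono: "(1 + s / 2 + s\<^sup>2 / 2) / sqrt (1 + s) \<le> (1 + t / 2 + t\<^sup>2 / 2) / sqrt (1 + t)"
    if st: "0 \<le> s" "s \<le> t" for s t :: real
  proof (rule power2_le_imp_le)
    have le_quot: "x\<^sup>2 / (1 + s) \<le> y\<^sup>2 / (1 + t)" if "x\<^sup>2 * (1 + t) \<le> y\<^sup>2 * (1 + s)" for x y
      using that st by (simp add: divide_simps)
    have "0 \<le> (1 + s) * (1 + t) - 1" using st by (simp add: algebra_simps)
    \<comment> \<open>Division gives \<open>(2 + t + t^2)^2 = (1 + t) (t^3 + t^2 + 4 t) + 4\<close>.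
      Cross-multiplied, the difference of the two quotients is the sum of these three terms.\<close>
    then have "0 \<le> (t - s) * (4 * ((1 + s) * (1 + t) - 1))"
      "0 \<le> (t ^ 3 - s ^ 3) * ((1 + s) * (1 + t))" "0 \<le> (t ^ 2 - s ^ 2) * ((1 + s) * (1 + t))"
      using st by (auto intro!: mult_nonneg_nonneg power_mono)
    then have "(2 + s + s\<^sup>2)\<^sup>2 * (1 + t) \<le> (2 + t + t\<^sup>2)\<^sup>2 * (1 + s)"
      by (simp add: power2_eq_square power3_eq_cube algebra_simps)
    moreover have "(2 + x + x\<^sup>2)\<^sup>2 = 4 * (1 + x / 2 + x\<^sup>2 / 2)\<^sup>2" for x :: real
      by (simp add: power2_eq_square algebra_simps)
    ultimately have "(1 + s / 2 + s\<^sup>2 / 2)\<^sup>2 * (1 + t) \<le> (1 + t / 2 + t\<^sup>2 / 2)\<^sup>2 * (1 + s)" by simp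
    then show "((1 + s / 2 + s\<^sup>2 / 2) / sqrt (1 + s))\<^sup>2 \<le> ((1 + t / 2 + t\<^sup>2 / 2) / sqrt (1 + t))\<^sup>2"
      using st le_quot[of "1 + s / 2 + s\<^sup>2 / 2" "1 + t / 2 + t\<^sup>2 / 2"] by (simp add: power_divide)
  qed (use st in auto)
  have "0 \<le> h0 / h'" "h0 / h' \<le> h0 / h" using assms by (auto intro: divide_left_mono)
  from mono[OF this] show ?thesis
    unfolding shock_slope_def using assms g_pos by (intro mult_left_mono) auto
qed

lemma wave_velocity_shock: "fst a \<le> h \<Longrightarrow> wave_velocity g a h = shock_velocity g a h"
  by (auto simp: wave_velocity_def shock_velocity_def)

lemma T1_eq:
  assumes "0 < fst a"
  shows "T1 g a = (\<lambda>h. (h, wave_velocity g a h)) ` {0..}"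
  using assms by (fastforce simp: T1_def R1_def S1_def wave_velocity_def shock_velocity_def)

lemma S1_eq:
  assumes "0 < fst a"
  shows "S1 g a = (\<lambda>h. (h, wave_velocity g a h)) ` {fst a..}"
  by (fastforce simp: S1_def wave_velocity_shock shock_velocity_def)

lemma R1_eq: "R1 g a = (\<lambda>h. (h, wave_velocity g a h)) ` {0..fst a}"
  by (auto simp: R1_def wave_velocity_def)

lemma T2B_eq: "T2B g a = mirror ` T1 g (mirror a)"
  by (auto simp: T2B_def T1_def R1_def S1_def R2B_def S2B_def mem_mirror_image_iff)

lemma R2B_eq: "R2B g a = mirror ` R1 g (mirror a)"
  by (auto simp: R1_def R2B_def mem_mirror_image_iff)

lemma S2B_eq: "S2B g a = mirror ` S1 g (mirror a)"
  by (auto simp: S1_def S2B_def mem_mirror_image_iff)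

lemma CD_mirror: "CD (mirror a) = mirror ` CD a"
  by (auto simp: CD_def mem_mirror_image_iff)

lemma between_mirror: "between (mirror ` C) (mirror a) (mirror b) = mirror ` between C a b"
  by (auto simp: between_def)

lemma conj_sb_locus_mirror:
  "conj_sb_locus g B B' (mirror ` C) = mirror ` conj_sb_locus g B B' C"
proof -
  have "is_conj_sb g B B' (mirror a) b \<longleftrightarrow> is_conj_sb g B B' a (mirror b)" for a b
    using is_conj_mirror(1)[OF g_pos, of B B' a "mirror b"] by simp
  then show ?thesis
    by (auto simp: conj_sb_locus_def mem_mirror_image_iff)
qed

text \<open>The quantity is constant on the rarefaction; on the shock curve its derivative is
  \<open>sqrt (g / h)\<close> minus the shock slope, hence not positive.\<close>

lemma wave_riemann_invariant_antimono:
  assumes "0 < fst a" "0 \<le> h" "h \<le> h'"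
  shows "wave_velocity g a h' + 2 * sqrt (g * h') \<le> wave_velocity g a h + 2 * sqrt (g * h)"
proof -
  have shock: "shock_velocity g a y + 2 * sqrt (g * y) \<le> shock_velocity g a x + 2 * sqrt (g * x)"
    if "fst a \<le> x" "x \<le> y" for x y
  proof (rule DERIV_nonpos_imp_nonincreasing[OF that(2)])
    fix z assume z: "x \<le> z" "z \<le> y"
    then have "0 < z" using assms that by simp
    then have "0 < g * z" using g_pos by simp
    then have "((\<lambda>h. 2 * sqrt (g * h)) has_real_derivative g / sqrt (g * z)) (at z)"
      by (auto intro!: derivative_eq_intros simp: field_simps)
    from DERIV_add[OF shock_velocity_has_derivative[OF assms(1) \<open>0 < z\<close>] this]
    have "((\<lambda>h. shock_velocity g a h + 2 * sqrt (g * h)) has_real_derivative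
        - shock_slope g (fst a) z + g / sqrt (g * z)) (at z)" .
    moreover have "g / sqrt (g * z) = sqrt (g / z)"
      using g_pos by (simp add: real_sqrt_mult real_sqrt_divide real_div_sqrt flip: divide_divide_eq_left)
    ultimately show "\<exists>d. ((\<lambda>h. shock_velocity g a h + 2 * sqrt (g * h)) has_real_derivative d) (at z) \<and> d \<le> 0"
      using shock_slope_ge[OF assms(1) \<open>0 < z\<close>] by (metis add.commute diff_ge_0_iff_ge le_diff_eq add_0 uminus_add_conv_diff diff_le_0_iff_le)
  qed
  consider "h' \<le> fst a" | "h \<le> fst a" "fst a < h'" | "fst a < h" by linarith
  then show ?thesis
  proof cases
    case 1 then show ?thesis using assms by (simp add: wave_velocity_def)
  next
    case 2 then show ?thesis using shock[of "fst a" h'] by (simp add: wave_velocity_def shock_velocity_def)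
  next
    case 3 then show ?thesis using shock[of h h'] assms by (simp add: wave_velocity_def)
  qed
qed

lemma wave_velocity_strict_antimono:
  assumes "0 < fst a" "0 \<le> h" "h < h'"
  shows "wave_velocity g a h' < wave_velocity g a h"
proof -
  have "sqrt (g * h) < sqrt (g * h')" using assms g_pos by simp
  then show ?thesis using wave_riemann_invariant_antimono[of a h h'] assms by linarith
qed

lemma wave_velocity_antimono:
  "0 < fst a \<Longrightarrow> 0 \<le> h \<Longrightarrow> h \<le> h' \<Longrightarrow> wave_velocity g a h' \<le> wave_velocity g a h"
  using wave_velocity_strict_antimono[of a h h'] by (cases "h = h'") auto

lemma wave_velocity_continuous:
  assumes "0 < fst a"
  shows "continuous_on {0..} (wave_velocity g a)"
proof -
  have "continuous_on ({0..fst a} \<union> {fst a..})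
      (\<lambda>h. if h \<le> fst a then snd a + 2 * sqrt (g * fst a) - 2 * sqrt (g * h) else shock_velocity g a h)"
  proof (rule continuous_on_If)
    show "continuous_on {fst a..} (shock_velocity g a)"
      using assms DERIV_isCont[OF shock_velocity_has_derivative[OF assms]]
      by (intro continuous_at_imp_continuous_on) auto
  qed (auto intro!: continuous_intros simp: shock_velocity_def)
  moreover have "{0..fst a} \<union> {fst a..} = {0..}" using assms by auto
  ultimately show ?thesis by (simp add: wave_velocity_def[abs_def])
qed

lemma wave_velocity_unbounded:
  assumes "0 < fst a"
  shows "\<exists>h\<ge>0. wave_velocity g a h \<le> c"
proof -
  define k where "k = sqrt (g / (2 * fst a))"
  have k: "0 < k" using assms g_pos by (simp add: k_def)
  \<comment> \<open>The factor \<open>sqrt (1 + fst a / h)\<close> is at least 1, so the velocity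
    drops at least linearly with rate \<open>k\<close>; this depth makes that drop equal to
    \<open>\<bar>snd a - c\<bar>\<close>.\<close>
  define h where "h = fst a + \<bar>snd a - c\<bar> / k"
  have h: "fst a \<le> h" "0 < h" using assms k by (auto simp: h_def add_pos_nonneg)
  have "(h - fst a) * 1 \<le> (h - fst a) * sqrt (1 + fst a / h)"
    using h assms by (intro mult_left_mono) auto
  then have "k * (h - fst a) \<le> k * ((h - fst a) * sqrt (1 + fst a / h))" using k by simp
  moreover have "k * (h - fst a) = \<bar>snd a - c\<bar>" using k by (simp add: h_def)
  ultimately have "shock_velocity g a h \<le> c"
    using shock_velocity_alt[of a h] assms h unfolding k_def by linarith
  then show ?thesis using h wave_velocity_shock[of a h] by (intro exI[of _ h]) auto
qed

section \<open>The elementary curves as descending arcs and rays\<close>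

lemma T1_dray:
  assumes "0 < fst a" "0 \<le> h"
  shows "dray {s \<in> T1 g a. h \<le> fst s} (h, wave_velocity g a h)"
proof -
  have "{s \<in> T1 g a. h \<le> fst s} = (\<lambda>h. (h, wave_velocity g a h)) ` {h..}"
    using assms(2) by (auto simp: T1_eq[OF assms(1)])
  moreover have "dray ((\<lambda>h. (h, wave_velocity g a h)) ` {h..}) (h, wave_velocity g a h)"
  proof (rule dray_graph)
    fix c
    obtain x where x: "x \<ge> 0" "wave_velocity g a x \<le> c" using wave_velocity_unbounded[OF assms(1)] by blast
    then show "\<exists>x\<ge>h. wave_velocity g a x \<le> c"
      using wave_velocity_antimono[OF assms(1), of x "max x h"]
      by (intro exI[of _ "max x h"]) auto
  qed (use assms wave_velocity_strict_antimono wave_velocity_continuous[OF assms(1)] in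
      \<open>auto intro: continuous_on_subset\<close>)
  ultimately show ?thesis by simp
qed

lemma T1_darc:
  assumes "0 < fst a" "0 \<le> h1" "h1 \<le> h2"
  shows "darc ((\<lambda>h. (h, wave_velocity g a h)) ` {h1..h2}) (h1, wave_velocity g a h1) (h2, wave_velocity g a h2)"
  using assms wave_velocity_strict_antimono wave_velocity_continuous[OF assms(1)]
  by (intro darc_graph) (auto intro: continuous_on_subset)

lemma wave_velocity_self [simp]: "wave_velocity g a (fst a) = snd a"
  by (simp add: wave_velocity_def)

lemma R1_darc:
  assumes "0 < fst a"
  shows "darc (R1 g a) (0, snd a + 2 * sqrt (g * fst a)) a"
proof -
  have "wave_velocity g a 0 = snd a + 2 * sqrt (g * fst a)"
    using assms by (simp add: wave_velocity_def)
  then show ?thesis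
    unfolding R1_eq using T1_darc[of a 0 "fst a"] assms by simp
qed

lemma S1_darc:
  assumes "0 < fst a" "b \<in> S1 g a"
  shows "darc (between (S1 g a) a b) a b"
proof -
  have b: "fst a \<le> fst b" "snd b = wave_velocity g a (fst b)"
    using assms by (auto simp: S1_eq)
  have "between (S1 g a) a b = (\<lambda>h. (h, wave_velocity g a h)) ` {fst a..fst b}"
    using b by (auto simp: between_def S1_eq[OF assms(1)] closed_segment_eq_real_ivl)
  then show ?thesis using T1_darc[of a "fst a" "fst b"] assms(1) b(1) by (simp add: b(2)[symmetric])
qed

lemma CD_darc:
  assumes "0 < fst a" "fst a \<le> fst b" "fst a * snd a = fst c * snd c" "fst b * snd b = fst c * snd c"
    "0 < fst c * snd c"
  shows "darc (between (CD c) a b) a b"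
proof -
  define q where "q = fst c * snd c"
  have ab: "a = (fst a, q / fst a)" "b = (fst b, q / fst b)"
    using assms by (auto simp: q_def prod_eq_iff field_simps)
  have "between (CD c) a b = (\<lambda>h. (h, q / h)) ` {fst a..fst b}"
    using assms by (auto simp: between_def CD_def closed_segment_eq_real_ivl q_def)
  moreover have "darc ((\<lambda>h. (h, q / h)) ` {fst a..fst b}) (fst a, q / fst a) (fst b, q / fst b)"
    using assms by (intro darc_graph) (auto intro!: continuous_intros divide_strict_left_mono simp: q_def)
  ultimately show ?thesis using ab by metis
qed

end

section \<open>Loci of subcritical conjugate states\<close>

lemma conj_sb_locus_graph_iff:
  "b \<in> conj_sb_locus g B B' ((\<lambda>h. (h, T h)) ` A) \<longleftrightarrow> (\<exists>h\<in>A. is_conj_sb g B B' (h, T h) b)"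
  by (auto simp: conj_sb_locus_def)

context
  fixes g :: real
  assumes g_pos: "0 < g"
begin

lemma is_conj_sb_at_rest: "0 \<le> h \<Longrightarrow> is_conj_sb g B B' (h, 0) (h, 0)"
  using g_pos by (auto simp: is_conj_sb_def smooth_transition_def discharge_def subcritical_le_def)

text \<open>
  The conjugate of a state with specific energy \<open>E\<close> and discharge \<open>q\<close> becomes deeper when \<open>E\<close> grows
  and when \<open>q\<close> falls. Both projections of the locus are onto by the intermediate value theorem, for
  the energy balance at a prescribed depth \<open>h'\<close> or, multiplied by \<open>u'\<close>, at a prescribed velocity \<open>u'\<close>.
\<close>

lemma conj_sb_locus_darc:
  fixes T :: "real \<Rightarrow> real"
  assumes B: "0 < B" "0 < B'" and h: "0 < hp" "hp \<le> hK" and cont: "continuous_on {hp..hK} T"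
    and TK: "T hK = 0"
    and E_mono: "\<And>x y. hp \<le> x \<Longrightarrow> x \<le> y \<Longrightarrow> y \<le> hK \<Longrightarrow>
      specific_energy g (x, T x) \<le> specific_energy g (y, T y)"
    and q_anti: "\<And>x y. hp \<le> x \<Longrightarrow> x < y \<Longrightarrow> y \<le> hK \<Longrightarrow> y * T y < x * T x"
    and p': "is_conj_sb g B B' (hp, T hp) p'"
  shows "darc (conj_sb_locus g B B' ((\<lambda>h. (h, T h)) ` {hp..hK})) p' (hK, 0)"
proof -
  define C where "C = conj_sb_locus g B B' ((\<lambda>h. (h, T h)) ` {hp..hK})"
  have C: "b \<in> C \<longleftrightarrow> (\<exists>h\<in>{hp..hK}. is_conj_sb g B B' (h, T h) b)" for b
    by (simp add: C_def conj_sb_locus_graph_iff)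
  define q where "q x = B * (x * T x) / B'" for x
  have q_less: "q y < q x" if "hp \<le> x" "x < y" "y \<le> hK" for x y
    using q_anti[OF that] B by (simp add: q_def divide_strict_right_mono)
  have q_le: "q y \<le> q x" if "hp \<le> x" "x \<le> y" "y \<le> hK" for x y
    using q_less[of x y] that by (cases "x = y") auto
  have qK: "q hK = 0" by (simp add: q_def TK)
  have q_nonneg: "0 \<le> q x" if "x \<in> {hp..hK}" for x using q_le[of x hK] that qK by auto
  have T_nonneg: "0 \<le> T x" if "x \<in> {hp..hK}" for x
    using q_nonneg[OF that] B that h by (simp add: q_def zero_le_mult_iff zero_le_divide_iff)
  have T_le: "T x \<le> T hp" if "x \<in> {hp..hK}" for x
  proof -
    have "x * T x \<le> hp * T hp" using q_le[of hp x] that B by (simp add: q_def field_simps)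
    also have "\<dots> \<le> x * T hp" using that T_nonneg[of hp] h by (intro mult_right_mono) auto
    finally show ?thesis using that h by simp
  qed
  \<comment> \<open>The first state is subcritical by \<open>p'\<close>; the later ones are deeper
    and not faster.\<close>
  have sub: "subcritical_le g (x, T x)" if "x \<in> {hp..hK}" for x
  proof -
    have "sqrt (g * hp) \<le> sqrt (g * x)" using that g_pos by simp
    moreover have "\<bar>T hp\<bar> \<le> sqrt (g * hp)" using p' by (simp add: is_conj_sb_def subcritical_le_def)
    ultimately show ?thesis
      using T_le[OF that] T_nonneg[OF that] unfolding subcritical_le_def fst_conv snd_conv by linarith
  qed
  have conjD: "0 < fst b" "fst b * snd b = q x" "0 \<le> snd b" "snd b = q x / fst b"
    "(snd b)\<^sup>2 \<le> g * fst b" "specific_energy g b = specific_energy g (x, T x)"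
    if x: "x \<in> {hp..hK}" and b: "is_conj_sb g B B' (x, T x) b" for x b
  proof -
    show *: "fst b * snd b = q x" "specific_energy g b = specific_energy g (x, T x)"
      using b B by (auto simp: is_conj_sb_def smooth_transition_def discharge_def q_def field_simps)
    have "0 \<le> fst b" using b by (simp add: is_conj_sb_def smooth_transition_def)
    then show s: "(snd b)\<^sup>2 \<le> g * fst b"
      using b subcritical_le_iff[OF g_pos, of b] by (simp add: is_conj_sb_def)
    have "fst b \<noteq> 0"
    proof
      assume "fst b = 0"
      then have "2 * g * x + (T x)\<^sup>2 \<le> 0"
        using *(2) s unfolding specific_energy_eq_iff[OF g_pos] by simp
      moreover have "0 < 2 * g * x" using x h g_pos by simp
      ultimately show False by (smt (verit) zero_le_power2)
    qed
    with \<open>0 \<le> fst b\<close> show pos: "0 < fst b" by simp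
    from this show "snd b = q x / fst b" using *(1) by (simp add: field_simps)
    then show "0 \<le> snd b" using q_nonneg[OF x] pos by simp
  qed
  have less: "fst b < fst c \<and> snd c < snd b"
    if xy: "x \<in> {hp..hK}" "y \<in> {hp..hK}" "x < y"
      and bc: "is_conj_sb g B B' (x, T x) b" "is_conj_sb g B B' (y, T y) c" for x y b c
  proof -
    note b = conjD[OF xy(1) bc(1)] and c = conjD[OF xy(2) bc(2)]
    have q: "0 \<le> q y" "q y < q x" using q_nonneg[OF xy(2)] q_less[of x y] xy by auto
    then have "(q y)\<^sup>2 < (q x)\<^sup>2" by (intro power_strict_mono) auto
    then have q2: "(fst c * snd c)\<^sup>2 < (fst b * snd b)\<^sup>2" unfolding b(2) c(2) .
    have E: "specific_energy g (fst b, snd b) \<le> specific_energy g (fst c, snd c)"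
      using b(6) c(6) E_mono[of x y] xy by simp
    have lt: "fst b < fst c"
      by (rule subcritical_depth_less[OF g_pos b(1) less_imp_le[OF c(1)] q2 E c(5)])
    have "q y / fst c \<le> q y / fst b" using q b lt by (intro divide_left_mono) auto
    also have "\<dots> < q x / fst b" using q b by (intro divide_strict_right_mono) auto
    finally show ?thesis using lt b(4) c(4) by simp
  qed
  have desc: "strictly_descending C"
    unfolding strictly_descending_def
  proof (intro ballI)
    fix s t assume "s \<in> C" "t \<in> C"
    then obtain x y where xy: "x \<in> {hp..hK}" "y \<in> {hp..hK}"
        "is_conj_sb g B B' (x, T x) s" "is_conj_sb g B B' (y, T y) t" by (auto simp: C)
    consider "x < y" | "y < x" | "x = y" by linarith
    then show "fst s < fst t \<longleftrightarrow> snd t < snd s"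
    proof cases
      case 3
      then have "s = t" using xy is_conj_sb_unique[OF g_pos] B by metis
      then show ?thesis by simp
    qed (use less[of x y s t] less[of y x t s] xy in auto)
  qed
  have ends: "hp \<in> {hp..hK}" "hK \<in> {hp..hK}" using h by auto
  have K: "is_conj_sb g B B' (hK, T hK) (hK, 0)" using is_conj_sb_at_rest h TK by simp
  note p = conjD[OF ends(1) p']
  define h0 u0 where "h0 = fst p'" and "u0 = snd p'"
  have h0: "0 < h0" "h0 * u0 = q hp" "0 \<le> u0" "u0\<^sup>2 \<le> g * h0"
      "h0 + u0\<^sup>2 / (2 * g) = specific_energy g (hp, T hp)"
    using p by (auto simp: h0_def u0_def specific_energy_def)
  have mem: "p' \<in> C" "(hK, 0) \<in> C" using p' K ends by (auto simp: C)
  have bounds: "h0 \<le> fst b \<and> fst b \<le> hK \<and> 0 \<le> snd b \<and> snd b \<le> u0" if b: "b \<in> C" for b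
  proof -
    obtain x where x: "x \<in> {hp..hK}" "is_conj_sb g B B' (x, T x) b" using b by (auto simp: C)
    have "h0 \<le> fst b \<and> snd b \<le> u0"
      using less[OF ends(1) x(1) _ p' x(2)] is_conj_sb_unique[OF g_pos p', of b] x B
      by (cases "x = hp") (auto simp: h0_def u0_def)
    moreover have "fst b \<le> hK \<and> 0 \<le> snd b"
      using less[OF x(1) ends(2) _ x(2) K] is_conj_sb_unique[OF g_pos K, of b] x B
      by (cases "x = hK") auto
    ultimately show ?thesis by blast
  qed
  have E_cont: "continuous_on {hp..hK} (\<lambda>x. specific_energy g (x, T x))"
    and q_cont: "continuous_on {hp..hK} q"
    unfolding specific_energy_def q_def using g_pos B by (auto intro!: continuous_intros cont)
  have EK: "specific_energy g (hK, T hK) = hK" by (simp add: TK specific_energy_def)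
  have intro_C: "(h', q x / h') \<in> C" if x: "x \<in> {hp..hK}" and h': "h0 \<le> h'"
    and e: "h' + (q x)\<^sup>2 / (2 * g * h'\<^sup>2) = specific_energy g (x, T x)" for x h'
  proof -
    have "0 < h'" using h' h0 by simp
    have "q x / h' \<le> u0"
    proof -
      have "q x \<le> h0 * u0" using q_le[of hp x] x h0(2) by simp
      also have "\<dots> \<le> h' * u0" using h' h0 by (intro mult_right_mono) auto
      finally show ?thesis using \<open>0 < h'\<close> by (simp add: field_simps)
    qed
    then have "(q x / h')\<^sup>2 \<le> u0\<^sup>2" using q_nonneg[OF x] \<open>0 < h'\<close> by (intro power_mono) auto
    also have "\<dots> \<le> g * h'" using h0(4) h' g_pos by (smt (verit) mult_left_mono)
    finally have "subcritical_le g (h', q x / h')"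
      using \<open>0 < h'\<close> by (simp add: subcritical_le_iff[OF g_pos])
    moreover have "smooth_transition g B B' (x, T x) (h', q x / h')"
      using smooth_transitionI[OF g_pos, of B x "T x" B' "q x" h'] \<open>0 < h'\<close> e B by (simp add: q_def)
    ultimately show ?thesis using sub x by (auto simp: C is_conj_sb_def)
  qed
  have depth_onto: "h' \<in> fst ` C" if h': "h' \<in> {h0..hK}" for h'
  proof -
    have "0 < h'" using h' h0 by simp
    define G where "G x = specific_energy g (x, T x) - (h' + (q x)\<^sup>2 / (2 * g * h'\<^sup>2))" for x
    \<comment> \<open>If it were positive, depth \<open>h'\<close> with the discharge of the first
      state would need less energy than \<open>p'\<close> has, so that \<open>h'\<close> could not
      exceed \<open>h0\<close>.\<close>
    have "G hp \<le> 0"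
    proof (rule ccontr)
      assume "\<not> G hp \<le> 0"
      moreover have "specific_energy g (h', q hp / h') = h' + (q hp)\<^sup>2 / (2 * g * h'\<^sup>2)"
        using \<open>0 < h'\<close> g_pos by (simp add: specific_energy_def power_divide field_simps)
      moreover have "specific_energy g (h0, u0) = specific_energy g (hp, T hp)"
        using h0(5) by (simp add: specific_energy_def)
      ultimately have lt: "specific_energy g (h', q hp / h') < specific_energy g (h0, u0)"
        by (simp add: G_def)
      then have "h' \<le> h0"
        using subcritical_depth_le[OF g_pos, of h' h0 u0 "q hp / h'"] h0 \<open>0 < h'\<close> by simp
      then have "h' = h0" using h' by simp
      moreover from this have "q hp / h' = u0" using h0(1,2) by (simp add: field_simps)
      ultimately show False using lt by simp
    qed
    moreover have "0 \<le> G hK" using h' by (simp add: G_def EK qK)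
    moreover have "continuous_on {hp..hK} G"
      unfolding G_def using g_pos \<open>0 < h'\<close> by (intro continuous_intros E_cont q_cont) auto
    ultimately obtain x where x: "hp \<le> x" "x \<le> hK" "G x = 0" using IVT'[of G hp 0 hK] h by auto
    then have "(h', q x / h') \<in> C" using h' by (intro intro_C) (auto simp: G_def)
    then show ?thesis by force
  qed
  have velocity_onto: "u' \<in> snd ` C" if u': "u' \<in> {0..u0}" for u'
  proof (cases "u' = 0")
    case True
    then show ?thesis using mem(2) by force
  next
    case False
    then have "0 < u'" using u' by simp
    define G where "G x = u' * specific_energy g (x, T x) - q x - u' ^ 3 / (2 * g)" for x
    have u'2: "u'\<^sup>2 \<le> u0\<^sup>2" using u' by (intro power_mono) auto
    \<comment> \<open>With energy and discharge of the first state expressed through its conjugate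
      \<open>(h0, u0)\<close>, the root \<open>u' = u0\<close> splits off; the cofactor is not
      positive because \<open>(h0, u0)\<close> is subcritical.\<close>
    have "G hp = (u0 - u') * ((u' * u0 + u'\<^sup>2) / (2 * g) - h0)"
      using g_pos by (simp add: G_def flip: h0(5) h0(2)) (simp add: field_simps power2_eq_square power3_eq_cube)
    moreover have "(u' * u0 + u'\<^sup>2) / (2 * g) \<le> h0"
    proof -
      have "u' * u0 \<le> u0\<^sup>2" using u' unfolding power2_eq_square by (intro mult_right_mono) auto
      then have "u' * u0 + u'\<^sup>2 \<le> 2 * (g * h0)" using u'2 h0(4) by linarith
      then show ?thesis using g_pos by (simp add: field_simps)
    qed
    ultimately have "G hp \<le> 0" using u' by (simp add: mult_nonneg_nonpos)
    moreover have "0 \<le> G hK"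
    proof -
      have "u'\<^sup>2 \<le> g * hK" using u'2 h0(4) bounds[OF mem(1)] g_pos
        by (smt (verit) h0_def mult_left_mono)
      moreover have "0 \<le> g * hK" using h g_pos by simp
      ultimately have "u'\<^sup>2 / (2 * g) \<le> hK" using g_pos by (simp add: field_simps)
      then have "u' * (u'\<^sup>2 / (2 * g)) \<le> u' * hK" using \<open>0 < u'\<close> by (intro mult_left_mono) auto
      then show ?thesis by (simp add: G_def EK qK power2_eq_square power3_eq_cube)
    qed
    moreover have "continuous_on {hp..hK} G"
      unfolding G_def using g_pos by (intro continuous_intros E_cont q_cont) auto
    ultimately obtain x where x: "x \<in> {hp..hK}" "G x = 0" using IVT'[of G hp 0 hK] h by auto
    define h' where "h' = q x / u'"
    have h': "h' = specific_energy g (x, T x) - u'\<^sup>2 / (2 * g)"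
      using x(2) \<open>0 < u'\<close> by (simp add: G_def h'_def field_simps power2_eq_square power3_eq_cube)
    have "u'\<^sup>2 / (2 * g) \<le> u0\<^sup>2 / (2 * g)" using u'2 g_pos by (intro divide_right_mono) auto
    then have "h0 \<le> h'" using E_mono[of hp x] x h0(5) h' by simp
    moreover have "q x / h' = u'" using \<open>h0 \<le> h'\<close> h0(1) \<open>0 < u'\<close> by (auto simp: h'_def)
    moreover have "(q x)\<^sup>2 / (2 * g * h'\<^sup>2) = (q x / h')\<^sup>2 / (2 * g)" by (simp add: power_divide)
    ultimately have "(h', u') \<in> C" using intro_C[OF x(1), of h'] h' by simp
    then show ?thesis by force
  qed
  have "fst ` C = {h0..hK}" "snd ` C = {0..u0}" using bounds depth_onto velocity_onto by auto
  then show ?thesis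
    using mem desc unfolding darc_def C_def h0_def u0_def by simp
qed

section \<open>Specific energy and discharge along wave curves\<close>

lemma shock_slope_self: "0 < h \<Longrightarrow> shock_slope g h h = sqrt (g / h)"
proof -
  assume "0 < h"
  have "(2::real) / sqrt 2 = sqrt 2" by (simp add: real_div_sqrt)
  moreover have "g / (2 * h) * 2 = g / h" using \<open>0 < h\<close> by simp
  ultimately show ?thesis using \<open>0 < h\<close> unfolding shock_slope_def by (simp flip: real_sqrt_mult)
qed

text \<open>Along the shock curve the energy has derivative \<open>1 - u * shock_slope / g\<close>.
  Velocity and slope both decrease with depth, so the condition \<open>slope\<close> at
  \<open>hp\<close> persists as long as \<open>u\<close> is nonnegative, and for negative
  \<open>u\<close> the derivative is positive anyway.\<close>

lemma shock_energy_mono: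
  assumes "0 < fst a" "fst a \<le> hp" "hp \<le> h" "h \<le> h'"
    and slope: "wave_velocity g a hp * shock_slope g (fst a) hp \<le> g"
  shows "specific_energy g (h, wave_velocity g a h) \<le> specific_energy g (h', wave_velocity g a h')"
proof -
  have "h + (shock_velocity g a h)\<^sup>2 / (2 * g) \<le> h' + (shock_velocity g a h')\<^sup>2 / (2 * g)"
  proof (rule DERIV_nonneg_imp_nondecreasing[OF assms(4)])
    fix z assume z: "h \<le> z" "z \<le> h'"
    then have "0 < z" using assms by simp
    note d = shock_velocity_has_derivative[OF g_pos assms(1) this]
    have deriv: "((\<lambda>h. h + (shock_velocity g a h)\<^sup>2 / (2 * g)) has_real_derivative
        1 - shock_velocity g a z * shock_slope g (fst a) z / g) (at z)"
      by (rule DERIV_cong[OF DERIV_add[OF DERIV_ident DERIV_cdivide[OF DERIV_power[OF d, of 2], of "2 * g"]]])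
        (use g_pos in \<open>simp add: field_simps\<close>)
    have "shock_velocity g a z * shock_slope g (fst a) z \<le> g"
    proof (cases "0 \<le> shock_velocity g a z")
      case True
      have "shock_velocity g a z \<le> wave_velocity g a hp"
        using wave_velocity_antimono[OF g_pos assms(1), of hp z] assms z
        by (simp add: wave_velocity_shock[OF g_pos])
      moreover have "shock_slope g (fst a) z \<le> shock_slope g (fst a) hp"
        using shock_slope_antimono[OF g_pos assms(1), of hp z] assms z by simp
      ultimately have "shock_velocity g a z * shock_slope g (fst a) z
          \<le> wave_velocity g a hp * shock_slope g (fst a) hp"
        using True shock_slope_pos[OF g_pos assms(1) \<open>0 < z\<close>] by (intro mult_mono) auto
      with slope show ?thesis by simp
    next
      case False
      then have "shock_velocity g a z * shock_slope g (fst a) z \<le> 0"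
        using shock_slope_pos[OF g_pos assms(1) \<open>0 < z\<close>] by (intro mult_nonpos_nonneg) auto
      with g_pos show ?thesis by simp
    qed
    then have "0 \<le> 1 - shock_velocity g a z * shock_slope g (fst a) z / g"
      using g_pos by (simp add: field_simps)
    with deriv show "\<exists>d. ((\<lambda>h. h + (shock_velocity g a h)\<^sup>2 / (2 * g)) has_real_derivative d) (at z) \<and> 0 \<le> d"
      by blast
  qed
  then show ?thesis using assms by (simp add: specific_energy_def wave_velocity_shock[OF g_pos])
qed

lemma wave_subcritical:
  assumes "0 < fst a" "0 \<le> hp" "wave_velocity g a hp \<le> sqrt (g * hp)" "hp \<le> h"
  shows "wave_velocity g a h \<le> sqrt (g * h)"
proof -
  have "sqrt (g * hp) \<le> sqrt (g * h)" using assms g_pos by simp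
  then show ?thesis using wave_velocity_antimono[OF g_pos assms(1,2,4)] assms(3) by linarith
qed

text \<open>With \<open>c = sqrt (g * h)\<close> the energy times \<open>2 * g\<close> is the
  parabola \<open>2 c^2 + (A - 2 c)^2\<close>, whose vertex \<open>c = A / 3\<close> is the critical
  state of the rarefaction.\<close>

lemma rarefaction_energy_mono:
  assumes "0 \<le> hp" "wave_velocity g a hp \<le> sqrt (g * hp)" "hp \<le> h" "h \<le> h'" "h' \<le> fst a"
  shows "specific_energy g (h, wave_velocity g a h) \<le> specific_energy g (h', wave_velocity g a h')"
proof -
  define A where "A = snd a + 2 * sqrt (g * fst a)"
  define c where "c = sqrt (g * h)"
  define c' where "c' = sqrt (g * h')"
  have "A \<le> 3 * sqrt (g * hp)" using assms by (simp add: A_def wave_velocity_def)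
  moreover have "sqrt (g * hp) \<le> c" "c \<le> c'" using assms g_pos by (auto simp: c_def c'_def)
  ultimately have "0 \<le> (c' - c) * (3 * (c + c') - 2 * A)" by (intro mult_nonneg_nonneg) auto
  then have "2 * c\<^sup>2 + (A - 2 * c)\<^sup>2 \<le> 2 * c'\<^sup>2 + (A - 2 * c')\<^sup>2"
    by (simp add: power2_eq_square algebra_simps)
  moreover have "c\<^sup>2 = g * h" "c'\<^sup>2 = g * h'" using assms g_pos by (auto simp: c_def c'_def)
  ultimately show ?thesis
    using assms by (simp add: specific_energy_le_iff[OF g_pos] wave_velocity_def A_def c_def c'_def)
qed

text \<open>
  The alternative matters: on the shock curve of a supercritical state the energy decreases at first,
  and it is sure to increase only from the conjugate state of the hydraulic jump on.
\<close>

lemma wave_energy_mono: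
  assumes a: "0 < fst a" and hp: "0 \<le> hp" "wave_velocity g a hp \<le> sqrt (g * hp)"
    and reg: "snd a \<le> sqrt (g * fst a) \<or>
      fst a \<le> hp \<and> wave_velocity g a hp * shock_slope g (fst a) hp \<le> g"
    and h: "hp \<le> h" "h \<le> h'"
  shows "specific_energy g (h, wave_velocity g a h) \<le> specific_energy g (h', wave_velocity g a h')"
proof (cases "fst a \<le> hp \<and> wave_velocity g a hp * shock_slope g (fst a) hp \<le> g")
  case True
  then show ?thesis using shock_energy_mono[OF a, of hp h h'] h by simp
next
  case False
  with reg have "snd a \<le> sqrt (g * fst a)" by simp
  \<comment> \<open>At the reference depth the shock slope is \<open>sqrt (g / fst a)\<close>, so
    the slope condition there is just subcriticality from above.\<close>
  then have "snd a * shock_slope g (fst a) (fst a) \<le> sqrt (g * fst a) * sqrt (g / fst a)"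
    unfolding shock_slope_self[OF a] using g_pos a by (intro mult_right_mono) auto
  also have "\<dots> = g" using g_pos a by (simp flip: real_sqrt_mult)
  finally have s: "wave_velocity g a (fst a) * shock_slope g (fst a) (fst a) \<le> g" using g_pos by simp
  note shock = shock_energy_mono[OF a order_refl _ _ s]
  consider "h' \<le> fst a" | "h \<le> fst a" "fst a < h'" | "fst a < h" by linarith
  then show ?thesis
  proof cases
    case 1 then show ?thesis using rarefaction_energy_mono[OF hp h] by simp
  next
    case 2
    have "specific_energy g (h, wave_velocity g a h) \<le> specific_energy g (fst a, wave_velocity g a (fst a))"
      using rarefaction_energy_mono[OF hp h(1) 2(1)] by simp
    also have "\<dots> \<le> specific_energy g (h', wave_velocity g a h')" using shock[of "fst a" h'] 2 by simp
    finally show ?thesis .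
  next
    case 3 then show ?thesis using shock[of h h'] h by simp
  qed
qed

text \<open>The Riemann invariant bounds the later velocity by \<open>u + 2 c - 2 c'\<close>. Then
  \<open>c'^2 u' - c^2 u\<close> is at most \<open>(c' - c) ((c + c') u - 2 c'^2)\<close>, which is
  negative since \<open>u \<le> c < c'\<close>.\<close>

lemma wave_discharge_strict_antimono:
  assumes a: "0 < fst a" and hp: "0 \<le> hp" "wave_velocity g a hp \<le> sqrt (g * hp)"
    and h: "hp \<le> h" "h < h'"
  shows "h' * wave_velocity g a h' < h * wave_velocity g a h"
proof -
  define c where "c = sqrt (g * h)"
  define c' where "c' = sqrt (g * h')"
  define u where "u = wave_velocity g a h"
  define u' where "u' = wave_velocity g a h'"
  have c: "0 \<le> c" "c < c'" "c\<^sup>2 = g * h" "c'\<^sup>2 = g * h'"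
    using hp h g_pos by (auto simp: c_def c'_def)
  have u: "u \<le> c" using wave_subcritical[OF a hp h(1)] by (simp add: u_def c_def)
  have "u' \<le> u + 2 * c - 2 * c'"
    using wave_riemann_invariant_antimono[OF g_pos a, of h h'] hp h by (simp add: u_def u'_def c_def c'_def)
  then have "c'\<^sup>2 * u' \<le> c'\<^sup>2 * (u + 2 * c - 2 * c')" by (intro mult_left_mono) auto
  also have "\<dots> = c\<^sup>2 * u + (c' - c) * ((c + c') * u - 2 * c'\<^sup>2)"
    by (simp add: power2_eq_square algebra_simps)
  also have "\<dots> < c\<^sup>2 * u"
  proof -
    have "(c + c') * u \<le> (c + c') * c" using c u by (intro mult_left_mono) auto
    also have "\<dots> < (c + c') * c'" using c by (intro mult_strict_left_mono) auto
    also have "\<dots> \<le> (c' + c') * c'" using c by (intro mult_right_mono) auto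
    also have "\<dots> = 2 * c'\<^sup>2" by (simp add: power2_eq_square)
    finally have "(c' - c) * ((c + c') * u - 2 * c'\<^sup>2) < 0" using c by (intro mult_pos_neg) auto
    then show ?thesis by simp
  qed
  finally have "g * (h' * u') < g * (h * u)" by (simp add: c(3,4) mult.assoc)
  then show ?thesis using g_pos by (simp add: u_def u'_def)
qed

text \<open>The widths are left open: widening serves the L-M curve, narrowing the reflected R-M
  locus.\<close>

lemma wave_locus_darc:
  assumes B: "0 < B" "0 < B'" and a: "0 < fst a" and hp: "0 < hp" "wave_velocity g a hp \<le> sqrt (g * hp)"
    and reg: "snd a \<le> sqrt (g * fst a) \<or>
      fst a \<le> hp \<and> wave_velocity g a hp * shock_slope g (fst a) hp \<le> g"
    and hK: "hp \<le> hK" "wave_velocity g a hK = 0"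
    and p': "is_conj_sb g B B' (hp, wave_velocity g a hp) p'"
  shows "darc (conj_sb_locus g B B' ((\<lambda>h. (h, wave_velocity g a h)) ` {hp..hK})) p' (hK, 0)"
proof (rule conj_sb_locus_darc[where T = "wave_velocity g a", OF B hp(1) hK(1) _ hK(2)])
  show "continuous_on {hp..hK} (wave_velocity g a)"
    using hp by (intro continuous_on_subset[OF wave_velocity_continuous[OF g_pos a]]) auto
  show "specific_energy g (x, wave_velocity g a x) \<le> specific_energy g (y, wave_velocity g a y)"
    if "hp \<le> x" "x \<le> y" for x y
    using wave_energy_mono[OF a _ hp(2) reg that] hp(1) by simp
  show "y * wave_velocity g a y < x * wave_velocity g a x" if "hp \<le> x" "x < y" for x y
    using wave_discharge_strict_antimono[OF a _ hp(2) that] hp(1) by simp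
qed (rule p')

end

section \<open>Hydraulic jumps\<close>

context
  fixes g :: real
  assumes g_pos: "0 < g"
begin

lemma jump_conj_mirror: "jump_conj g (mirror a) = mirror (jump_conj g a)"
  by (simp add: jump_conj_def froude_def Let_def mirror_def)

text \<open>\<open>y\<close> is the depth ratio of the jump, the positive root of
  \<open>y * (y + 1) = 2 * F^2\<close>. In terms of \<open>y\<close> all later statements about
  jumps become rational.\<close>

lemma jump_ratio_exists:
  assumes "0 < fst a" "snd a \<noteq> 0"
  obtains y where "0 < y" "2 * (snd a)\<^sup>2 = g * fst a * (y * (y + 1))"
    "jump_conj g a = (y * fst a, snd a / y)"
proof -
  define y where "y = (sqrt (1 + 8 * (froude g a)\<^sup>2) - 1) / 2"
  have F: "(froude g a)\<^sup>2 = (snd a)\<^sup>2 / (g * fst a)"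
    using assms g_pos by (simp add: froude_def power_divide)
  then have "0 < (froude g a)\<^sup>2" using assms g_pos by simp
  then have "0 < y" by (simp add: y_def)
  have "2 * y + 1 = sqrt (1 + 8 * (froude g a)\<^sup>2)" by (simp add: y_def field_simps)
  then have "(2 * y + 1)\<^sup>2 = 1 + 8 * (froude g a)\<^sup>2" by simp
  then have "y * (y + 1) = 2 * (froude g a)\<^sup>2"
    by (simp add: power2_eq_square algebra_simps)
  then have "y * (y + 1) = 2 * ((snd a)\<^sup>2 / (g * fst a))" unfolding F .
  then have "2 * (snd a)\<^sup>2 = g * fst a * (y * (y + 1))" using assms g_pos by (simp add: field_simps)
  moreover have "jump_conj g a = (y * fst a, snd a / y)"
    using assms \<open>0 < y\<close> by (simp add: jump_conj_def Let_def y_def)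
  ultimately show thesis using that \<open>0 < y\<close> by blast
qed

lemma jump_ratio_ge_1:
  assumes "0 < h" "0 < y" "2 * u\<^sup>2 = g * h * (y * (y + 1))" "g * h \<le> u\<^sup>2"
  shows "1 \<le> y"
proof (rule ccontr)
  assume "\<not> 1 \<le> y"
  then have "y * (y + 1) < 1 * (1 + 1)" using assms(2) by (intro mult_strict_mono) auto
  then have "g * h * (y * (y + 1)) < g * h * (1 * (1 + 1))"
    using assms g_pos by (intro mult_strict_left_mono) auto
  then show False using assms(3,4) by simp
qed

text \<open>A critical state has jump ratio 1. This lets the head of a type II curve be treated as
  that of a type III curve.\<close>

lemma jump_conj_critical:
  assumes "0 < fst a" "(snd a)\<^sup>2 = g * fst a"
  shows "jump_conj g a = a"
proof -
  have nz: "snd a \<noteq> 0" using assms g_pos by auto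
  obtain y where y: "0 < y" "2 * (snd a)\<^sup>2 = g * fst a * (y * (y + 1))"
      "jump_conj g a = (y * fst a, snd a / y)"
    using jump_ratio_exists[OF assms(1) nz] by metis
  have "y * (y + 1) = 2" using y(2) assms g_pos by simp
  then have "(y - 1) * (y + 2) = 0" by (simp add: algebra_simps)
  then show ?thesis using y by (auto simp: prod_eq_iff)
qed

text \<open>Everything follows from the jump ratio being at least 1. The last claim is the slope
  condition that \<open>wave_energy_mono\<close> demands, so a locus may start at the post-jump
  state.\<close>

lemma jump_conj_props:
  assumes a: "0 < fst a" "0 < snd a" and sup: "supercritical_le g a"
  shows "fst a \<le> fst (jump_conj g a)" "0 < snd (jump_conj g a)"
    "fst (jump_conj g a) * snd (jump_conj g a) = fst a * snd a"
    "(snd (jump_conj g a))\<^sup>2 \<le> g * fst (jump_conj g a)"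
    "specific_energy g (jump_conj g a) \<le> specific_energy g a"
    "snd (jump_conj g a) = wave_velocity g a (fst (jump_conj g a))"
    "snd (jump_conj g a) * shock_slope g (fst a) (fst (jump_conj g a)) \<le> g"
proof -
  obtain h u where hu: "a = (h, u)" by fastforce
  with a have hu_pos: "0 < h" "0 < u" by auto
  obtain y where y: "0 < y" "2 * u\<^sup>2 = g * h * (y * (y + 1))" and J: "jump_conj g a = (y * h, u / y)"
    using jump_ratio_exists[of "(h, u)"] a unfolding hu fst_conv snd_conv by (metis less_irrefl)
  have "g * h \<le> u\<^sup>2" using sup supercritical_le_iff[OF g_pos, of a] a by (simp add: hu)
  with hu_pos y have y1: "1 \<le> y" using jump_ratio_ge_1 by blast
  have u2: "u\<^sup>2 = g * h * (y * (y + 1)) / 2" using y(2) by simp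
  have uy2: "(u / y)\<^sup>2 = g * h * ((y + 1) / (2 * y))"
  proof -
    have "(u / y)\<^sup>2 = g * h * (y * (y + 1)) / 2 / (y * y)" by (simp add: power_divide u2 power2_eq_square[of y])
    also have "\<dots> = g * h * ((y + 1) / (2 * y))" using y(1) by simp
    finally show ?thesis .
  qed
  show "fst a \<le> fst (jump_conj g a)" using y1 hu_pos unfolding J by (simp add: hu)
  show "0 < snd (jump_conj g a)" using y hu_pos unfolding J by simp
  show "fst (jump_conj g a) * snd (jump_conj g a) = fst a * snd a" using y unfolding J by (simp add: hu)
  have "(y + 1) / (2 * y) \<le> y"
  proof -
    have "y \<le> y * y" using y1 by simp
    then have "y + 1 \<le> y * (2 * y)" using y1 unfolding mult.left_commute[of y 2 y] by linarith
    then show ?thesis using y1 by (simp only: pos_divide_le_eq)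
  qed
  then have "g * h * ((y + 1) / (2 * y)) \<le> g * h * y" using hu_pos g_pos by (intro mult_left_mono) auto
  then show "(snd (jump_conj g a))\<^sup>2 \<le> g * fst (jump_conj g a)"
    unfolding J snd_conv fst_conv uy2 by (simp add: mult_ac)
  have "2 * y + (y + 1) / (2 * y) \<le> 2 + y * (y + 1) / 2"
  proof -
    \<comment> \<open>The classical head loss \<open>(h2 - h1)^3 / (4 h1 h2)\<close> of a hydraulic
      jump, here times \<open>2 / h\<close>.\<close>
    have "2 + y * (y + 1) / 2 - (2 * y + (y + 1) / (2 * y)) = (y - 1) ^ 3 / (2 * y)"
      using y(1) by (simp add: field_simps power3_eq_cube)
    also have "0 \<le> \<dots>" using y1 by simp
    finally show ?thesis by simp
  qed
  then have "g * h * (2 * y + (y + 1) / (2 * y)) \<le> g * h * (2 + y * (y + 1) / 2)"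
    using hu_pos g_pos by (intro mult_left_mono) auto
  moreover have "2 * g * (y * h) + (u / y)\<^sup>2 = g * h * (2 * y + (y + 1) / (2 * y))"
    unfolding uy2 by (simp add: algebra_simps)
  moreover have "2 * g * h + u\<^sup>2 = g * h * (2 + y * (y + 1) / 2)"
    unfolding u2 by (simp add: algebra_simps)
  ultimately show "specific_energy g (jump_conj g a) \<le> specific_energy g a"
    unfolding specific_energy_le_iff[OF g_pos] J unfolding hu by simp
  have sqrt_uy: "u / y = sqrt (g * h * ((y + 1) / (2 * y)))"
    using y hu_pos by (intro real_sqrt_unique[symmetric]) (auto simp: uy2)
  have "u - u / y = (y - 1) * (u / y)" using y by (simp add: field_simps)
  also have "\<dots> = (y - 1) * sqrt (h\<^sup>2 * (g / 2 * (1 / (y * h) + 1 / h)))"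
  proof -
    have "g * h * ((y + 1) / (2 * y)) = h\<^sup>2 * (g / 2 * (1 / (y * h) + 1 / h))"
      using y hu_pos by (simp add: field_simps power2_eq_square)
    then show ?thesis unfolding sqrt_uy by simp
  qed
  also have "\<dots> = (y * h - h) * sqrt (g / 2 * (1 / (y * h) + 1 / h))"
  proof -
    have "sqrt (h\<^sup>2 * K) = h * sqrt K" for K using hu_pos by (simp add: real_sqrt_mult)
    moreover have "(y - 1) * (h * K) = (y * h - h) * K" for K by (simp add: algebra_simps)
    ultimately show ?thesis by metis
  qed
  finally have "u / y = shock_velocity g a (y * h)" by (simp add: shock_velocity_def hu)
  moreover have "fst a \<le> y * h" using y1 hu_pos by (simp add: hu)
  ultimately show "snd (jump_conj g a) = wave_velocity g a (fst (jump_conj g a))"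
    unfolding J by (simp add: wave_velocity_shock[OF g_pos])
  \<comment> \<open>The square roots in velocity and slope cancel: their product is
    \<open>g / 2 * (1 + s / 2 + s^2 / 2)\<close>, which reaches \<open>g\<close> only for the
    trivial jump \<open>s = 1\<close>.\<close>
  define s where "s = 1 / y"
  have s: "0 < s" "s \<le> 1" using y1 by (auto simp: s_def)
  have "u / y = sqrt (g * h / 2) * sqrt (1 + s)"
    unfolding sqrt_uy real_sqrt_mult[symmetric] using y by (simp add: s_def field_simps)
  moreover have "shock_slope g h (y * h) = sqrt (g / (2 * h)) * ((1 + s / 2 + s\<^sup>2 / 2) / sqrt (1 + s))"
    using hu_pos by (simp add: shock_slope_def s_def)
  moreover have "sqrt (g * h / 2) * sqrt (g / (2 * h)) = g / 2"
  proof -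
    have "g * h / 2 * (g / (2 * h)) = (g / 2)\<^sup>2" using hu_pos by (simp add: power2_eq_square)
    then show ?thesis using g_pos by (simp only: real_sqrt_mult[symmetric] real_sqrt_abs abs_of_pos half_gt_zero)
  qed
  moreover have "sqrt (1 + s) \<noteq> 0" using s by simp
  moreover have "A * S * (C * (P / S)) = A * C * P" if "S \<noteq> 0" for A S C P :: real
    using that by simp
  ultimately have "u / y * shock_slope g h (y * h) = g / 2 * (1 + s / 2 + s\<^sup>2 / 2)"
    by simp
  also have "\<dots> \<le> g / 2 * 2" 
    using s power_le_one[of s 2] g_pos by (intro mult_left_mono) auto
  finally show "snd (jump_conj g a) * shock_slope g (fst a) (fst (jump_conj g a)) \<le> g"
    unfolding J by (simp add: hu)
qed

text \<open>
  In terms of the depth ratio \<open>y\<close> of a jump, the energies before and after it are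
  \<open>h (y\<^sup>2 + y + 4) / 4\<close> and \<open>h (4 y\<^sup>2 + y + 1) / (4 y)\<close>; their quotient decreases as \<open>y\<close> grows.
\<close>

lemma jump_conj_energy_le:
  assumes a: "0 < fst a" "0 < snd a" "supercritical_le g a"
    and b: "0 < fst b" "0 < snd b" "supercritical_le g b"
    and E: "specific_energy g a = specific_energy g b"
    and q: "fst b * snd b \<le> fst a * snd a"
  shows "specific_energy g (jump_conj g b) \<le> specific_energy g (jump_conj g a)"
proof -
  obtain h u k v where hu: "a = (h, u)" "b = (k, v)" by fastforce
  with a b have pos: "0 < h" "0 < u" "0 < k" "0 < v" by auto
  obtain y where y: "0 < y" "2 * u\<^sup>2 = g * h * (y * (y + 1))" and J: "jump_conj g a = (y * h, u / y)"
    using jump_ratio_exists[of "(h, u)"] a unfolding hu fst_conv snd_conv by (metis less_irrefl)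
  obtain z where z: "0 < z" "2 * v\<^sup>2 = g * k * (z * (z + 1))" and J': "jump_conj g b = (z * k, v / z)"
    using jump_ratio_exists[of "(k, v)"] b unfolding hu fst_conv snd_conv by (metis less_irrefl)
  have sup: "g * h \<le> u\<^sup>2" "g * k \<le> v\<^sup>2"
    using a b supercritical_le_iff[OF g_pos] by (auto simp: hu)
  have y1: "1 \<le> y" and z1: "1 \<le> z" using jump_ratio_ge_1 pos y z sup by blast+
  have "(k * v)\<^sup>2 \<le> (h * u)\<^sup>2" using q pos by (intro power_mono) (auto simp: hu)
  then have kh: "k \<le> h"
    using supercritical_depth_le[OF g_pos, of h k v u] pos E sup by (simp add: hu)
  \<comment> \<open>\<open>4 * g\<close> times the common energy of \<open>a\<close> and
    \<open>b\<close>.\<close>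
  define E0 where "E0 = g * h * (4 + y * (y + 1))"
  have expand: "c * (4 + x) = 4 * c + c * x" for c x :: real by (simp add: algebra_simps)
  have "4 * (g * h) + g * h * (y * (y + 1)) = 4 * (g * k) + g * k * (z * (z + 1))"
    unfolding y(2)[symmetric] z(2)[symmetric]
    using E unfolding specific_energy_eq_iff[OF g_pos] hu by simp
  then have E0: "E0 = g * k * (4 + z * (z + 1))" "0 < E0"
    using y z pos g_pos by (auto simp only: E0_def expand intro!: add_pos_pos mult_pos_pos)
  \<comment> \<open>\<open>b\<close> is not deeper than \<open>a\<close>; with a smaller jump ratio
    as well it would have less energy.\<close>
  have yz: "y \<le> z"
  proof (rule ccontr)
    assume "\<not> y \<le> z"
    then have "z * (z + 1) < y * (y + 1)" using z by (intro mult_strict_mono) auto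
    then have "g * k * (4 + z * (z + 1)) < g * k * (4 + y * (y + 1))" using pos g_pos by simp
    also have "\<dots> \<le> g * h * (4 + y * (y + 1))"
      using kh y g_pos by (intro mult_right_mono) auto
    finally show False using E0(1) unfolding E0_def by simp
  qed
  have den: "0 < x * (4 + x * (x + 1))" if "0 < x" for x :: real
    using that by (intro mult_pos_pos add_pos_pos) auto
  \<comment> \<open>The left side is \<open>4 * g\<close> times the energy after the jump, so the
    factor of \<open>E'\<close> is the share of energy that survives a jump of ratio
    \<open>x\<close>.\<close>
  have post: "4 * g * (x * d) + 2 * (w / x)\<^sup>2 = E' * ((4 * x\<^sup>2 + x + 1) / (x * (4 + x * (x + 1))))"
    if "0 < x" "2 * w\<^sup>2 = g * d * (x * (x + 1))" "E' = g * d * (4 + x * (x + 1))" for x d w E'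
  proof -
    have "4 * g * (x * d) + 2 * (w / x)\<^sup>2 = g * d * ((4 * x\<^sup>2 + x + 1) / x)"
      using that(1,2) by (simp add: power_divide field_simps power2_eq_square)
    moreover have "4 + x * (x + 1) \<noteq> 0" using den[OF that(1)] by auto
    ultimately show ?thesis by (simp add: that(3))
  qed
  have "(4 * z\<^sup>2 + z + 1) * (y * (4 + y * (y + 1))) \<le> (4 * y\<^sup>2 + y + 1) * (z * (4 + z * (z + 1)))"
  proof -
    define d where "d = z - y"
    have d: "0 \<le> d" using yz by (simp add: d_def)
    have "(4 * y\<^sup>2 + y + 1) * (z * (4 + z * (z + 1))) - (4 * z\<^sup>2 + z + 1) * (y * (4 + y * (y + 1)))
       = d * (4 * y\<^sup>2 * z\<^sup>2 + y * z\<^sup>2 + y\<^sup>2 * z + z\<^sup>2 + y\<^sup>2 + 2 * y * z + y + z + 4 - 16 * y * z)"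
      by (simp add: d_def algebra_simps power2_eq_square)
    moreover have "0 \<le> 4 * y\<^sup>2 * z\<^sup>2 + y * z\<^sup>2 + y\<^sup>2 * z + z\<^sup>2 + y\<^sup>2 + 2 * y * z + y + z + 4 - 16 * y * z"
    \<comment> \<open>The cofactor depends only on \<open>y * z\<close> and
      \<open>y + z = 2 * m\<close>. By \<open>y * z \<le> m^2\<close> it is at least
      \<open>4 (y z - 1)^2 + 2 (y z (m - 2) + m)\<close>; for \<open>m < 2\<close> the last bracket
      is at least \<open>m (m - 1)^2\<close>.\<close>
    proof -
      define m where "m = (y + z) / 2"
      have m: "1 \<le> m" "y + z = 2 * m" using y1 z1 by (auto simp: m_def)
      have "0 \<le> (y - z)\<^sup>2" by simp
      then have ms: "y * z \<le> m\<^sup>2" by (simp add: m_def power2_eq_square field_simps)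
      have "0 \<le> y * z * (m - 2) + m"
      proof (cases "2 \<le> m")
        case True
        then show ?thesis using y z m by (intro add_nonneg_nonneg mult_nonneg_nonneg) auto
      next
        case False
        then have "m\<^sup>2 * (m - 2) \<le> y * z * (m - 2)" using ms by (intro mult_right_mono_neg) auto
        moreover have "0 \<le> m * (m - 1)\<^sup>2" using m by simp
        moreover have "m * (m - 1)\<^sup>2 = m\<^sup>2 * (m - 2) + m" by (simp add: power2_eq_square algebra_simps)
        ultimately show ?thesis by linarith
      qed
      moreover have "0 \<le> 4 * (y * z - 1)\<^sup>2" by simp
      moreover have "4 * y\<^sup>2 * z\<^sup>2 + y * z\<^sup>2 + y\<^sup>2 * z + z\<^sup>2 + y\<^sup>2 + 2 * y * z + y + z + 4 - 16 * y * z =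
          4 * (y * z - 1)\<^sup>2 + y * z * (y + z) + (y + z)\<^sup>2 + (y + z) - 8 * (y * z)"
        by (simp add: power2_eq_square algebra_simps)
      ultimately show ?thesis using ms unfolding m(2) by (simp add: power2_eq_square algebra_simps)
    qed
    ultimately show ?thesis using d by (metis diff_ge_0_iff_ge mult_nonneg_nonneg)
  qed
  then have "(4 * z\<^sup>2 + z + 1) / (z * (4 + z * (z + 1))) \<le> (4 * y\<^sup>2 + y + 1) / (y * (4 + y * (y + 1)))"
    using den[OF y(1)] den[OF z(1)] by (simp add: divide_le_eq pos_le_divide_eq mult_ac)
  then have "E0 * ((4 * z\<^sup>2 + z + 1) / (z * (4 + z * (z + 1)))) \<le> E0 * ((4 * y\<^sup>2 + y + 1) / (y * (4 + y * (y + 1))))"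
    using E0(2) by (intro mult_left_mono) auto
  then show ?thesis
    unfolding specific_energy_le_iff[OF g_pos] J J'
    using post[OF y E0_def] post[OF z E0(1)] by simp
qed

end

section \<open>Froude limits and existence of conjugate states\<close>

text \<open>The difference of the two sides of the equation for the Froude limits; times the depth,
  it is the energy surplus over critical flow in the other section.\<close>

definition froude_gap :: "real \<Rightarrow> real \<Rightarrow> real" where
  "froude_gap r K = 1 + K\<^sup>2 / 2 - 3 / 2 * (K / r) powr (2 / 3)"

text \<open>The depth at which a flow with unit-width discharge \<open>q\<close> satisfies
  \<open>u^2 = g * h\<close>.\<close>

definition critical_depth :: "real \<Rightarrow> real \<Rightarrow> real" where
  "critical_depth g q = root 3 (q\<^sup>2 / g)"

text \<open>The cubic is positive at 0, negative at 1 and positive at \<open>3 * \<rho>\<close>;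
  without a quadratic term its third root is \<open>- x - y\<close>.\<close>

lemma cubic_roots:
  fixes \<rho> :: real
  assumes "1 < \<rho>"
  obtains x y where "0 < x" "x < 1" "1 < y" "\<And>z. z ^ 3 - 3 * \<rho> * z + 2 = (z - x) * (z - y) * (z + x + y)"
proof -
  define c where "c z = z ^ 3 - 3 * \<rho> * z + 2" for z :: real
  have cont: "continuous_on A c" for A unfolding c_def by (intro continuous_intros)
  have c1: "c 1 < 0" using assms by (simp add: c_def)
  obtain x where x: "0 \<le> x" "x \<le> 1" "c x = 0"
    using IVT2'[of c 1 0 0] c1 cont by (auto simp: c_def)
  have "c (3 * \<rho>) = 9 * \<rho>\<^sup>2 * (3 * \<rho> - 1) + 2"
    by (simp add: c_def power2_eq_square power3_eq_cube algebra_simps)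
  then have "0 \<le> c (3 * \<rho>)" using assms by simp
  then obtain y where y: "1 \<le> y" "c y = 0"
    using IVT'[of c 1 0 "3 * \<rho>"] c1 assms cont by auto
  have "x \<noteq> 0" "x \<noteq> 1" "y \<noteq> 1" using x y c1 by (auto simp: c_def)
  then have xy: "0 < x" "x < 1" "1 < y" using x y by auto
  have "(x - y) * (x\<^sup>2 + x * y + y\<^sup>2 - 3 * \<rho>) = c x - c y"
    by (simp add: c_def power2_eq_square power3_eq_cube algebra_simps)
  then have r: "3 * \<rho> = x\<^sup>2 + x * y + y\<^sup>2" using x y xy by simp
  have "2 = x * y * (x + y)"
    using x(3) unfolding c_def r by (simp add: power2_eq_square power3_eq_cube algebra_simps)
  then have "z ^ 3 - 3 * \<rho> * z + 2 = (z - x) * (z - y) * (z + x + y)" for z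
    unfolding r by (simp add: power2_eq_square power3_eq_cube algebra_simps)
  then show thesis using that xy by blast
qed

lemma froude_gap_cubic:
  assumes "0 < r" "0 < K"
  shows "2 * froude_gap r K = (K powr (2 / 3)) ^ 3 - 3 * (1 / r) powr (2 / 3) * K powr (2 / 3) + 2"
proof -
  have "(K powr (2 / 3)) ^ 3 = K\<^sup>2"
    using assms by (simp add: powr_power)
  moreover have "(K / r) powr (2 / 3) = (1 / r) powr (2 / 3) * K powr (2 / 3)"
    using assms powr_mult[of "1 / r" K "2 / 3"] by simp
  ultimately show ?thesis by (simp add: froude_gap_def)
qed

text \<open>Substituting \<open>z = K powr (2 / 3)\<close> gives the cubic above with
  \<open>\<rho> = (1 / r) powr (2 / 3)\<close>, which exceeds 1 because \<open>r < 1\<close>. For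
  positive \<open>z\<close> the third factor is positive, so the sign depends only on the two
  positive roots.\<close>

lemma froude_limits:
  assumes "0 < r" "r < 1"
  shows "0 < K_sb r" "K_sb r < 1" "1 < K_sp r" "froude_gap r (K_sb r) = 0"
    "\<And>K. 0 < K \<Longrightarrow> 0 \<le> froude_gap r K \<longleftrightarrow> K \<le> K_sb r \<or> K_sp r \<le> K"
proof -
  have "1 < (1 / r) powr (2 / 3)" using assms by (simp add: gr_one_powr)
  then obtain x y where xy: "0 < x" "x < 1" "1 < y"
    and fac: "\<And>z. z ^ 3 - 3 * (1 / r) powr (2 / 3) * z + 2 = (z - x) * (z - y) * (z + x + y)"
    using cubic_roots by blast
  have gap: "2 * froude_gap r K = (K powr (2 / 3) - x) * (K powr (2 / 3) - y) * (K powr (2 / 3) + x + y)"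
    if "0 < K" for K using froude_gap_cubic[OF assms(1) that] fac by simp
  define X where "X = x powr (3 / 2)"
  define Y where "Y = y powr (3 / 2)"
  have X: "0 < X" "X < 1" "X powr (2 / 3) = x" using xy powr_less_mono2[of "3 / 2" x 1] by (auto simp: X_def powr_powr)
  have Y: "1 < Y" "Y powr (2 / 3) = y" using xy by (auto simp: Y_def powr_powr gr_one_powr)
  have zero: "1 + K\<^sup>2 / 2 = 3 / 2 * (K / r) powr (2 / 3) \<longleftrightarrow> K = X \<or> K = Y" if "0 < K" for K
  proof -
    have "1 + K\<^sup>2 / 2 = 3 / 2 * (K / r) powr (2 / 3) \<longleftrightarrow> 2 * froude_gap r K = 0"
      by (auto simp: froude_gap_def)
    also have "\<dots> \<longleftrightarrow> K powr (2 / 3) = x \<or> K powr (2 / 3) = y"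
    proof -
      have "0 < K powr (2 / 3) + x + y" using xy powr_ge_zero[of K "2 / 3"] by linarith
      then show ?thesis unfolding gap[OF that] by simp
    qed
    also have "\<dots> \<longleftrightarrow> K = X \<or> K = Y"
      using that X Y powr_inj[of "2 / 3" K] by (smt (verit) powr_less_mono2 divide_pos_pos)
    finally show ?thesis .
  qed
  have "K_sb r = X" unfolding K_sb_def
  proof (rule the_equality)
    show "0 < X \<and> X < 1 \<and> 1 + X\<^sup>2 / 2 = 3 / 2 * (X / r) powr (2 / 3)" using X zero[of X] by simp
    show "K = X" if "0 < K \<and> K < 1 \<and> 1 + K\<^sup>2 / 2 = 3 / 2 * (K / r) powr (2 / 3)" for K
      using that zero[of K] Y by auto
  qed
  moreover have "K_sp r = Y" unfolding K_sp_def
  proof (rule the_equality)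
    show "1 < Y \<and> 1 + Y\<^sup>2 / 2 = 3 / 2 * (Y / r) powr (2 / 3)" using Y zero[of Y] by simp
    show "K = Y" if "1 < K \<and> 1 + K\<^sup>2 / 2 = 3 / 2 * (K / r) powr (2 / 3)" for K
      using that zero[of K] X by auto
  qed
  moreover have "froude_gap r X = 0" using zero[of X] X by (simp add: froude_gap_def)
  moreover have "0 \<le> froude_gap r K \<longleftrightarrow> K \<le> X \<or> Y \<le> K" if "0 < K" for K
  proof -
    have "0 < K powr (2 / 3) + x + y" using xy powr_ge_zero[of K "2 / 3"] by linarith
    then have "0 \<le> 2 * froude_gap r K \<longleftrightarrow> 0 \<le> (K powr (2 / 3) - x) * (K powr (2 / 3) - y)"
      unfolding gap[OF that] by (simp add: zero_le_mult_iff)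
    also have "\<dots> \<longleftrightarrow> K powr (2 / 3) \<le> x \<or> y \<le> K powr (2 / 3)"
      using xy by (auto simp: zero_le_mult_iff)
    also have "\<dots> \<longleftrightarrow> K \<le> X \<or> Y \<le> K"
      using that X Y powr_less_mono2[of "2/3" X K] powr_less_mono2[of "2/3" K X]
        powr_less_mono2[of "2/3" Y K] powr_less_mono2[of "2/3" K Y] by force
    finally show ?thesis by simp
  qed
  ultimately show "0 < K_sb r" "K_sb r < 1" "1 < K_sp r" "froude_gap r (K_sb r) = 0"
    "\<And>K. 0 < K \<Longrightarrow> 0 \<le> froude_gap r K \<longleftrightarrow> K \<le> K_sb r \<or> K_sp r \<le> K"
    using X Y by auto
qed

section \<open>Critical depth and solvability of smooth transitions\<close>

context
  fixes g :: real
  assumes g_pos: "0 < g"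
begin

lemma critical_depth_pos: "q \<noteq> 0 \<Longrightarrow> 0 < critical_depth g q"
  using g_pos by (simp add: critical_depth_def)

lemma critical_depth_cubed: "g * critical_depth g q ^ 3 = q\<^sup>2"
  using g_pos by (simp add: critical_depth_def)

lemma critical_depth_energy:
  assumes "q \<noteq> 0"
  shows "critical_depth g q + q\<^sup>2 / (2 * g * (critical_depth g q)\<^sup>2) = 3 / 2 * critical_depth g q"
proof -
  have "q\<^sup>2 / (2 * g * (critical_depth g q)\<^sup>2) = critical_depth g q / 2"
    unfolding critical_depth_cubed[of q, symmetric]
    using critical_depth_pos[OF assms] g_pos by (simp add: field_simps power2_eq_square power3_eq_cube)
  then show ?thesis by simp
qed

lemma critical_depth_le_iff: "0 \<le> h \<Longrightarrow> critical_depth g q \<le> h \<longleftrightarrow> q\<^sup>2 \<le> g * h ^ 3"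
proof -
  assume h: "0 \<le> h"
  have "critical_depth g q \<le> h \<longleftrightarrow> critical_depth g q ^ 3 \<le> h ^ 3"
    by (metis h power_mono_iff critical_depth_def g_pos divide_nonneg_pos real_root_ge_zero zero_le_power2 zero_less_numeral)
  also have "\<dots> \<longleftrightarrow> g * critical_depth g q ^ 3 \<le> g * h ^ 3" using g_pos by simp
  finally show ?thesis unfolding critical_depth_cubed .
qed

text \<open>
  The flow of depth \<open>h\<close> and velocity \<open>u\<close> passes into the section of relative width \<open>r\<close> iff its energy
  suffices for critical flow there.
\<close>

lemma froude_gap_eq:
  assumes "0 < r" "0 < h" "0 < u"
  shows "h * froude_gap r (froude g (h, u)) = specific_energy g (h, u) - 3 / 2 * critical_depth g (h * u / r)"
proof -
  define F where "F = u / sqrt (g * h)"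
  have F: "0 < F" "F\<^sup>2 = u\<^sup>2 / (g * h)" using assms g_pos by (auto simp: F_def power_divide)
  have "(h * (F / r) powr (2 / 3)) ^ 3 = h ^ 3 * (F / r)\<^sup>2"
    using F assms by (simp add: power_mult_distrib powr_power)
  also have "\<dots> = (h * u / r)\<^sup>2 / g"
  proof -
    have "h ^ 3 * (F / r)\<^sup>2 = h ^ 3 * (u\<^sup>2 / (g * h) / r\<^sup>2)" by (simp add: power_divide F(2))
    also have "\<dots> = (h * u / r)\<^sup>2 / g"
      using assms g_pos by (simp add: power_divide power_mult_distrib power2_eq_square power3_eq_cube mult_ac)
    finally show ?thesis .
  qed
  finally have "critical_depth g (h * u / r) = h * (F / r) powr (2 / 3)"
    unfolding critical_depth_def using assms by (intro real_root_pos_unique) auto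
  moreover have "h * (1 + F\<^sup>2 / 2) = specific_energy g (h, u)"
    unfolding F(2) using assms g_pos by (simp add: specific_energy_def field_simps)
  ultimately show ?thesis by (simp add: froude_gap_def froude_def algebra_simps flip: F_def)
qed

lemma froude_le_iff: "0 < h \<Longrightarrow> froude g (h, u) \<le> K \<longleftrightarrow> u \<le> K * sqrt (g * h)"
  using g_pos by (simp add: froude_def divide_le_eq)

lemma froude_ge_iff: "0 < h \<Longrightarrow> K \<le> froude g (h, u) \<longleftrightarrow> K * sqrt (g * h) \<le> u"
  using g_pos by (simp add: froude_def le_divide_eq)

lemma is_conj_sp_exI_critical:
  assumes B: "0 < B" "0 < B'" and h: "0 < h" "0 < u" and sup: "supercritical_le g (h, u)"
    and E: "3 / 2 * critical_depth g (B * (h * u) / B') \<le> specific_energy g (h, u)"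
  obtains b where "is_conj_sp g B B' (h, u) b" "0 < fst b" "0 < snd b"
    "fst b * snd b = B * (h * u) / B'"
proof -
  define q where "q = B * (h * u) / B'"
  have q: "0 < q" "B * (h * u) = B' * q" using assms by (auto simp: q_def)
  obtain h' where h': "0 < h'" "is_conj_sp g B B' (h, u) (h', q / h')"
    using is_conj_sp_exI[OF g_pos sup q(2), of "critical_depth g q"] q critical_depth_pos[of q]
      critical_depth_cubed[of q] critical_depth_energy[of q] E unfolding q_def[symmetric] by (metis less_irrefl order_refl)
  have "0 < q / h'" using h'(1) q(1) by simp
  moreover have "h' * (q / h') = B * (h * u) / B'" using h'(1) by (simp add: q_def)
  ultimately show thesis using that[OF h'(2)] h'(1) by simp
qed

text \<open>No Froude limit is needed: \<open>(h - c)^2 (2 h + c) \<ge> 0\<close> says that every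
  flow has at least the critical energy \<open>3 / 2 * c\<close> of any discharge not exceeding its
  own, and widening reduces the discharge.\<close>

lemma conj_sp_widening:
  assumes B: "0 < B" "B \<le> B'" and h: "0 < h" "0 < u" and sup: "supercritical_le g (h, u)"
  obtains b where "is_conj_sp g B B' (h, u) b" "0 < fst b" "0 < snd b"
    "fst b * snd b = B * (h * u) / B'"
proof -
  define q where "q = B * (h * u) / B'"
  define c where "c = critical_depth g q"
  have q: "0 < q" using assms by (auto simp: q_def)
  have "B * (h * u) \<le> B' * (h * u)" using assms by (intro mult_right_mono) auto
  then have "q \<le> h * u" using assms by (simp add: q_def field_simps)
  then have "q\<^sup>2 \<le> (h * u)\<^sup>2" using q by (intro power_mono) auto
  then have c3: "g * c ^ 3 \<le> h\<^sup>2 * u\<^sup>2" unfolding c_def critical_depth_cubed by (simp add: power_mult_distrib)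
  have c: "0 < c" using critical_depth_pos[of q] q by (simp add: c_def)
  have "0 \<le> (h - c)\<^sup>2 * (2 * h + c)" using h c by simp
  also have "\<dots> = 2 * h ^ 3 + c ^ 3 - 3 * c * h\<^sup>2" by (simp add: power2_eq_square power3_eq_cube algebra_simps)
  finally have "g * (3 * c * h\<^sup>2) \<le> g * (2 * h ^ 3 + c ^ 3)" using g_pos by (intro mult_left_mono) auto
  also have "\<dots> \<le> 2 * g * h ^ 3 + h\<^sup>2 * u\<^sup>2" using c3 by (simp add: algebra_simps)
  finally have "h\<^sup>2 * (g * (3 * c)) \<le> h\<^sup>2 * (2 * g * h + u\<^sup>2)"
    by (simp add: power2_eq_square power3_eq_cube algebra_simps)
  then have "g * (3 * c) \<le> 2 * g * h + u\<^sup>2" using h by simp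
  then have "3 / 2 * c \<le> specific_energy g (h, u)"
    using g_pos by (simp add: specific_energy_def field_simps)
  then show thesis
    using is_conj_sp_exI_critical[of B B' h u] that assms by (auto simp: c_def q_def)
qed

lemma conj_sb_widening:
  assumes B: "0 < B" "B \<le> B'" and h: "0 < h" "0 < u" and sub: "subcritical_le g (h, u)"
  obtains b where "is_conj_sb g B B' (h, u) b" "0 < fst b" "0 < snd b"
    "fst b * snd b = B * (h * u) / B'"
proof -
  define q where "q = B * (h * u) / B'"
  have q: "0 < q" "B * (h * u) = B' * q" using assms by (auto simp: q_def)
  have "B * (h * u) \<le> B' * (h * u)" using assms by (intro mult_right_mono) auto
  then have "q \<le> h * u" using assms by (simp add: q_def field_simps)
  then have q2: "q\<^sup>2 \<le> (h * u)\<^sup>2" using q by (intro power_mono) auto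
  have "u\<^sup>2 \<le> g * h" using sub subcritical_le_iff[OF g_pos, of "(h, u)"] h by simp
  then have "(h * u)\<^sup>2 \<le> h\<^sup>2 * (g * h)" using h by (simp add: power_mult_distrib)
  with q2 have "q\<^sup>2 \<le> g * h ^ 3" by (simp add: power2_eq_square power3_eq_cube algebra_simps)
  moreover have "q\<^sup>2 / (2 * g * h\<^sup>2) \<le> (h * u)\<^sup>2 / (2 * g * h\<^sup>2)"
    using q2 g_pos by (intro divide_right_mono) auto
  then have "h + q\<^sup>2 / (2 * g * h\<^sup>2) \<le> specific_energy g (h, u)"
    using h by (simp add: specific_energy_def power_mult_distrib)
  \<comment> \<open>With the reduced discharge the old depth \<open>h\<close> is still subcritical
    and needs no more than the available energy, so the search starts there.\<close>
  ultimately obtain h' where h': "h \<le> h'" "is_conj_sb g B B' (h, u) (h', q / h')"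
    using is_conj_sb_exI[OF g_pos sub q(2) h(1)] by metis
  have "0 < h'" using h' h by simp
  have "0 < q / h'" using \<open>0 < h'\<close> q(1) by simp
  moreover have "h' * (q / h') = B * (h * u) / B'" using \<open>0 < h'\<close> by (simp add: q_def)
  ultimately show thesis using that[OF h'(2)] \<open>0 < h'\<close> by simp
qed

lemma conj_sb_narrowing:
  assumes B: "0 < B'" "B' < B" and h: "0 < h" "0 < u" and sub: "subcritical_le g (h, u)"
    and F: "froude g (h, u) \<le> K_sb (B' / B)"
  obtains b where "is_conj_sb g B B' (h, u) b" "0 < fst b" "0 < snd b"
    "fst b * snd b = B * (h * u) / B'"
proof -
  define q where "q = B * (h * u) / B'"
  have q: "0 < q" "B * (h * u) = B' * q" using assms by (auto simp: q_def)
  have "0 < froude g (h, u)" using h g_pos by (simp add: froude_def)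
  then have "0 \<le> h * froude_gap (B' / B) (froude g (h, u))"
    using froude_limits(5)[of "B' / B"] B F h by simp
  then have "3 / 2 * critical_depth g q \<le> specific_energy g (h, u)"
    using froude_gap_eq[of "B' / B" h u] B h by (simp add: q_def mult_ac)
  then obtain h' where h': "critical_depth g q \<le> h'" "is_conj_sb g B B' (h, u) (h', q / h')"
    using is_conj_sb_exI[OF g_pos sub q(2), of "critical_depth g q"] q critical_depth_pos[of q]
      critical_depth_cubed[of q] critical_depth_energy[of q] by (metis less_irrefl order_refl)
  have "0 < h'" using h'(1) critical_depth_pos[of q] q by simp
  have "0 < q / h'" using \<open>0 < h'\<close> q(1) by simp
  moreover have "h' * (q / h') = B * (h * u) / B'" using \<open>0 < h'\<close> by (simp add: q_def)
  ultimately show thesis using that[OF h'(2)] \<open>0 < h'\<close> by simp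
qed

text \<open>At the limit \<open>K_sb\<close> the gap vanishes: the energy is exactly that of
  critical flow in the narrow section. This yields the reflected state
  \<open>alpha_R\<close>.\<close>

lemma conj_sb_narrowing_critical:
  assumes B: "0 < B'" "B' < B" and h: "0 < h"
    and u: "u = K_sb (B' / B) * sqrt (g * h)"
  obtains c where "0 < c" "is_conj_sb g B B' (h, u) (c, sqrt (g * c))"
proof -
  have r: "0 < B' / B" "B' / B < 1" using B by auto
  note K = froude_limits[OF r]
  have u0: "0 < u" using K h g_pos u by simp
  have F: "froude g (h, u) = K_sb (B' / B)" using h g_pos u by (simp add: froude_def)
  define q where "q = B * (h * u) / B'"
  have q: "0 < q" "B * (h * u) = B' * q" using B h u0 by (auto simp: q_def)
  define c where "c = critical_depth g q"
  have c: "0 < c" using critical_depth_pos[of q] q by (simp add: c_def)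
  have "specific_energy g (h, u) = 3 / 2 * c"
    using froude_gap_eq[OF r(1) h u0] K(4) B unfolding F by (simp add: c_def q_def mult_ac)
  then have E: "c + q\<^sup>2 / (2 * g * c\<^sup>2) = specific_energy g (h, u)"
    using critical_depth_energy[of q] q unfolding c_def by (metis less_irrefl)
  have "q / c = sqrt (g * c)"
  proof (rule real_sqrt_unique[symmetric])
    have "q\<^sup>2 = g * c ^ 3" by (simp add: c_def critical_depth_cubed)
    then show "(q / c)\<^sup>2 = g * c" using c by (simp add: power_divide field_simps power2_eq_square power3_eq_cube)
  qed (use q c in simp)
  moreover have "u \<le> sqrt (g * h)" using u K h g_pos by (simp add: mult_left_le_one_le)
  ultimately have "is_conj_sb g B B' (h, u) (c, sqrt (g * c))"
    using smooth_transitionI[OF g_pos q(2) c E] u0 c g_pos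
    by (simp add: is_conj_sb_def subcritical_le_def)
  with c show thesis using that by blast
qed

lemma conj_sp_narrowing:
  assumes B: "0 < B'" "B' < B" and h: "0 < h" and F: "K_sp (B' / B) \<le> froude g (h, u)"
  obtains b where "is_conj_sp g B B' (h, u) b" "0 < fst b" "0 < snd b"
    "fst b * snd b = B * (h * u) / B'"
proof -
  have r: "0 < B' / B" "B' / B < 1" using B by auto
  note K = froude_limits[OF r]
  have "1 < froude g (h, u)" using F K by simp
  then have u: "sqrt (g * h) < u" using froude_le_iff[OF h, of u 1] by simp
  then have "0 < u" using h g_pos by (smt (verit) mult_pos_pos real_sqrt_gt_zero)
  have "0 \<le> h * froude_gap (B' / B) (froude g (h, u))"
    using K(5)[of "froude g (h, u)"] F h \<open>1 < froude g (h, u)\<close> by simp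
  then have "3 / 2 * critical_depth g (B * (h * u) / B') \<le> specific_energy g (h, u)"
    using froude_gap_eq[OF r(1) h \<open>0 < u\<close>] B by (simp add: mult_ac)
  moreover have "supercritical_le g (h, u)" using u by (simp add: supercritical_le_def)
  ultimately show thesis using is_conj_sp_exI_critical[of B B' h u] that B h \<open>0 < u\<close> by auto
qed

text \<open>
  A jump followed by a passage into the narrow section needs at least the energy of a direct passage.
\<close>

lemma froude_jump_gt_K_sb:
  assumes r: "0 < r" "r < 1" and a: "0 < fst a" and F: "1 < froude g a" "froude g a < K_sp r"
  shows "K_sb r < froude g (jump_conj g a)"
proof (rule ccontr)
  obtain h u where hu: "a = (h, u)" by fastforce
  obtain k v where J: "jump_conj g a = (k, v)" by fastforce
  have u: "sqrt (g * h) < u" using froude_le_iff[of h u 1] F a by (simp add: hu)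
  then have u0: "0 < u" using a g_pos by (smt (verit) mult_pos_pos real_sqrt_gt_zero fst_conv hu)
  have "supercritical_le g a" using u by (simp add: supercritical_le_def hu)
  note p = jump_conj_props[OF g_pos a _ this, unfolded hu J[unfolded hu] fst_conv snd_conv, OF u0]
  have k: "0 < k" using p(1) a by (simp add: hu)
  have "0 < froude g (k, v)" using k p(2) g_pos by (simp add: froude_def)
  assume "\<not> K_sb r < froude g (jump_conj g a)"
  then have "0 \<le> k * froude_gap r (froude g (k, v))"
    using froude_limits(5)[OF r \<open>0 < froude g (k, v)\<close>] k by (simp add: J)
  also have "\<dots> \<le> h * froude_gap r (froude g (h, u))"
    unfolding froude_gap_eq[OF r(1) k p(2)] froude_gap_eq[OF r(1) a[unfolded hu fst_conv] u0] p(3)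
    using p(5) by simp
  finally have "0 \<le> froude_gap r (froude g (h, u))" using a by (simp add: hu zero_le_mult_iff)
  then show False using froude_limits(2,5)[OF r] F by (auto simp: hu)
qed

text \<open>The squared Froude numbers before and after a jump are \<open>y (y + 1) / 2\<close> at
  \<open>y\<close> and at \<open>1 / y\<close>. \<open>K_jump\<close> arises from
  \<open>K_sb\<close> by this inversion, so it is the Froude number whose jump ends exactly at
  \<open>K_sb\<close>.\<close>

lemma froude_jump_le_K_sb_iff:
  assumes r: "0 < r" "r < 1" and a: "0 < fst a" "0 < snd a"
  shows "froude g (jump_conj g a) \<le> K_sb r \<longleftrightarrow> K_jump r \<le> froude g a"
proof -
  define K where "K = K_sb r"
  have K: "0 < K" "K < 1" using froude_limits[OF r] by (auto simp: K_def)
  define x where "x = (- 1 + sqrt (1 + 8 * K\<^sup>2)) / 2"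
  have x: "0 < x" using K by (simp add: x_def)
  have "2 * x + 1 = sqrt (1 + 8 * K\<^sup>2)" by (simp add: x_def field_simps)
  then have "(2 * x + 1)\<^sup>2 = 1 + 8 * K\<^sup>2" by simp
  then have K2: "K\<^sup>2 = x * (x + 1) / 2" by (simp add: power2_eq_square algebra_simps)
  have Kj: "K_jump r = sqrt 8 * K * (2 * x) powr (- 3 / 2)"
  proof -
    have "2 * x = - 1 + sqrt (1 + 8 * K\<^sup>2)" by (simp add: x_def)
    then show ?thesis by (simp only: K_jump_def K_def)
  qed
  have "((2 * x) powr (- 3 / 2))\<^sup>2 = (2 * x) powr (- 3)"
    using x by (simp add: power2_eq_square flip: powr_add)
  also have "\<dots> = 1 / (8 * x ^ 3)"
    using x by (simp add: powr_minus powr_numeral power_mult_distrib field_simps)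
  finally have pow: "((2 * x) powr (- 3 / 2))\<^sup>2 = 1 / (8 * x ^ 3)" .
  have Kj2: "(K_jump r)\<^sup>2 = (1 / x) * (1 / x + 1) / 2"
    unfolding Kj power_mult_distrib K2 pow using x by (simp add: field_simps power3_eq_cube)
  have Kj0: "0 \<le> K_jump r" unfolding Kj using K by simp
  obtain y where y: "0 < y" "2 * (snd a)\<^sup>2 = g * fst a * (y * (y + 1))"
      "jump_conj g a = (y * fst a, snd a / y)"
    using jump_ratio_exists[OF g_pos a(1)] a(2) by (metis less_irrefl)
  have fr2: "(froude g b)\<^sup>2 = (snd b)\<^sup>2 / (g * fst b)" if "0 < fst b" for b
    using that g_pos by (simp add: froude_def power_divide)
  have u2: "(snd a)\<^sup>2 = g * fst a * (y * (y + 1)) / 2" using y(2) by simp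
  have Fa: "(froude g a)\<^sup>2 = y * (y + 1) / 2"
    using a g_pos by (simp add: fr2 u2)
  have FJ: "(froude g (jump_conj g a))\<^sup>2 = (1 / y) * (1 / y + 1) / 2"
  proof -
    have "(froude g (jump_conj g a))\<^sup>2 = (snd a / y)\<^sup>2 / (g * (y * fst a))"
      using fr2[of "jump_conj g a"] a y(1) by (simp add: y(3))
    also have "\<dots> = (1 / y) * (1 / y + 1) / 2"
      unfolding power_divide u2 using a g_pos y(1) by (simp add: field_simps power2_eq_square)
    finally show ?thesis .
  qed
  have F0: "0 \<le> froude g a" "0 \<le> froude g (jump_conj g a)"
    using a g_pos y(1) by (auto simp: froude_def y(3))
  have quad: "s * (s + 1) / 2 \<le> t * (t + 1) / 2 \<longleftrightarrow> s \<le> t" if "0 < s" "0 < t" for s t :: real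
  proof -
    have "t * (t + 1) / 2 - s * (s + 1) / 2 = (t - s) * ((t + s + 1) / 2)" by (simp add: field_simps)
    moreover have "0 < (t + s + 1) / 2" using that by simp
    ultimately show ?thesis by (smt (verit) mult_nonneg_nonneg mult_neg_pos)
  qed
  have "froude g (jump_conj g a) \<le> K \<longleftrightarrow> (froude g (jump_conj g a))\<^sup>2 \<le> K\<^sup>2"
    using F0 K by (simp add: power2_le_iff_abs_le)
  also have "\<dots> \<longleftrightarrow> 1 / y \<le> x" unfolding FJ K2 using x y by (intro quad) auto
  also have "\<dots> \<longleftrightarrow> 1 / x \<le> y" using x y(1) by (simp add: field_simps)
  also have "\<dots> \<longleftrightarrow> (K_jump r)\<^sup>2 \<le> (froude g a)\<^sup>2" unfolding Fa Kj2 using x y by (intro quad[symmetric]) auto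
  also have "\<dots> \<longleftrightarrow> K_jump r \<le> froude g a"
    using F0 Kj0 by (metis abs_le_square_iff abs_of_nonneg)
  finally show ?thesis by (simp add: K_def)
qed

end

section \<open>The L-M curve\<close>

context
  fixes g :: real
  assumes g_pos: "0 < g"
begin

section \<open>Intersections of wave curves with curves of constant Froude number\<close>

lemma wave_velocity_0: "0 < fst a \<Longrightarrow> wave_velocity g a 0 = snd a + 2 * sqrt (g * fst a)"
  by (simp add: wave_velocity_def)

lemma wave_velocity_0_iff:
  assumes "0 < fst a"
  shows "0 \<le> wave_velocity g a 0 \<longleftrightarrow> - 2 \<le> froude g a" "0 < wave_velocity g a 0 \<longleftrightarrow> - 2 < froude g a"
proof -
  have "0 < sqrt (g * fst a)" using assms g_pos by simp
  then show "0 \<le> wave_velocity g a 0 \<longleftrightarrow> - 2 \<le> froude g a" "0 < wave_velocity g a 0 \<longleftrightarrow> - 2 < froude g a"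
    unfolding wave_velocity_0[OF assms] froude_def by (auto simp: field_simps)
qed

lemma wave_line_less:
  assumes "0 < fst a" "0 \<le> c" "0 \<le> x" "x < y"
  shows "wave_velocity g a y - c * sqrt (g * y) < wave_velocity g a x - c * sqrt (g * x)"
proof -
  have "c * sqrt (g * x) \<le> c * sqrt (g * y)" using assms g_pos by (intro mult_left_mono) auto
  then show ?thesis using wave_velocity_strict_antimono[OF g_pos assms(1,3,4)] by linarith
qed

lemma wave_line_unique:
  assumes "0 < fst a" "0 \<le> c" "0 \<le> x" "0 \<le> y"
    and "wave_velocity g a x = c * sqrt (g * x)" "wave_velocity g a y = c * sqrt (g * y)"
  shows "x = y"
  using wave_line_less[of a c x y] wave_line_less[of a c y x] assms by (cases x y rule: linorder_cases) auto

text \<open>\<open>- 2 \<le> froude g a\<close> is exactly nonnegative velocity at depth zero, the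
  sign needed at the left end. The value \<open>c = 0\<close> gives the states at rest,
  \<open>c = K_sb\<close> the reflected \<open>alpha_sb\<close>.\<close>

lemma wave_line_exists:
  assumes a: "0 < fst a" "- 2 \<le> froude g a" and c: "0 \<le> c"
  obtains h where "0 \<le> h" "wave_velocity g a h = c * sqrt (g * h)"
proof -
  obtain b where b: "0 \<le> b" "wave_velocity g a b \<le> 0" using wave_velocity_unbounded[OF g_pos a(1)] by blast
  have "0 \<le> c * sqrt (g * b)" using b c g_pos by simp
  then have "wave_velocity g a b - c * sqrt (g * b) \<le> 0" using b(2) by linarith
  moreover have "0 \<le> wave_velocity g a 0 - c * sqrt (g * 0)" using wave_velocity_0_iff(1)[OF a(1)] a(2) by simp
  moreover have "continuous_on {0..b} (\<lambda>h. wave_velocity g a h - c * sqrt (g * h))"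
    by (intro continuous_intros continuous_on_subset[OF wave_velocity_continuous[OF g_pos a(1)]]) auto
  ultimately obtain h where "0 \<le> h" "wave_velocity g a h - c * sqrt (g * h) = 0"
    using IVT2'[of "\<lambda>h. wave_velocity g a h - c * sqrt (g * h)" b 0 0] b(1) by auto
  then show thesis using that by simp
qed

lemma mem_T1_iff:
  assumes "0 < fst a"
  shows "s \<in> T1 g a \<longleftrightarrow> 0 \<le> fst s \<and> snd s = wave_velocity g a (fst s)"
    "s \<in> T2B g (mirror a) \<longleftrightarrow> 0 \<le> fst s \<and> snd s = - wave_velocity g a (fst s)"
proof -
  show 1: "s \<in> T1 g a \<longleftrightarrow> 0 \<le> fst s \<and> snd s = wave_velocity g a (fst s)" for s
    unfolding T1_eq[OF g_pos assms] by (cases s) auto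
  show "s \<in> T2B g (mirror a) \<longleftrightarrow> 0 \<le> fst s \<and> snd s = - wave_velocity g a (fst s)"
    unfolding T2B_eq[OF g_pos] mirror_simps mem_mirror_image_iff 1 by auto
qed

lemma the_T1_line:
  assumes "0 < fst a" "0 \<le> c" "0 \<le> h" "wave_velocity g a h = c * sqrt (g * h)"
  shows "(THE s. s \<in> T1 g a \<and> snd s = c * sqrt (g * fst s)) = (h, wave_velocity g a h)"
    "(THE s. s \<in> T2B g (mirror a) \<and> snd s = - c * sqrt (g * fst s)) = mirror (h, wave_velocity g a h)"
proof -
  have uniq: "x = h" if "0 \<le> x" "wave_velocity g a x = c * sqrt (g * x)" for x
    using wave_line_unique[OF assms(1,2) that(1) assms(3) that(2) assms(4)] .
  have "s = (h, wave_velocity g a h)"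
    if "0 \<le> fst s \<and> snd s = wave_velocity g a (fst s)" "snd s = c * sqrt (g * fst s)" for s
    using uniq[of "fst s"] that by (metis prod.collapse)
  then show "(THE s. s \<in> T1 g a \<and> snd s = c * sqrt (g * fst s)) = (h, wave_velocity g a h)"
    unfolding mem_T1_iff[OF assms(1)] using assms(3,4) by (intro the_equality) auto
  have "s = mirror (h, wave_velocity g a h)"
    if "0 \<le> fst s \<and> snd s = - wave_velocity g a (fst s)" "snd s = - c * sqrt (g * fst s)" for s
  proof -
    have "fst s = h" using uniq[of "fst s"] that by simp
    then show ?thesis using that by (metis mirror_simps(4) prod.collapse)
  qed
  then show "(THE s. s \<in> T2B g (mirror a) \<and> snd s = - c * sqrt (g * fst s)) = mirror (h, wave_velocity g a h)"
    unfolding mem_T1_iff[OF assms(1)] using assms(3,4) by (intro the_equality) auto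
qed

lemma K_L_eq:
  assumes "0 < fst a" "0 \<le> h" "wave_velocity g a h = 0"
  shows "K_L g a = (h, 0)" "K_R g (mirror a) = mirror (h, 0)"
  using the_T1_line[of a 0 h] assms by (auto simp: K_L_def K_R_def)

lemma between_T1_eq:
  assumes "0 < fst a" "0 \<le> h1" "h1 \<le> h2"
  shows "between (T1 g a) (h1, u1) (h2, u2) = (\<lambda>h. (h, wave_velocity g a h)) ` {h1..h2}"
  using assms by (auto simp: between_def T1_eq[OF g_pos assms(1)] closed_segment_eq_real_ivl)

lemma between_S1_eq:
  assumes "0 < fst a" "fst a \<le> h1" "h1 \<le> h2"
  shows "between (S1 g a) (h1, u1) (h2, u2) = (\<lambda>h. (h, wave_velocity g a h)) ` {h1..h2}"
  using assms by (auto simp: between_def S1_eq[OF g_pos assms(1)] closed_segment_eq_real_ivl)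

text \<open>The tail \<open>u < 0\<close> omits the state at rest; as the preceding piece contains
  it, the tail may be closed and glued as a ray.\<close>

lemma T1_tail_eq:
  assumes a: "0 < fst a" "0 \<le> hK" "wave_velocity g a hK = 0" and K: "(hK, 0) \<in> X"
  shows "X \<union> {s \<in> T1 g a. snd s < 0} = X \<union> {s \<in> T1 g a. hK \<le> fst s}"
proof -
  have "wave_velocity g a h < 0 \<longleftrightarrow> hK < h" if "0 \<le> h" for h
    using wave_velocity_strict_antimono[OF g_pos a(1), of h hK]
      wave_velocity_strict_antimono[OF g_pos a(1), of hK h] a that by (cases h hK rule: linorder_cases) auto
  then have iff: "snd s < 0 \<longleftrightarrow> hK < fst s" if "s \<in> T1 g a" for s
    using that by (simp add: mem_T1_iff[OF a(1)])
  have eq: "s = (hK, 0)" if "s \<in> T1 g a" "fst s = hK" for s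
    using that a(3) by (simp add: mem_T1_iff[OF a(1)] prod_eq_iff)
  show ?thesis
  proof (rule set_eqI)
    fix s
    show "s \<in> X \<union> {s \<in> T1 g a. snd s < 0} \<longleftrightarrow> s \<in> X \<union> {s \<in> T1 g a. hK \<le> fst s}"
      using K iff[of s] eq[of s] by (cases "fst s = hK") auto
  qed
qed

lemma T1_tail_dray:
  assumes a: "0 < fst a" "0 \<le> hK" "wave_velocity g a hK = 0" and X: "darc X P (hK, 0)"
  shows "dray (X \<union> {s \<in> T1 g a. snd s < 0}) P"
proof -
  have "(hK, 0) \<in> X" using X by (simp add: darc_def)
  moreover have "dray {s \<in> T1 g a. hK \<le> fst s} (hK, 0)" using T1_dray[OF g_pos a(1,2)] a(3) by simp
  ultimately show ?thesis unfolding T1_tail_eq[OF a \<open>(hK, 0) \<in> X\<close>] using darc_dray_Un[OF X] by blast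
qed

lemma T1_dray_0:
  assumes "0 < fst a"
  shows "dray (T1 g a) (0, wave_velocity g a 0)"
proof -
  have "{s \<in> T1 g a. 0 \<le> fst s} = T1 g a" by (auto simp: T1_eq[OF g_pos assms])
  then show ?thesis using T1_dray[OF g_pos assms, of 0] by simp
qed

lemma S1_jump_darc:
  assumes a: "0 < fst a" "0 < snd a" "supercritical_le g a"
  shows "darc (between (S1 g a) a (jump_conj g a)) a (jump_conj g a)"
proof -
  note p = jump_conj_props[OF g_pos a]
  have "jump_conj g a = (fst (jump_conj g a), wave_velocity g a (fst (jump_conj g a)))"
    unfolding p(6)[symmetric] by simp
  then have "jump_conj g a \<in> S1 g a"
    unfolding S1_eq[OF g_pos a(1)] by (rule image_eqI) (simp add: p(1))
  then show ?thesis using S1_darc[OF g_pos a(1)] by simp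
qed

lemma conj_energy_discharge:
  assumes "is_conj_sb g B B' a b \<or> is_conj_sp g B B' a b" "0 < B'"
  shows "specific_energy g b = specific_energy g a" "fst b * snd b = B * (fst a * snd a) / B'" "0 \<le> fst b"
  using assms by (auto simp: is_conj_sb_def is_conj_sp_def smooth_transition_def discharge_def field_simps)

text \<open>The first three pieces of the L-M curve, with \<open>a = uL\<close> in type III and with
  \<open>a\<close> the critical state \<open>gamma_L\<close> in type II. The point is the order of
  the \<open>CD\<close> piece: both its ends carry the same discharge, and jumping after the
  widening leaves less energy than jumping before it.\<close>

lemma supercritical_head_darc:
  assumes B: "0 < BL" "BL < BR" and a: "0 < fst a" "0 < snd a" "supercritical_le g a"
    and d: "is_conj_sb g BL BR (jump_conj g a) d"
  defines "b \<equiv> conj_sp g BL BR a"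
  shows "\<exists>uI. darc (R1 g b \<union> between (S1 g b) b (jump_conj g b) \<union> between (CD b) (jump_conj g b) d) (0, uI) d"
proof -
  have a': "supercritical_le g (fst a, snd a)" using a by simp
  obtain b' where b': "is_conj_sp g BL BR a b'" "0 < fst b'" "0 < snd b'"
      "fst b' * snd b' = BL * (fst a * snd a) / BR"
    using conj_sp_widening[OF g_pos B(1) less_imp_le[OF B(2)] a(1,2) a'] by auto
  have "conj_sp g BL BR a = b'"
    using conj_sp_eqI[OF g_pos b'(1)] B a by simp
  then have b: "b = b'" by (simp add: b_def)
  have sup: "supercritical_le g b" using b'(1) by (simp add: is_conj_sp_def b)
  have bpos: "0 < fst b" "0 < snd b" using b' b by auto
  note pa = jump_conj_props[OF g_pos a] and pb = jump_conj_props[OF g_pos bpos sup]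
  have B': "0 < BR" using B by simp
  note dD = conj_energy_discharge[OF disjI1[OF d] B'] and bD = conj_energy_discharge[OF disjI2[OF b'(1)] B', folded b]
  have q: "fst d * snd d = fst b * snd b" unfolding dD(2) bD(2) pa(3) ..
  have "BL * (fst a * snd a) \<le> BR * (fst a * snd a)" using B a by (intro mult_right_mono) auto
  then have "fst b * snd b \<le> fst a * snd a" unfolding bD(2) using B by (simp add: field_simps)
  then have "specific_energy g (jump_conj g b) \<le> specific_energy g (jump_conj g a)"
    using jump_conj_energy_le[OF g_pos a bpos sup] bD(1) by simp
  then have E: "specific_energy g (jump_conj g b) \<le> specific_energy g d" by (simp add: dD(1))
  have "(snd d)\<^sup>2 \<le> g * fst d"
    using d dD(3) subcritical_le_iff[OF g_pos, of d] by (simp add: is_conj_sb_def)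
  then have le: "fst (jump_conj g b) \<le> fst d"
    using subcritical_depth_le[OF g_pos, of "fst (jump_conj g b)" "fst d" "snd d" "snd (jump_conj g b)"]
      pb(1,3) bpos dD(3) q E by simp
  have "darc (between (CD b) (jump_conj g b) d) (jump_conj g b) d"
    using pb(1,3) bpos le q by (intro CD_darc) auto
  then show ?thesis
    using darc_Un[OF darc_Un[OF R1_darc[OF g_pos bpos(1)] S1_jump_darc[OF bpos sup]]] by blast
qed

lemma jump_is_on_wave:
  assumes a: "0 < fst a" "0 < snd a" "supercritical_le g a"
  shows "jump_conj g a = (fst (jump_conj g a), wave_velocity g a (fst (jump_conj g a)))"
    "wave_velocity g a (fst (jump_conj g a)) \<le> sqrt (g * fst (jump_conj g a))"
    "subcritical_le g (jump_conj g a)"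
proof -
  note p = jump_conj_props[OF g_pos a]
  show "jump_conj g a = (fst (jump_conj g a), wave_velocity g a (fst (jump_conj g a)))"
    unfolding p(6)[symmetric] by simp
  show sub: "subcritical_le g (jump_conj g a)" using p(1,4) a subcritical_le_iff[OF g_pos, of "jump_conj g a"] by simp
  then show "wave_velocity g a (fst (jump_conj g a)) \<le> sqrt (g * fst (jump_conj g a))"
    unfolding p(6)[symmetric] subcritical_le_def by simp
qed

lemma LM_III_dray:
  assumes B: "0 < BL" "BL < BR" and a: "0 < fst a" and F: "1 < froude g a"
  shows "\<exists>uI. dray (LM_III g BL BR a) (0, uI)"
proof -
  have "sqrt (g * fst a) < snd a" using froude_le_iff[OF g_pos a, of "snd a" 1] F by simp
  moreover have "0 < sqrt (g * fst a)" using a g_pos by simp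
  ultimately have a': "0 < snd a" "supercritical_le g a" unfolding supercritical_le_def by linarith+
  note p = jump_conj_props[OF g_pos a a'] and J = jump_is_on_wave[OF a a']
  define hJ where "hJ = fst (jump_conj g a)"
  have hJ: "0 < hJ" "fst a \<le> hJ" using p(1) a by (auto simp: hJ_def)
  have J': "0 < fst (jump_conj g a)" "subcritical_le g (fst (jump_conj g a), snd (jump_conj g a))"
    using p(1) a J(3) by auto
  obtain d where d: "is_conj_sb g BL BR (jump_conj g a) d"
    using conj_sb_widening[OF g_pos B(1) less_imp_le[OF B(2)] J'(1) p(2) J'(2), unfolded prod.collapse] by blast
  then have d_eq: "conj_sb g BL BR (jump_conj g a) = d" using conj_sb_eqI[OF g_pos] B by simp
  obtain uI where head: "darc (R1 g (conj_sp g BL BR a) \<union>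
        between (S1 g (conj_sp g BL BR a)) (conj_sp g BL BR a) (jump_conj g (conj_sp g BL BR a)) \<union>
        between (CD (conj_sp g BL BR a)) (jump_conj g (conj_sp g BL BR a)) d) (0, uI) d"
    using supercritical_head_darc[OF B a a' d] by blast
  obtain hK where hK: "0 \<le> hK" "wave_velocity g a hK = 0" using wave_line_exists[of a 0] a F by auto
  have "hJ \<le> hK"
  proof (rule ccontr)
    assume "\<not> hJ \<le> hK"
    then show False using wave_velocity_strict_antimono[OF g_pos a, of hK hJ] hK p(2,6) by (simp add: hJ_def)
  qed
  then have btw: "between (S1 g a) (jump_conj g a) (K_L g a) = (\<lambda>h. (h, wave_velocity g a h)) ` {hJ..hK}"
    unfolding K_L_eq(1)[OF a hK]
    using between_S1_eq[OF a hJ(2), of hK "snd (jump_conj g a)" 0] by (simp add: hJ_def)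
  have loc: "darc (conj_sb_locus g BL BR ((\<lambda>h. (h, wave_velocity g a h)) ` {hJ..hK})) d (hK, 0)"
    using B J(2) p(6,7) hJ \<open>hJ \<le> hK\<close> hK(2) d J(1)
    by (intro wave_locus_darc[OF g_pos _ _ a]) (auto simp: hJ_def)
  show ?thesis
    unfolding LM_III_def Let_def d_eq btw by (intro exI, rule T1_tail_dray[OF a hK darc_Un[OF head loc]])
qed

lemma degenerate_locus:
  assumes "0 < fst a" "wave_velocity g a 0 = 0" "0 < B" "0 < B'"
  shows "conj_sb_locus g B B' (between (T1 g a) (0, 0) (0, 0)) = {(0, 0)}"
proof -
  have "between (T1 g a) (0, 0) (0, 0) = {(0, 0)}"
    using between_T1_eq[OF assms(1), of 0 0 0 0] assms(2) by simp
  then show ?thesis using conj_dry(1)[OF g_pos assms(3,4)] by (auto simp: conj_sb_locus_def)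
qed

lemma R1_origin: "R1 g (0, 0) = {(0, 0)}"
  by (auto simp: R1_def)

lemma LM_II_dray:
  assumes B: "0 < BL" "BL < BR" and a: "0 < fst a" and F: "- 2 \<le> froude g a" "froude g a \<le> 1"
  shows "\<exists>uI. dray (LM_II g BL BR a) (0, uI)"
proof -
  \<comment> \<open>On the rarefaction \<open>u + 2 * sqrt (g * h)\<close> is constant, and at the
    critical state it equals \<open>3 * c\<close>.\<close>
  define c where "c = (snd a + 2 * sqrt (g * fst a)) / 3"
  have c0: "0 \<le> c" using wave_velocity_0_iff(1)[OF a] F(1) by (simp add: c_def wave_velocity_0[OF a])
  have "snd a \<le> sqrt (g * fst a)" using froude_le_iff[OF g_pos a, of "snd a" 1] F(2) by simp
  then have c1: "c \<le> sqrt (g * fst a)" by (simp add: c_def)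
  define hc where "hc = c\<^sup>2 / g"
  have hc: "0 \<le> hc" "sqrt (g * hc) = c" using c0 g_pos by (auto simp: hc_def)
  have "c\<^sup>2 \<le> (sqrt (g * fst a))\<^sup>2" using c0 c1 by (intro power_mono) auto
  then have hc_le: "hc \<le> fst a" using a g_pos by (simp add: hc_def field_simps)
  have wave_hc: "wave_velocity g a hc = c"
    using hc hc_le by (simp add: wave_velocity_def) (simp add: c_def)
  have gamma: "gamma_L g a = (hc, c)"
    unfolding gamma_L_def
  proof (rule the_equality)
    show "(hc, c) \<in> R1 g a \<and> snd (hc, c) = sqrt (g * fst (hc, c))"
      using hc hc_le wave_hc by (auto simp: R1_eq[OF g_pos])
    fix s assume s: "s \<in> R1 g a \<and> snd s = sqrt (g * fst s)"
    then have "fst s = hc"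
      using wave_line_unique[OF a, of 1 "fst s" hc] hc wave_hc by (auto simp: R1_eq[OF g_pos])
    then show "s = (hc, c)" using s hc by (simp add: prod_eq_iff)
  qed
  obtain hK where hK: "0 \<le> hK" "wave_velocity g a hK = 0" using wave_line_exists[of a 0] a F by auto
  show ?thesis
  proof (cases "c = 0")
    \<comment> \<open>This is \<open>F_L = -2\<close>: every piece except the tail shrinks to
      \<open>(0, 0)\<close> or, for \<open>CD\<close>, to the empty set.\<close>
    case True
    then have hc_0: "hc = 0" "wave_velocity g a 0 = 0" using wave_hc by (auto simp: hc_def)
    have "hK = 0" using wave_line_unique[OF a, of 0 hK 0] hK hc_0 by simp
    have B': "0 < BR" using B by simp
    have "conj_sp g BL BR (0, 0) = (0, 0)" "conj_sb g BL BR (0, 0) = (0, 0)"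
      unfolding conj_sp_def conj_sb_def conj_dry[OF g_pos B(1) B'] by auto
    then have "LM_II g BL BR a = {(0, 0)} \<union> {s \<in> T1 g a. snd s < 0}"
      unfolding LM_II_def Let_def gamma hc_0 True K_L_eq(1)[OF a hK] \<open>hK = 0\<close>
        degenerate_locus[OF a hc_0(2) B(1) B']
      by (auto simp: R1_origin jump_conj_def S1_def CD_def between_def)
    moreover have "dray ({(0, 0)} \<union> {s \<in> T1 g a. snd s < 0}) (0, 0)"
      using \<open>hK = 0\<close> by (intro T1_tail_dray[OF a hK]) (simp add: darc_def strictly_descending_def)
    ultimately show ?thesis by auto
  next
    case False
    then have c_pos: "0 < c" using c0 by simp
    then have hc_pos: "0 < hc" using g_pos by (simp add: hc_def)
    have c2: "c\<^sup>2 = g * hc" using g_pos by (simp add: hc_def)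
    have crit: "supercritical_le g (hc, c)" "subcritical_le g (hc, c)"
      using hc c_pos by (auto simp: supercritical_le_def subcritical_le_def)
    have J: "jump_conj g (hc, c) = (hc, c)" using jump_conj_critical[OF g_pos] hc_pos c2 by simp
    obtain d where d: "is_conj_sb g BL BR (hc, c) d"
      using conj_sb_widening[OF g_pos B(1) less_imp_le[OF B(2)] hc_pos c_pos crit(2)] by blast
    then have d_eq: "conj_sb g BL BR (hc, c) = d" using conj_sb_eqI[OF g_pos] B by simp
    obtain uI where head: "darc (R1 g (conj_sp g BL BR (hc, c)) \<union>
        between (S1 g (conj_sp g BL BR (hc, c))) (conj_sp g BL BR (hc, c)) (jump_conj g (conj_sp g BL BR (hc, c))) \<union>
        between (CD (conj_sp g BL BR (hc, c))) (jump_conj g (conj_sp g BL BR (hc, c))) d) (0, uI) d"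
      using supercritical_head_darc[OF B, of "(hc, c)" d] hc_pos c_pos crit d J by auto
    have "hc \<le> hK"
    proof (rule ccontr)
      assume "\<not> hc \<le> hK"
      then show False using wave_velocity_strict_antimono[OF g_pos a, of hK hc] hK c_pos wave_hc by simp
    qed
    then have btw: "between (T1 g a) (hc, c) (K_L g a) = (\<lambda>h. (h, wave_velocity g a h)) ` {hc..hK}"
      unfolding K_L_eq(1)[OF a hK] using between_T1_eq[OF a hc(1)] by simp
    have loc: "darc (conj_sb_locus g BL BR ((\<lambda>h. (h, wave_velocity g a h)) ` {hc..hK})) d (hK, 0)"
      using B hc hc_pos \<open>hc \<le> hK\<close> hK(2) d wave_hc \<open>snd a \<le> sqrt (g * fst a)\<close>
      by (intro wave_locus_darc[OF g_pos _ _ a]) auto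
    show ?thesis
      unfolding LM_II_def Let_def gamma d_eq btw by (intro exI, rule T1_tail_dray[OF a hK darc_Un[OF head loc]])
  qed
qed

lemma LM_curve_dray:
  assumes "0 < BL" "BL < BR" "0 < fst a"
  shows "\<exists>uI. dray (LM_curve g BL BR a) (0, uI)"
  using LM_II_dray[OF assms] LM_III_dray[OF assms] T1_dray_0[OF assms(3)]
  by (auto simp: LM_curve_def LM_I_def)

text \<open>Such a state lies on the tail \<open>u < 0\<close> of its own type II curve. It makes
  the curve pass through prescribed points in the examples for one and three solutions.\<close>

lemma LM_curve_self:
  assumes "0 < fst a" "snd a < 0" "- 1 \<le> froude g a"
  shows "a \<in> LM_curve g BL BR a"
proof -
  have "(fst a, wave_velocity g a (fst a)) \<in> T1 g a" using assms T1_eq[OF g_pos assms(1)] by auto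
  then have "a \<in> T1 g a" using g_pos by simp
  moreover have "froude g a \<le> 0" using assms g_pos by (simp add: froude_def divide_le_0_iff)
  ultimately show ?thesis using assms by (simp add: LM_curve_def LM_II_def Let_def)
qed

end

section \<open>The R-M locus\<close>

text \<open>
  The reflection \<open>u \<mapsto> - u\<close> turns the branches of the R-M locus into descending curves that consist of
  pieces of \<open>T\<^sub>1\<close> and loci of conjugate states, as the L-M curve does.
\<close>

context
  fixes g :: real
  assumes g_pos: "0 < g"
begin

lemma froude_mirror: "froude g (mirror a) = - froude g a"
  by (simp add: froude_def)

lemma mirror_R2B: "mirror ` R2B g (mirror a) = R1 g a"
  by (simp add: R2B_eq[OF g_pos])

lemma mirror_between_S2B: "mirror ` between (S2B g (mirror a)) (mirror b) (mirror c) = between (S1 g a) b c"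
  by (simp add: S2B_eq[OF g_pos] between_mirror[OF g_pos])

lemma mirror_between_CD: "mirror ` between (CD (mirror a)) (mirror b) (mirror c) = between (CD a) b c"
  by (simp add: CD_mirror[OF g_pos] between_mirror[OF g_pos])

lemma mirror_T2B_pos: "mirror ` {s \<in> T2B g (mirror a). snd s > 0} = {s \<in> T1 g a. snd s < 0}"
  by (auto simp: T2B_eq[OF g_pos] mem_mirror_image_iff)

lemma mirror_locus_T2B:
  "mirror ` conj_sb_locus g B B' (between (T2B g (mirror a)) (mirror b) (mirror c)) =
    conj_sb_locus g B B' (between (T1 g a) b c)"
  by (simp add: T2B_eq[OF g_pos] between_mirror[OF g_pos] conj_sb_locus_mirror[OF g_pos])

lemma mirror_locus_S2B:
  "mirror ` conj_sb_locus g B B' (between (S2B g (mirror a)) (mirror b) (mirror c)) =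
    conj_sb_locus g B B' (between (S1 g a) b c)"
  by (simp add: S2B_eq[OF g_pos] between_mirror[OF g_pos] conj_sb_locus_mirror[OF g_pos])

lemma supercritical_froude:
  assumes "0 < fst m" "1 < froude g m"
  shows "0 < snd m" "supercritical_le g m"
proof -
  have "sqrt (g * fst m) < snd m" using froude_le_iff[OF g_pos assms(1), of "snd m" 1] assms(2) by simp
  moreover have "0 < sqrt (g * fst m)" using assms g_pos by simp
  ultimately show "0 < snd m" "supercritical_le g m" unfolding supercritical_le_def by linarith+
qed

text \<open>Serves type II and the first branch of type III. If \<open>m\<close> is supercritical,
  \<open>reg\<close> ensures that the locus starts beyond the post-jump state, where energy
  increases.\<close>

lemma RM_main_branch_dray:
  assumes B: "0 < BL" "BL < BR" and m: "0 < fst m" and F: "- 2 \<le> froude g m"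
    and reg: "froude g m \<le> 1 \<or> 1 < froude g m \<and> K_sb (BL / BR) < froude g (jump_conj g m)"
  shows "\<exists>v. dray (mirror ` (R2B g (alpha_R g BL BR (mirror m)) \<union> RS g BL BR (mirror m) \<union>
    {s \<in> T2B g (mirror m). snd s > 0})) (0, v)"
proof -
  define K where "K = K_sb (BL / BR)"
  have B': "0 < BR" and r: "0 < BL / BR" "BL / BR < 1" using B by auto
  have K: "0 < K" "K < 1" using froude_limits[OF r] by (auto simp: K_def)
  obtain hp where hp: "0 \<le> hp" "wave_velocity g m hp = K * sqrt (g * hp)"
    using wave_line_exists[OF g_pos m F less_imp_le[OF K(1)]] by blast
  obtain hK where hK: "0 \<le> hK" "wave_velocity g m hK = 0"
    using wave_line_exists[OF g_pos m F, of 0] by auto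
  have asb: "alpha_sb g BL BR (mirror m) = mirror (hp, wave_velocity g m hp)"
    unfolding alpha_sb_def using the_T1_line(2)[OF g_pos m less_imp_le[OF K(1)] hp] by (simp add: K_def)
  have KR: "K_R g (mirror m) = mirror (hK, 0)" using K_L_eq(2)[OF g_pos m hK] .
  have RS: "mirror ` RS g BL BR (mirror m) =
      conj_sb_locus g BR BL (between (T1 g m) (hp, wave_velocity g m hp) (hK, 0))"
    unfolding RS_def asb KR mirror_locus_T2B ..
  show ?thesis
  proof (cases "hp = 0") \<comment> \<open>that is, \<open>froude g m = - 2\<close>\<close>
    case True
    then have w0: "wave_velocity g m 0 = 0" using hp by simp
    have "hK = 0" using wave_line_unique[OF g_pos m, of 0 hK 0] hK w0 by simp
    have "conj_sb g BR BL (0, 0) = (0, 0)"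
      unfolding conj_sb_def conj_dry[OF g_pos B' B(1)] by auto
    then have "alpha_R g BL BR (mirror m) = mirror (0, 0)" unfolding alpha_R_def asb True w0 by simp
    then have "mirror ` (R2B g (alpha_R g BL BR (mirror m)) \<union> RS g BL BR (mirror m) \<union>
        {s \<in> T2B g (mirror m). snd s > 0}) = {(0, 0)} \<union> {s \<in> T1 g m. snd s < 0}"
      unfolding image_Un RS mirror_T2B_pos True w0 \<open>hK = 0\<close> degenerate_locus[OF g_pos m w0 B' B(1)]
      by (simp only: mirror_R2B R1_origin[OF g_pos] Un_absorb)
    moreover have "dray ({(0, 0)} \<union> {s \<in> T1 g m. snd s < 0}) (0, 0)"
      using \<open>hK = 0\<close> by (intro T1_tail_dray[OF g_pos m hK]) (simp add: darc_def strictly_descending_def)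
    ultimately show ?thesis by metis
  next
    case False
    then have hp_pos: "0 < hp" using hp by simp
    obtain c where c: "0 < c" "is_conj_sb g BR BL (hp, wave_velocity g m hp) (c, sqrt (g * c))"
      using conj_sb_narrowing_critical[OF g_pos B hp_pos, of "wave_velocity g m hp"] hp(2)
      unfolding K_def by blast
    have "is_conj_sb g BR BL (mirror (hp, wave_velocity g m hp)) (mirror (c, sqrt (g * c)))"
      using c(2) unfolding is_conj_mirror[OF g_pos] .
    then have alpha: "alpha_R g BL BR (mirror m) = mirror (c, sqrt (g * c))"
      unfolding alpha_R_def asb by (rule conj_sb_eqI[OF g_pos _ B(1)])
    have v_pos: "0 < wave_velocity g m hp" using hp(2) K hp_pos g_pos by simp
    have sub: "wave_velocity g m hp \<le> sqrt (g * hp)"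
      unfolding hp(2) using K hp_pos g_pos by (intro mult_left_le_one_le) auto
    have "hp \<le> hK"
    proof (rule ccontr)
      assume "\<not> hp \<le> hK"
      then show False using wave_velocity_strict_antimono[OF g_pos m, of hK hp] hK v_pos by simp
    qed
    have cond: "snd m \<le> sqrt (g * fst m) \<or>
      fst m \<le> hp \<and> wave_velocity g m hp * shock_slope g (fst m) hp \<le> g"
    proof (cases "froude g m \<le> 1")
      case True
      then show ?thesis using froude_le_iff[OF g_pos m, of "snd m" 1] by simp
    next
      case False
      then have F1: "1 < froude g m" and FJ: "K < froude g (jump_conj g m)" using reg by (auto simp: K_def)
      note m' = supercritical_froude[OF m F1]
      note p = jump_conj_props[OF g_pos m m']
      define hJ where "hJ = fst (jump_conj g m)"
      have hJ: "fst m \<le> hJ" "0 < hJ" using p(1) m by (auto simp: hJ_def)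
      have "K * sqrt (g * hJ) < snd (jump_conj g m)"
        using FJ froude_le_iff[OF g_pos hJ(2), of "snd (jump_conj g m)" K] by (simp add: hJ_def)
      then have "K * sqrt (g * hJ) < wave_velocity g m hJ" unfolding p(6) hJ_def .
      \<comment> \<open>At \<open>hJ\<close> the wave curve is still above the curve
        \<open>u = K * sqrt (g * h)\<close>, so their crossing \<open>hp\<close> is deeper.\<close>
      then have "hJ \<le> hp"
        using wave_line_less[OF g_pos m less_imp_le[OF K(1)] hp(1), of hJ] hp(2) by linarith
      have "wave_velocity g m hp * shock_slope g (fst m) hp \<le> wave_velocity g m hJ * shock_slope g (fst m) hJ"
        using wave_velocity_antimono[OF g_pos m, of hJ hp] shock_slope_antimono[OF g_pos m hJ(2) \<open>hJ \<le> hp\<close>]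
          \<open>hJ \<le> hp\<close> hJ v_pos shock_slope_pos[OF g_pos m hp_pos] by (intro mult_mono) auto
      also have "\<dots> \<le> g" using p(6,7) by (simp add: hJ_def)
      finally show ?thesis using hJ \<open>hJ \<le> hp\<close> by simp
    qed
    have R1: "darc (R1 g (c, sqrt (g * c))) (0, sqrt (g * c) + 2 * sqrt (g * c)) (c, sqrt (g * c))"
      using R1_darc[OF g_pos, of "(c, sqrt (g * c))"] c(1) by simp
    have btw: "between (T1 g m) (hp, wave_velocity g m hp) (hK, 0) = (\<lambda>h. (h, wave_velocity g m h)) ` {hp..hK}"
      using between_T1_eq[OF g_pos m hp(1) \<open>hp \<le> hK\<close>] .
    have loc: "darc (conj_sb_locus g BR BL ((\<lambda>h. (h, wave_velocity g m h)) ` {hp..hK})) (c, sqrt (g * c)) (hK, 0)"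
      by (rule wave_locus_darc[OF g_pos B' B(1) m hp_pos sub cond \<open>hp \<le> hK\<close> hK(2) c(2)])
    show ?thesis
      unfolding image_Un RS mirror_T2B_pos alpha mirror_R2B btw
      by (intro exI, rule T1_tail_dray[OF g_pos m hK darc_Un[OF R1 loc]])
  qed
qed

lemma RM_supercritical_setup:
  assumes B: "0 < BL" "BL < BR" and m: "0 < fst m" and F: "K_sp (BL / BR) \<le> froude g m"
  obtains b where "conj_sp g BR BL (mirror m) = mirror b" "is_conj_sp g BR BL m b" "0 < fst b" "0 < snd b"
    "supercritical_le g b" "fst b * snd b = BR * (fst m * snd m) / BL"
    "1 < froude g m" "0 < snd m" "supercritical_le g m"
proof -
  have r: "0 < BL / BR" "BL / BR < 1" using B by auto
  have F1: "1 < froude g m" using froude_limits(3)[OF r] F by simp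
  note m' = supercritical_froude[OF m F1]
  obtain b where b: "is_conj_sp g BR BL m b" "0 < fst b" "0 < snd b"
      "fst b * snd b = BR * (fst m * snd m) / BL"
    using conj_sp_narrowing[OF g_pos B m, of "snd m", unfolded prod.collapse, OF F] by blast
  have "is_conj_sp g BR BL (mirror m) (mirror b)" using b(1) unfolding is_conj_mirror[OF g_pos] .
  then have "conj_sp g BR BL (mirror m) = mirror b"
    by (rule conj_sp_eqI[OF g_pos]) (use B m m' in auto)
  moreover have "supercritical_le g b" using b(1) by (simp add: is_conj_sp_def)
  ultimately show thesis using that b F1 m' by blast
qed

lemma RM_third_branch_darc:
  assumes b: "0 < fst b" "0 < snd b" "supercritical_le g b"
  shows "\<exists>v. darc (mirror ` (R2B g (mirror b) \<union>
      between (S2B g (mirror b)) (mirror b) (jump_conj g (mirror b)))) (0, v) (jump_conj g b)"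
  unfolding image_Un jump_conj_mirror[OF g_pos] mirror_R2B mirror_between_S2B
  by (intro exI, rule darc_Un[OF R1_darc[OF g_pos b(1)] S1_jump_darc[OF g_pos b]])

text \<open>\<open>beta_R\<close> has the critical depth of the discharge of \<open>b\<close>, and
  the post-jump state, being subcritical, is at least as deep.\<close>

lemma RM_III_second_branch_darc:
  assumes b: "0 < fst b" "0 < snd b" "supercritical_le g b"
    and R: "conj_sp g BR BL uR = mirror b"
  shows "\<exists>v. darc (mirror ` (R2B g (beta_R g BL BR uR) \<union>
      between (CD (mirror b)) (beta_R g BL BR uR) (jump_conj g (mirror b)))) (0, v) (jump_conj g b)"
proof -
  define q where "q = fst b * snd b"
  have q: "0 < q" using b by (simp add: q_def)
  define c where "c = critical_depth g q"
  have c: "0 < c" using critical_depth_pos[OF g_pos, of q] q by (simp add: c_def)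
  have c3: "g * c ^ 3 = q\<^sup>2" by (simp add: c_def critical_depth_cubed[OF g_pos])
  have crit: "q / h = sqrt (g * h) \<longleftrightarrow> h = c" if "0 < h" for h
  proof -
    have "q / h = sqrt (g * h) \<longleftrightarrow> (q / h)\<^sup>2 = g * h"
    proof
      assume "(q / h)\<^sup>2 = g * h"
      then have "sqrt (g * h) = q / h" using q that by (intro real_sqrt_unique) auto
      then show "q / h = sqrt (g * h)" by simp
    qed (use that g_pos in simp)
    also have "\<dots> \<longleftrightarrow> q\<^sup>2 = g * h * h\<^sup>2" using that by (simp add: power_divide divide_eq_eq)
    also have "\<dots> \<longleftrightarrow> g * c ^ 3 = g * h ^ 3"
      unfolding c3 by (simp only: power3_eq_cube power2_eq_square mult.assoc)
    also have "\<dots> \<longleftrightarrow> h = c" using g_pos c that by (auto simp: power_eq_iff_eq_base)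
    finally show ?thesis .
  qed
  have beta: "beta_R g BL BR uR = mirror (c, q / c)"
    unfolding beta_R_def R
  proof (rule the_equality)
    show "mirror (c, q / c) \<in> CD (mirror b) \<and> snd (mirror (c, q / c)) = - sqrt (g * fst (mirror (c, q / c)))"
      using c crit[OF c] by (simp add: CD_def q_def)
    fix s assume s: "s \<in> CD (mirror b) \<and> snd s = - sqrt (g * fst s)"
    then have "0 < fst s" "snd s = - (q / fst s)" by (auto simp: CD_def q_def)
    with s crit[of "fst s"] have "fst s = c" by simp
    then show "s = mirror (c, q / c)" using \<open>snd s = - (q / fst s)\<close> by (simp add: prod_eq_iff)
  qed
  note p = jump_conj_props[OF g_pos b]
  define k v where "k = fst (jump_conj g b)" and "v = snd (jump_conj g b)"
  have kv: "0 < k" "k * v = q" "v\<^sup>2 \<le> g * k" using p(1,3,4) b by (auto simp: k_def v_def q_def)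
  have "q\<^sup>2 \<le> g * k ^ 3"
    unfolding kv(2)[symmetric] power_mult_distrib
    using mult_left_mono[OF kv(3), of "k\<^sup>2"] by (simp add: power2_eq_square power3_eq_cube mult_ac)
  then have ck: "c \<le> fst (jump_conj g b)"
    using critical_depth_le_iff[OF g_pos, of k q] kv(1) by (simp add: c_def k_def)
  have CD: "darc (between (CD b) (c, q / c) (jump_conj g b)) (c, q / c) (jump_conj g b)"
    using c ck kv(2) q by (intro CD_darc[OF g_pos]) (auto simp: k_def v_def q_def)
  have R1: "darc (R1 g (c, q / c)) (0, q / c + 2 * sqrt (g * c)) (c, q / c)"
    using R1_darc[OF g_pos, of "(c, q / c)"] c by simp
  show ?thesis
    unfolding image_Un beta jump_conj_mirror[OF g_pos] mirror_R2B mirror_between_CD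
    by (intro exI, rule darc_Un[OF R1 CD])
qed

text \<open>\<open>F\<close> says that the flow after the jump can enter the narrow section, which
  yields the common start \<open>d\<close> of the two branches. It is not deeper than
  \<open>jump_conj g b\<close>: with equal discharge, jumping before the narrowing leaves no more
  energy than jumping after it.\<close>

lemma RM_IV_branches:
  assumes B: "0 < BL" "BL < BR" and m: "0 < fst m" "1 < froude g m"
    and F: "froude g (jump_conj g m) \<le> K_sb (BL / BR)"
    and b: "is_conj_sp g BR BL m b" "0 < fst b" "0 < snd b" "supercritical_le g b"
    "fst b * snd b = BR * (fst m * snd m) / BL"
  defines "D \<equiv> conj_sb g BR BL (jump_conj g (mirror m))"
  shows "\<exists>d. 0 < fst d \<and> D = mirror d \<and>
    dray (mirror ` (conj_sb_locus g BR BL (between (S2B g (mirror m)) (jump_conj g (mirror m)) (K_R g (mirror m))) \<union>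
      {s \<in> T2B g (mirror m). snd s > 0})) d \<and>
    darc (mirror ` between (CD (mirror b)) D (jump_conj g (mirror b))) d (jump_conj g b)"
proof -
  note m' = supercritical_froude[OF m]
  note p = jump_conj_props[OF g_pos m(1) m'] and J = jump_is_on_wave[OF g_pos m(1) m']
  define hJ where "hJ = fst (jump_conj g m)"
  have hJ: "fst m \<le> hJ" "0 < hJ" using p(1) m by (auto simp: hJ_def)
  have J': "0 < fst (jump_conj g m)" "subcritical_le g (fst (jump_conj g m), snd (jump_conj g m))"
      "froude g (fst (jump_conj g m), snd (jump_conj g m)) \<le> K_sb (BL / BR)"
    using hJ(2) J(3) F by (auto simp: hJ_def)
  obtain d where d: "is_conj_sb g BR BL (jump_conj g m) d" "0 < fst d" "0 < snd d"
    using conj_sb_narrowing[OF g_pos B J'(1) p(2) J'(2,3), unfolded prod.collapse] by blast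
  have "is_conj_sb g BR BL (mirror (jump_conj g m)) (mirror d)"
    using d(1) unfolding is_conj_mirror[OF g_pos] .
  then have D: "D = mirror d"
    unfolding D_def jump_conj_mirror[OF g_pos] by (rule conj_sb_eqI[OF g_pos _ B(1)])
  obtain hK where hK: "0 \<le> hK" "wave_velocity g m hK = 0"
    using wave_line_exists[OF g_pos m(1), of 0] m(2) by auto
  have "hJ \<le> hK"
  proof (rule ccontr)
    assume "\<not> hJ \<le> hK"
    then show False using wave_velocity_strict_antimono[OF g_pos m(1), of hK hJ] hK p(2,6) by (simp add: hJ_def)
  qed
  then have btw: "between (S1 g m) (jump_conj g m) (hK, 0) = (\<lambda>h. (h, wave_velocity g m h)) ` {hJ..hK}"
    using between_S1_eq[OF g_pos m(1) hJ(1), of hK "snd (jump_conj g m)" 0] by (simp add: hJ_def)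
  have loc: "darc (conj_sb_locus g BR BL ((\<lambda>h. (h, wave_velocity g m h)) ` {hJ..hK})) d (hK, 0)"
    using B J(2) p(6,7) hJ \<open>hJ \<le> hK\<close> hK(2) d J(1)
    by (intro wave_locus_darc[OF g_pos _ _ m(1)]) (auto simp: hJ_def)
  have 1: "dray (mirror ` (conj_sb_locus g BR BL (between (S2B g (mirror m)) (jump_conj g (mirror m)) (K_R g (mirror m))) \<union>
      {s \<in> T2B g (mirror m). snd s > 0})) d"
    unfolding image_Un jump_conj_mirror[OF g_pos] K_L_eq(2)[OF g_pos m(1) hK] mirror_locus_S2B
      mirror_T2B_pos btw
    by (rule T1_tail_dray[OF g_pos m(1) hK loc])
  note pb = jump_conj_props[OF g_pos b(2-4)]
  note dD = conj_energy_discharge[OF g_pos disjI1[OF d(1)] B(1)]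
    and bD = conj_energy_discharge[OF g_pos disjI2[OF b(1)] B(1)]
  have q: "fst d * snd d = fst b * snd b" unfolding dD(2) bD(2) p(3) ..
  have "BL * (fst m * snd m) \<le> BR * (fst m * snd m)" using B m m' by (intro mult_right_mono) auto
  then have "fst m * snd m \<le> fst b * snd b" unfolding bD(2) using B by (simp add: field_simps)
  then have "specific_energy g (jump_conj g m) \<le> specific_energy g (jump_conj g b)"
    using jump_conj_energy_le[OF g_pos b(2-4) m(1) m'] bD(1) by simp
  then have E: "specific_energy g d \<le> specific_energy g (jump_conj g b)" by (simp add: dD(1))
  have le: "fst d \<le> fst (jump_conj g b)"
    using subcritical_depth_le[OF g_pos d(2), of "fst (jump_conj g b)" "snd (jump_conj g b)" "snd d"]
      pb(1,3,4) b q E by simp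
  have CD: "darc (between (CD b) d (jump_conj g b)) d (jump_conj g b)"
    using pb(1,3) b(2,3) d(2) le q by (intro CD_darc[OF g_pos]) auto
  show ?thesis
    unfolding D jump_conj_mirror[OF g_pos] mirror_between_CD
    using d(2) CD 1[unfolded jump_conj_mirror[OF g_pos]] by blast
qed

end

section \<open>The number of solutions\<close>

text \<open>If the curve passes below \<open>d\<close>, then by descending it passes below the
  deeper and faster rising end \<open>e\<close> as well. The other two claims serve the examples
  with three solutions and with one.\<close>

lemma lies_above_or_below:
  assumes "dray LM (0, uI)" "0 \<le> fst d" "fst d \<le> fst e" "snd d \<le> snd e"
  shows "lies_above LM d \<or> lies_below LM e"
    "e \<in> LM \<Longrightarrow> lies_above LM d \<and> lies_below LM e"
    "(fst e, u) \<in> LM \<Longrightarrow> snd e < u \<Longrightarrow> \<not> lies_below LM e"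
proof -
  obtain f where f: "LM = (\<lambda>h. (h, f h)) ` {0..}" "\<And>x y. 0 \<le> x \<Longrightarrow> x < y \<Longrightarrow> f y < f x"
    using dray_imp_graph[OF assms(1)] by (metis fst_conv)
  have mem: "(h, u) \<in> LM \<longleftrightarrow> 0 \<le> h \<and> u = f h" for h u by (auto simp: f(1))
  have le: "f (fst e) \<le> f (fst d)"
    using f(2)[of "fst d" "fst e"] assms(2,3) by (cases "fst d = fst e") auto
  have above: "lies_above LM d \<longleftrightarrow> snd d \<le> f (fst d)" and below: "lies_below LM e \<longleftrightarrow> f (fst e) \<le> snd e"
    using assms(2,3) by (auto simp: lies_above_def lies_below_def mem)
  show "lies_above LM d \<or> lies_below LM e" using le assms(4) unfolding above below by linarith
  show "lies_above LM d \<and> lies_below LM e" if "e \<in> LM"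
    using that mem[of "fst e" "snd e"] le assms(4) unfolding above below by auto
  show "\<not> lies_below LM e" if "(fst e, u) \<in> LM" "snd e < u" using that unfolding below by (auto simp: mem)
qed

lemma card_if_singleton:
  "if P then is_singleton X else X = {} \<Longrightarrow> finite X \<and> card X = (if P then 1 else 0)"
  by (auto simp: is_singleton_def split: if_splits)

lemma solutions_single_branch:
  assumes "RM_branches g BL BR uR = [D]"
  shows "solutions g BL BR uL uR = branch_solutions (LM_curve g BL BR uL) 0 D"
  by (simp add: solutions_eq assms lessThan_Suc)

lemma card_solutions_three_branches:
  assumes "RM_branches g BL BR uR = [D0, D1, D2]"
    and "if P0 then is_singleton (branch_solutions (LM_curve g BL BR uL) 0 D0)
      else branch_solutions (LM_curve g BL BR uL) 0 D0 = {}"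
    and "if P1 then is_singleton (branch_solutions (LM_curve g BL BR uL) 1 D1)
      else branch_solutions (LM_curve g BL BR uL) 1 D1 = {}"
    and "if P2 then is_singleton (branch_solutions (LM_curve g BL BR uL) 2 D2)
      else branch_solutions (LM_curve g BL BR uL) 2 D2 = {}"
  shows "card (solutions g BL BR uL uR) =
    (if P0 then 1 else 0) + (if P1 then 1 else 0) + (if P2 then 1 else 0)"
proof -
  define X where "X i = branch_solutions (LM_curve g BL BR uL) i ([D0, D1, D2] ! i)" for i
  have X: "finite (X 0)" "card (X 0) = (if P0 then 1 else 0)" "finite (X 1)" "card (X 1) = (if P1 then 1 else 0)"
    "finite (X 2)" "card (X 2) = (if P2 then 1 else 0)"
    using assms(2-4)[THEN card_if_singleton] by (auto simp: X_def numeral_2_eq_2)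
  have fin: "finite (X i)" if "i < 3" for i
    using X that by (auto simp: less_Suc_eq numeral_3_eq_3 numeral_2_eq_2)
  have "solutions g BL BR uL uR = (\<Union>i<3. X i)"
    by (simp add: solutions_eq assms(1) X_def numeral_3_eq_3)
  then have "card (solutions g BL BR uL uR) = (\<Sum>i<3. card (X i))"
    using fin branch_solutions_disjoint by (simp add: card_UN_disjoint X_def)
  then show ?thesis using X by (simp add: numeral_3_eq_3 numeral_2_eq_2)
qed

context
  fixes g :: real
  assumes g_pos: "0 < g"
begin

lemma RM_branches_single:
  assumes B: "0 < BL" "BL < BR" and uR: "0 < fst uR" and F: "- K_sp (BL / BR) < froude g uR"
  shows "\<exists>D v. RM_branches g BL BR uR = [D] \<and> dray (mirror ` D) (0, v)"
proof -
  define m where "m = mirror uR"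
  have m: "uR = mirror m" "0 < fst m" using uR by (auto simp: m_def)
  have r: "0 < BL / BR" "BL / BR < 1" using B by auto
  show ?thesis
  proof (cases "2 < froude g uR")
    case True
    have "mirror ` T2B g uR = T1 g m" by (simp add: m_def T2B_eq[OF g_pos])
    then show ?thesis
      using True T1_dray_0[OF g_pos m(2)] by (simp add: RM_branches_def RM_I_def) blast
  next
    case False
    then have Fm: "- 2 \<le> froude g m" "froude g m < K_sp (BL / BR)" using F by (auto simp: m(1) froude_mirror[OF g_pos])
    have "froude g m \<le> 1 \<or> 1 < froude g m \<and> K_sb (BL / BR) < froude g (jump_conj g m)"
      using froude_jump_gt_K_sb[OF g_pos r m(2) _ Fm(2)] by linarith
    from RM_main_branch_dray[OF g_pos B m(2) Fm(1) this]
    show ?thesis using False F unfolding m(1)[symmetric] by (simp add: RM_branches_def RM_II_def)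
  qed
qed

text \<open>A common form of types III and IV: the first two branches both start at depth zero, or
  both start in one state of positive depth. The facts about \<open>e\<close> make it a possible
  left state for \<open>LM_curve_self\<close>.\<close>

lemma RM_branches_triple:
  assumes B: "0 < BL" "BL < BR" and uR: "0 < fst uR" and F: "froude g uR \<le> - K_sp (BL / BR)"
  obtains D0 D1 D2 d0 d1 e where "RM_branches g BL BR uR = [D0, D1, D2]"
    "dray (mirror ` D0) (mirror d0)" "darc (mirror ` D1) (mirror d1) (mirror e)"
    "\<exists>v. darc (mirror ` D2) (0, v) (mirror e)"
    "fst d0 = 0 \<and> fst d1 = 0 \<or> d0 = d1 \<and> 0 < fst d1" "0 < fst e" "snd e < 0" "(snd e)\<^sup>2 \<le> g * fst e"
proof -
  define m where "m = mirror uR"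
  have m: "uR = mirror m" "0 < fst m" using uR by (auto simp: m_def)
  have Fm: "K_sp (BL / BR) \<le> froude g m" using F by (simp add: m(1) froude_mirror[OF g_pos])
  have r: "0 < BL / BR" "BL / BR < 1" using B by auto
  obtain b where b: "conj_sp g BR BL (mirror m) = mirror b" "is_conj_sp g BR BL m b" "0 < fst b" "0 < snd b"
    "supercritical_le g b" "fst b * snd b = BR * (fst m * snd m) / BL"
    "1 < froude g m" "0 < snd m" "supercritical_le g m"
    by (rule RM_supercritical_setup[OF g_pos B m(2) Fm])
  note pb = jump_conj_props[OF g_pos b(3-5)]
  define e where "e = mirror (jump_conj g b)"
  have e: "0 < fst e" "snd e < 0" "(snd e)\<^sup>2 \<le> g * fst e" "mirror e = jump_conj g b"
    using pb(1,2,4) b(3) by (auto simp: e_def)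
  obtain v3 where 3: "darc (mirror ` (R2B g (mirror b) \<union>
      between (S2B g (mirror b)) (mirror b) (jump_conj g (mirror b)))) (0, v3) (mirror e)"
    using RM_third_branch_darc[OF g_pos b(3-5)] e(4) by auto
  have not_I_II: "\<not> 2 < froude g uR" "\<not> - K_sp (BL / BR) < froude g uR"
    using F froude_limits(3)[OF r] by auto
  show thesis
  proof (cases "K_jump (BL / BR) \<le> froude g m")
    case False
    then have "K_sb (BL / BR) < froude g (jump_conj g m)"
      using froude_jump_le_K_sb_iff[OF g_pos r m(2) b(8)] by simp
    then obtain v1 where 1: "dray (mirror ` (R2B g (alpha_R g BL BR (mirror m)) \<union> RS g BL BR (mirror m) \<union>
        {s \<in> T2B g (mirror m). snd s > 0})) (0, v1)"
      using RM_main_branch_dray[OF g_pos B m(2)] b(7) by auto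
    obtain v2 where 2: "darc (mirror ` (R2B g (beta_R g BL BR uR) \<union>
      between (CD (mirror b)) (beta_R g BL BR uR) (jump_conj g (mirror b)))) (0, v2) (mirror e)"
      using RM_III_second_branch_darc[OF g_pos b(3-5) b(1)[folded m(1)]] e(4) by auto
    have "- K_jump (BL / BR) < froude g uR" using False by (simp add: m(1) froude_mirror[OF g_pos])
    then have "RM_branches g BL BR uR = RM_III g BL BR uR" using not_I_II by (simp add: RM_branches_def)
    also have "\<dots> = [R2B g (alpha_R g BL BR (mirror m)) \<union> RS g BL BR (mirror m) \<union> {s \<in> T2B g (mirror m). snd s > 0},
        R2B g (beta_R g BL BR uR) \<union> between (CD (mirror b)) (beta_R g BL BR uR) (jump_conj g (mirror b)),
        R2B g (mirror b) \<union> between (S2B g (mirror b)) (mirror b) (jump_conj g (mirror b))]"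
      unfolding RM_III_def Let_def using b(1) by (simp add: m(1))
    finally have R: "RM_branches g BL BR uR = \<dots>" .
    show thesis
    proof (rule that[OF R _ _ _ _ e(1-3)])
      show "dray (mirror ` (R2B g (alpha_R g BL BR (mirror m)) \<union> RS g BL BR (mirror m) \<union>
        {s \<in> T2B g (mirror m). snd s > 0})) (mirror (0, - v1))" using 1 by simp
      show "darc (mirror ` (R2B g (beta_R g BL BR uR) \<union>
        between (CD (mirror b)) (beta_R g BL BR uR) (jump_conj g (mirror b)))) (mirror (0, - v2)) (mirror e)"
        using 2 by simp
      show "fst (0 :: real, - v1) = 0 \<and> fst (0 :: real, - v2) = 0 \<or> (0, - v1) = (0, - v2) \<and> 0 < fst (0 :: real, - v2)"
        by simp
    qed (intro exI, rule 3)
  next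
    case True
    then have FJ: "froude g (jump_conj g m) \<le> K_sb (BL / BR)"
      using froude_jump_le_K_sb_iff[OF g_pos r m(2) b(8)] by simp
    obtain d where d: "0 < fst d" "conj_sb g BR BL (jump_conj g (mirror m)) = mirror d"
      "dray (mirror ` (conj_sb_locus g BR BL (between (S2B g (mirror m)) (jump_conj g (mirror m)) (K_R g (mirror m))) \<union>
        {s \<in> T2B g (mirror m). snd s > 0})) d"
      "darc (mirror ` between (CD (mirror b)) (conj_sb g BR BL (jump_conj g (mirror m))) (jump_conj g (mirror b)))
        d (jump_conj g b)"
      using RM_IV_branches[OF g_pos B m(2) b(7) FJ b(2-6)] by (elim exE conjE) (rule that)
    note d4 = d(4)[unfolded d(2)]
    have "\<not> - K_jump (BL / BR) < froude g uR" using True by (simp add: m(1) froude_mirror[OF g_pos])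
    then have "RM_branches g BL BR uR = RM_IV g BL BR uR" using not_I_II by (simp add: RM_branches_def)
    also have "\<dots> = [conj_sb_locus g BR BL (between (S2B g (mirror m)) (jump_conj g (mirror m)) (K_R g (mirror m))) \<union>
        {s \<in> T2B g (mirror m). snd s > 0},
        between (CD (mirror b)) (mirror d) (jump_conj g (mirror b)),
        R2B g (mirror b) \<union> between (S2B g (mirror b)) (mirror b) (jump_conj g (mirror b))]"
      unfolding RM_IV_def Let_def using b(1) d(2) by (simp add: m(1))
    finally have R: "RM_branches g BL BR uR = \<dots>" .
    show thesis
    proof (rule that[OF R _ _ _ _ e(1-3)])
      show "dray (mirror ` (conj_sb_locus g BR BL (between (S2B g (mirror m)) (jump_conj g (mirror m)) (K_R g (mirror m))) \<union>
        {s \<in> T2B g (mirror m). snd s > 0})) (mirror (mirror d))" using d(3) by simp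
      show "darc (mirror ` between (CD (mirror b)) (mirror d) (jump_conj g (mirror b))) (mirror (mirror d)) (mirror e)"
        using d4 e(4) by simp
      show "fst (mirror d) = 0 \<and> fst (mirror d) = 0 \<or> mirror d = mirror d \<and> 0 < fst (mirror d)"
        using d(1) by simp
    qed (intro exI, rule 3)
  qed
qed

lemma card_solutions_single:
  assumes B: "0 < BL" "BL < BR" and u: "0 < fst uL" "0 < fst uR" and F: "- K_sp (BL / BR) < froude g uR"
  shows "card (solutions g BL BR uL uR) = 1"
proof -
  obtain uI where LM: "dray (LM_curve g BL BR uL) (0, uI)" using LM_curve_dray[OF g_pos B u(1)] by blast
  obtain D v where D: "RM_branches g BL BR uR = [D]" "dray (mirror ` D) (mirror (0, - v))"
    using RM_branches_single[OF B u(2) F] by auto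
  show ?thesis
    using branch_solutions_ray[OF LM D(2), of 0] solutions_single_branch[OF D(1)] by (simp add: is_singleton_altdef)
qed

lemma card_solutions_triple:
  assumes B: "0 < BL" "BL < BR" and uR: "0 < fst uR" and F: "froude g uR \<le> - K_sp (BL / BR)"
  shows "0 < fst uL \<Longrightarrow> card (solutions g BL BR uL uR) \<in> {1, 3}"
    "\<exists>uL. 0 < fst uL \<and> card (solutions g BL BR uL uR) = 1"
    "\<exists>uL. 0 < fst uL \<and> card (solutions g BL BR uL uR) = 3"
proof -
  obtain D0 D1 D2 d0 d1 e where D: "RM_branches g BL BR uR = [D0, D1, D2]"
    "dray (mirror ` D0) (mirror d0)" "darc (mirror ` D1) (mirror d1) (mirror e)"
    "\<exists>v. darc (mirror ` D2) (0, v) (mirror e)"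
    "fst d0 = 0 \<and> fst d1 = 0 \<or> d0 = d1 \<and> 0 < fst d1" and e: "0 < fst e" "snd e < 0" "(snd e)\<^sup>2 \<le> g * fst e"
    by (rule RM_branches_triple[OF B uR F])
  obtain v2 where "darc (mirror ` D2) (0, v2) (mirror e)" using D(4) by blast
  then have D2: "darc (mirror ` D2) (mirror (0, - v2)) (mirror e)" "0 \<le> fst (0 :: real, - v2)" by simp_all
  have d0: "0 \<le> fst d0" "0 \<le> fst d1" using D(5) by auto
  have "mirror d1 \<in> mirror ` D1" using D(3) by (simp add: darc_def)
  from darc_bounds[OF D(3) this] have le: "fst d1 \<le> fst e" "snd d1 \<le> snd e" by auto
  \<comment> \<open>Below \<open>e\<close>, the third branch is hit, and the first two are hit
    together or not at all, as their starting conditions agree. Otherwise only the first one is hit,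
    by \<open>or\<close>.\<close>
  have count: "card (solutions g BL BR uL uR) = (if lies_below LM e then
      (if fst d1 = 0 \<or> lies_above LM d1 then 3 else 1) else 1)"
    and LM: "\<exists>uI. dray LM (0, uI)" if "0 < fst uL" "LM = LM_curve g BL BR uL" for uL LM
  proof -
    show "\<exists>uI. dray LM (0, uI)" using LM_curve_dray[OF g_pos B that(1)] that(2) by simp
    then obtain uI where LM: "dray LM (0, uI)" by blast
    note LM' = LM[unfolded that(2)]
    have or: "lies_above LM d1 \<or> lies_below LM e" by (rule lies_above_or_below(1)[OF LM d0(2) le])
    note card = card_solutions_three_branches[OF D(1) branch_solutions_ray[OF LM' D(2) d0(1)]
        branch_solutions_arc[OF LM' D(3) d0(2)] branch_solutions_arc[OF LM' D2], folded that(2)]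
    show "card (solutions g BL BR uL uR) = (if lies_below LM e then
      (if fst d1 = 0 \<or> lies_above LM d1 then 3 else 1) else 1)"
      unfolding card using D(5) or by auto
  qed
  show "card (solutions g BL BR uL uR) \<in> {1, 3}" if "0 < fst uL" using count[OF that refl] by simp
  have "0 < sqrt (g * fst e)" using e g_pos by simp
  have F_e: "- 1 \<le> froude g (fst e, t * snd e)" if "0 < t" "t \<le> 1" for t
  proof -
    have "\<bar>snd e\<bar> \<le> sqrt (g * fst e)" using real_sqrt_le_mono[OF e(3)] unfolding real_sqrt_abs .
    then have "- sqrt (g * fst e) \<le> snd e" by linarith
    also have "\<dots> \<le> t * snd e" using that e(2) by (simp add: mult_le_cancel_right2)
    finally show ?thesis using froude_ge_iff[OF g_pos e(1), of "- 1" "t * snd e"] by simp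
  qed
  show "\<exists>uL. 0 < fst uL \<and> card (solutions g BL BR uL uR) = 3"
  proof -
    define LM where "LM = LM_curve g BL BR e"
    obtain uI where "dray LM (0, uI)" using LM[OF e(1) LM_def] by blast
    moreover have "e \<in> LM"
      unfolding LM_def using F_e[of 1] by (intro LM_curve_self[OF g_pos e(1,2)]) simp
    ultimately have "lies_above LM d1 \<and> lies_below LM e" using lies_above_or_below(2) d0(2) le by blast
    then show ?thesis using count[OF e(1) LM_def] e(1) by (intro exI[of _ e]) simp
  qed
  show "\<exists>uL. 0 < fst uL \<and> card (solutions g BL BR uL uR) = 1"
  proof -
    \<comment> \<open>As \<open>snd e < 0\<close>, halving the velocity keeps the state subcritical
      and puts the L-M curve strictly above \<open>e\<close>.\<close>
    define uL where "uL = (fst e, 1 / 2 * snd e)"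
    define LM where "LM = LM_curve g BL BR uL"
    have uL: "0 < fst uL" "snd uL < 0" using e by (auto simp: uL_def)
    obtain uI where "dray LM (0, uI)" using LM[OF uL(1) LM_def] by blast
    moreover have "uL \<in> LM"
      unfolding LM_def using F_e[of "1 / 2"] by (intro LM_curve_self[OF g_pos uL]) (simp add: uL_def)
    ultimately have "\<not> lies_below LM e"
      using lies_above_or_below(3)[of LM uI d1 e "1 / 2 * snd e"] d0(2) le e(2) by (simp add: uL_def)
    then show ?thesis using count[OF uL(1) LM_def] uL(1) by (intro exI[of _ uL]) simp
  qed
qed

end

theorem theorem1:
  fixes g B\<^sub>L B\<^sub>R r :: real
  assumes "g > 0" and "0 < B\<^sub>L" and "B\<^sub>L < B\<^sub>R" and "r = B\<^sub>L / B\<^sub>R"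
  shows "(\<forall>h\<^sub>L u\<^sub>L h\<^sub>R u\<^sub>R. h\<^sub>L > 0 \<and> h\<^sub>R > 0 \<longrightarrow>
            solutions g B\<^sub>L B\<^sub>R (h\<^sub>L, u\<^sub>L) (h\<^sub>R, u\<^sub>R) \<noteq> {})
       \<and> (\<forall>h\<^sub>R u\<^sub>R. h\<^sub>R > 0 \<and> froude g (h\<^sub>R, u\<^sub>R) > - K_sp r \<longrightarrow>
            (\<forall>h\<^sub>L u\<^sub>L. h\<^sub>L > 0 \<longrightarrow>
               card (solutions g B\<^sub>L B\<^sub>R (h\<^sub>L, u\<^sub>L) (h\<^sub>R, u\<^sub>R)) = 1))
       \<and> (\<forall>h\<^sub>R u\<^sub>R. h\<^sub>R > 0 \<and> froude g (h\<^sub>R, u\<^sub>R) \<le> - K_sp r \<longrightarrow>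
            (\<forall>h\<^sub>L u\<^sub>L. h\<^sub>L > 0 \<longrightarrow>
               card (solutions g B\<^sub>L B\<^sub>R (h\<^sub>L, u\<^sub>L) (h\<^sub>R, u\<^sub>R)) \<in> {1, 3})
          \<and> (\<exists>h\<^sub>L u\<^sub>L. h\<^sub>L > 0 \<and>
               card (solutions g B\<^sub>L B\<^sub>R (h\<^sub>L, u\<^sub>L) (h\<^sub>R, u\<^sub>R)) = 1)
          \<and> (\<exists>h\<^sub>L u\<^sub>L. h\<^sub>L > 0 \<and>
               card (solutions g B\<^sub>L B\<^sub>R (h\<^sub>L, u\<^sub>L) (h\<^sub>R, u\<^sub>R)) = 3))"
proof -
  note single = card_solutions_single[OF assms(1-3), folded assms(4)]
  note triple = card_solutions_triple[OF assms(1-3), folded assms(4)]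
  have one: "card (solutions g B\<^sub>L B\<^sub>R (h\<^sub>L, u\<^sub>L) (h\<^sub>R, u\<^sub>R)) = 1"
    if "h\<^sub>L > 0" "h\<^sub>R > 0" "froude g (h\<^sub>R, u\<^sub>R) > - K_sp r" for h\<^sub>L u\<^sub>L h\<^sub>R u\<^sub>R
    using single[of "(h\<^sub>L, u\<^sub>L)" "(h\<^sub>R, u\<^sub>R)"] that by simp
  have three: "card (solutions g B\<^sub>L B\<^sub>R (h\<^sub>L, u\<^sub>L) (h\<^sub>R, u\<^sub>R)) \<in> {1, 3}"
    if "h\<^sub>L > 0" "h\<^sub>R > 0" "froude g (h\<^sub>R, u\<^sub>R) \<le> - K_sp r" for h\<^sub>L u\<^sub>L h\<^sub>R u\<^sub>R
    using triple(1)[of "(h\<^sub>R, u\<^sub>R)" "(h\<^sub>L, u\<^sub>L)"] that by simp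
  have ex: "\<exists>h\<^sub>L u\<^sub>L. h\<^sub>L > 0 \<and> card (solutions g B\<^sub>L B\<^sub>R (h\<^sub>L, u\<^sub>L) (h\<^sub>R, u\<^sub>R)) = n"
    if R: "h\<^sub>R > 0" "froude g (h\<^sub>R, u\<^sub>R) \<le> - K_sp r" "n = 1 \<or> n = 3" for h\<^sub>R u\<^sub>R n
  proof -
    obtain u where "0 < fst u" "card (solutions g B\<^sub>L B\<^sub>R u (h\<^sub>R, u\<^sub>R)) = n"
      using triple(2,3)[of "(h\<^sub>R, u\<^sub>R)"] R by auto
    then show ?thesis by (intro exI[of _ "fst u"] exI[of _ "snd u"]) simp
  qed
  have nonempty: "solutions g B\<^sub>L B\<^sub>R (h\<^sub>L, u\<^sub>L) (h\<^sub>R, u\<^sub>R) \<noteq> {}" if "h\<^sub>L > 0 \<and> h\<^sub>R > 0" for h\<^sub>L u\<^sub>L h\<^sub>R u\<^sub>R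
  proof
    assume empty: "solutions g B\<^sub>L B\<^sub>R (h\<^sub>L, u\<^sub>L) (h\<^sub>R, u\<^sub>R) = {}"
    have "froude g (h\<^sub>R, u\<^sub>R) > - K_sp r \<or> froude g (h\<^sub>R, u\<^sub>R) \<le> - K_sp r" by linarith
    then show False using one[of h\<^sub>L h\<^sub>R u\<^sub>R u\<^sub>L] three[of h\<^sub>L h\<^sub>R u\<^sub>R u\<^sub>L] that by (auto simp: empty)
  qed
  show ?thesis
    by (intro conjI allI impI; (elim conjE)?; (rule nonempty one three ex)?; simp)
qed

end
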